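(* Let $(Q,I)$ be a gentle presentation with $Q$ (finite and connected and) having more than one vertex, let $A=\Bbbk Q/I$ and let $T$ be a spanning tree of $Q$. If $u$ is an element of the generating set $\mathscr G$ of $\mathrm{HH}^*(A)$ and $v$ is an element of the basis $\mathscr H$ of $\mathrm{HH}_*(A)$ (both described in the context) such that the cap product $v\frown u$ is not zero in $\mathrm{HH}_*(A)$, then one of the following statements holds (equalities in $\mathrm{HH}_*(A)$): (i) There are an arrow $c\in Q_1\setminus T$ and a cocomplete circuit $C$ in which $c$ appears such that $u=(c,c)$, $v=\llbracket\bar C\rrbracket$ and $v\frown u=(\bar C,s(\bar C))$. (ii) There are an arrow $c\in Q_1\setminus T$ and a complete circuit $C$ in which $c$ appears, whose length $m$ and period $r$ are such that $(-1)^{(m+1)r}=1$ in $\Bbbk$, such that $u=(c,c)$, $v=\llbracket\bar C\rrbracket$ and $v\frown u=(-1)^{m+1}(\ell(\bar C),\ell'(\bar C))$. (iii) There are $\alpha\in\overline{\mathscr C}^{\mathsf{basic}}(\mathcal B)$ and a vertex $e$ of $Q$ through which the cycle $\alpha$ passes such that $u=\langle\langle\alpha\rangle\rangle$, $v=(e,e)$ and $v\frown u=(\alpha,s(\alpha))$. (iv) There are $\alpha\in\overline{\mathscr C}^{\mathsf{basic}}(\mathcal B)$ and an integer $k\ge1$ such that $u=\langle\langle\alpha\rangle\rangle$, $v=(\alpha^k,s(\alpha^k))$ and $v\frown u=(\alpha^{k+1},s(\alpha^{k+1}))$. (v) There are $\alpha\in\overline{\mathscr C}^{\mathsf{basic}}(\mathcal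 B)$ and an integer $k\ge1$ such that $u=\langle\langle\alpha\rangle\rangle$, $v=\llbracket\alpha^k\rrbracket$ and $v\frown u=\llbracket\alpha^{k+1}\rrbracket$. (vi) There are a circuit $C$ with $\bar C\in\overline{\mathscr C}^{\mathsf{basic}}(\Gamma)$, a complete circuit $D$ whose length $n$ and period $r$ are such that $(-1)^{(n+1)r}=1$ in $\Bbbk$, a primitive circuit $E$ and non-negative integers $w,k$ with $k\ge w$ such that $\bar C=\bar E^w$, $\bar D=\bar E^k$, $u=\langle\langle\bar C\rangle\rangle$, $v=\llbracket\bar D\rrbracket$, and $$v\frown u=\begin{cases}\sum_{i=0}^{r-1}(-1)^i\,(s(\mathrm{rot}^i(\bar E)),s(\mathrm{rot}^i(\bar E)))&\text{if }k=w;\\ \llbracket\bar E^{k-w}\rrbracket&\text{if }k>w.\end{cases}$$ (vii) There are a circuit $C$ with $\bar C\in\overline{\mathscr C}^{\mathsf{basic}}(\Gamma)$, a complete circuit $D$ whose length $n+1$ and period $t$ are such that $(-1)^{nt}=1$ in $\Bbbk$, a primitive circuit $E$ and non-negative integers $w,k$ with $k>w$ such that $\bar C=\bar E^w$, $\bar D=\bar E^k$, $u=\langle\langle\bar C\rangle\rangle$, $v=(\ell(\bar D),\ell'(\bar D))$, and $v\frown u=(\ell(\bar E^{k-w}),\ell'(\bar E^{k-w}))$.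
   Context: $\Bbbk$ is a field. Paths in $Q=(Q_0,Q_1,s,t)$ are written from right to left ($c_m\cdots c_1$ has first arrow $c_1$, last arrow $c_m$); vertices are the paths of length $0$. $(Q,I)$ is a gentle presentation: $I$ is an ideal of $\Bbbk Q$ generated by paths of length $2$; every vertex is the source of at most two and the target of at most two arrows; for every arrow $a$ there is at most one arrow $b$ with $t(b)=s(a)$ and $ab\notin I$, at most one arrow $c$ with $t(a)=s(c)$ and $ca\notin I$, at most one arrow $b$ with $t(b)=s(a)$ and $ab\in I$, and at most one arrow $c$ with $t(a)=s(c)$ and $ca\in I$. $R$ is the set of paths of length $2$ in $I$; $\mathcal B$ the set of paths with no subpath in $R$; $\Gamma$ the set of paths all of whose subpaths of length $2$ are in $R$; $\Gamma_m$ its subset of paths of length $m$. A path is $\mathcal B$-maximal (resp. $\Gamma$-maximal) if it is in $\mathcal B$ (resp. $\Gamma$) and is not a proper subpath of another element of that set. A spanning tree is the set of arrows of a connected subquiver, acyclic as an undirected graph, containing all vertices. For a path $\alpha$ of positive length, $\ell(\alpha)$ and $f(\alpha)$ are its last and first arrows, and $\ell'(\alpha)$, $f'(\alpha)$ are the paths with $\alpha=\ell(\alpha)\ell'(\alpha)=f'(\alpha)f(\alpha)$. Cohomology: $\Gamma_m\parallel\mathcal B$ is the set of pairs $(\gamma,\alpha)\in\Gamma_m\times\mathcal B$ with the same source and the same target; $\Bbbk(\Gamma\parallel\mathcal B)$ is the complex with $d^m(\gamma,\alpha)=\sum_b(b\gamma,b\alpha)-(-1)^m\sum_a(\gamma a,\alpha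 a)$ (sums over arrows for which the pair is in $\Gamma_{m+1}\parallel\mathcal B$), whose cohomology is $\mathrm{HH}^*(A)$. Homology: $\mathcal B\odot\Gamma_m$ is the set of pairs $(\alpha,\gamma)\in\mathcal B\times\Gamma_m$ with $s(\alpha)=t(\gamma)$, $t(\alpha)=s(\gamma)$; $\Bbbk(\mathcal B\odot\Gamma)$ is the complex with $d_m(\alpha,\gamma)=(\alpha\ell(\gamma),\ell'(\gamma))+(-1)^m(f(\gamma)\alpha,f'(\gamma))$ (pairs with first component in $I$ being $0$), whose homology is $\mathrm{HH}_*(A)$. The cap product is induced by the map such that for $(a,x)\in\mathcal B\odot\Gamma_p$ and $(y,b)\in\Gamma_q\parallel\mathcal B$ one has $(a,x)\frown(y,b)=(-1)^{(p+q)q}(ab,z)$ if $x$ factorizes as $yz$ (read as $0$ if $ab\in I$), and $0$ otherwise. A cycle is a path of positive length with equal source and target; $\mathrm{rot}(c_m\cdots c_1)=c_{m-1}\cdots c_1c_m$; circuits are classes of cycles under rotation; the period of a cycle $C$ is the least $i\ge1$ with $\mathrm{rot}^i(C)=C$; a cycle is primitive if it is not a proper power of another cycle. A cycle $C$ is complete if $C^2\in\Gamma$, cocomplete if $C^2\in\mathcal B$. Fix one representative of each primitive complete and each primitive cocomplete circuit; for every complete or cocomplete circuit $C$, $\bar C$ is the cycle in $C$ that is a power of one of these representatives. $\overline{\mathscr C}^{\mathsf{basic}}(\mathcal B)$ is the set of the chosen primitive cocomplete cycles. $\overline{\mathscr C}^{\mathsf{basic}}(\Gamma)$ consists of the chosen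 primitive complete cycles $D$ if $\mathrm{char}\,\Bbbk=2$, and otherwise of those $D$ of even length and the squares $D^2$ of those of odd length. $\mathscr G$ is the set of classes of: the pairs $(s(\alpha),\alpha)$ with $\alpha$ a $\mathcal B$-maximal cycle; $\langle\langle\alpha\rangle\rangle=\sum_{i=0}^{r-1}(s(\mathrm{rot}^i\alpha),\mathrm{rot}^i\alpha)$ for $\alpha\in\overline{\mathscr C}^{\mathsf{basic}}(\mathcal B)$ of period $r$; the pairs $(c,c)$ with $c\in Q_1\setminus T$; the pairs $(\gamma,\alpha)\in\Gamma\parallel\mathcal B$ with $\gamma$ $\Gamma$-maximal and $\gamma,\alpha$ neither beginning nor ending with the same arrow; $\langle\langle C\rangle\rangle=\sum_{i=0}^{r-1}(\mathrm{rot}^iC,s(\mathrm{rot}^iC))$ for $C\in\overline{\mathscr C}^{\mathsf{basic}}(\Gamma)$ of period $r$. $\mathscr H$ is the set of classes of: $(e,e)$ for each vertex $e$; for each cocomplete circuit $C$ of period $r$, the $0$-cycle $(\bar C,s(\bar C))$ and the $1$-cycle $\llbracket\bar C\rrbracket=\sum_{i=0}^{r-1}(f'(\mathrm{rot}^i\bar C),f(\mathrm{rot}^i\bar C))$; for each complete circuit $C$ of length $m$ and period $r$ with $(-1)^{(m+1)r}=1$ in $\Bbbk$, the $m$-cycle $\llbracket\bar C\rrbracket=\sum_{i=0}^{r-1}(-1)^{(m+1)i}(s(\mathrm{rot}^i\bar C),\mathrm{rot}^i\bar C)$ and the $(m-1)$-cycle $(\ell(\bar C),\ell'(\bar C))$.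 It is a basis of $\mathrm{HH}_*(A)$.
   Formalization: In (iii) the product is N·(α,s(α)), where N≥1 counts how often α passes through e; the printed formula, without N, fails if N=2 and char 𝕜≠2 (e.g. arrows x:e→f, y:f→e, z:e→e, I=(xy,zz), α=zyx). *)

theory Defs
  imports
    Graph_Theory.Digraph_Component
    "HOL-Algebra.Ideal"
    "HOL-Library.Poly_Mapping"
begin

section \<open>Finitely supported linear combinations\<close>

definition scale :: "'k::field \<Rightarrow> ('b \<Rightarrow>\<^sub>0 'k) \<Rightarrow> 'b \<Rightarrow>\<^sub>0 'k" where
  "scale c x = Poly_Mapping.map ((*) c) x"

definition bas :: "'b \<Rightarrow> 'b \<Rightarrow>\<^sub>0 'k::field" where
  "bas b = Poly_Mapping.single b 1"

text \<open>The linear extension of a map given on basis elements.\<close>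

definition lin_ext :: "('b \<Rightarrow> 'c \<Rightarrow>\<^sub>0 'k::field) \<Rightarrow> ('b \<Rightarrow>\<^sub>0 'k) \<Rightarrow> 'c \<Rightarrow>\<^sub>0 'k" where
  "lin_ext f x = (\<Sum>b\<in>Poly_Mapping.keys x. scale (Poly_Mapping.lookup x b) (f b))"


lemma lookup_scale: "Poly_Mapping.lookup (scale c x) b = c * Poly_Mapping.lookup x b"
  by (simp add: scale_def Poly_Mapping.map.rep_eq when_def)

lemma scale_add: "scale c (x + y) = scale c x + scale c y"
  by (rule poly_mapping_eqI) (simp add: lookup_scale lookup_add algebra_simps)

lemma scale_zero [simp]: "scale c 0 = 0" "scale 0 x = 0"
  by (rule poly_mapping_eqI, simp add: lookup_scale)+

lemma scale_one [simp]: "scale 1 x = x"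
  by (rule poly_mapping_eqI) (simp add: lookup_scale)

lemma scale_left_add: "scale (c + d) x = scale c x + scale d x"
  by (rule poly_mapping_eqI) (simp add: lookup_scale lookup_add algebra_simps)

lemma scale_scale: "scale c (scale d x) = scale (c * d) x"
  by (rule poly_mapping_eqI) (simp add: lookup_scale)

lemma scale_sum: "scale c (sum f A) = (\<Sum>a\<in>A. scale c (f a))"
  by (induction A rule: infinite_finite_induct) (simp_all add: scale_add)

lemma keys_scale: "Poly_Mapping.keys (scale c x) \<subseteq> Poly_Mapping.keys x"
  by (auto simp: in_keys_iff lookup_scale)

lemma keys_bas [simp]: "Poly_Mapping.keys (bas b :: _ \<Rightarrow>\<^sub>0 'k::field) = {b}"
  by (simp add: bas_def)

lemma lin_ext_superset:
  assumes "finite A" "Poly_Mapping.keys x \<subseteq> A"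
  shows "lin_ext f x = (\<Sum>b\<in>A. scale (Poly_Mapping.lookup x b) (f b))"
  unfolding lin_ext_def
  by (rule sum.mono_neutral_left) (use assms in \<open>auto simp: in_keys_iff\<close>)

lemma lin_ext_zero [simp]: "lin_ext f 0 = 0"
  by (simp add: lin_ext_def)

lemma lin_ext_bas [simp]: "lin_ext f (bas b) = f b"
  unfolding lin_ext_def by (simp only: keys_bas) (simp add: bas_def)

lemma lin_ext_add: "lin_ext f (x + y) = lin_ext f x + lin_ext f y"
proof -
  let ?A = "Poly_Mapping.keys x \<union> Poly_Mapping.keys y"
  have "lin_ext f (x + y) = (\<Sum>b\<in>?A. scale (Poly_Mapping.lookup (x + y) b) (f b))"
    by (rule lin_ext_superset) (use keys_add[of x y] in auto)
  also have "\<dots> = (\<Sum>b\<in>?A. scale (Poly_Mapping.lookup x b) (f b))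
      + (\<Sum>b\<in>?A. scale (Poly_Mapping.lookup y b) (f b))"
    by (simp add: lookup_add scale_left_add sum.distrib)
  also have "\<dots> = lin_ext f x + lin_ext f y"
    by (simp add: lin_ext_superset[of ?A])
  finally show ?thesis .
qed

lemma lin_ext_scale: "lin_ext f (scale c x) = scale c (lin_ext f x)"
  by (subst lin_ext_superset[OF _ keys_scale])
     (simp_all add: lin_ext_def scale_sum scale_scale lookup_scale)

lemma lin_ext_sum: "lin_ext f (sum g A) = (\<Sum>a\<in>A. lin_ext f (g a))"
  by (induction A rule: infinite_finite_induct) (simp_all add: lin_ext_add)

lemma lin_ext_cong:
  assumes "\<And>b. b \<in> Poly_Mapping.keys x \<Longrightarrow> f b = g b"
  shows "lin_ext f x = lin_ext g x"
  unfolding lin_ext_def using assms by (intro sum.cong) auto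

lemma lin_ext_fun_add: "lin_ext (\<lambda>b. f b + g b) x = lin_ext f x + lin_ext g x"
  by (simp add: lin_ext_def scale_add sum.distrib)

lemma lin_ext_fun_zero [simp]: "lin_ext (\<lambda>b. 0) x = 0"
  by (simp add: lin_ext_def)

lemma lin_ext_lin_ext: "lin_ext f (lin_ext g x) = lin_ext (\<lambda>b. lin_ext f (g b)) x"
  unfolding lin_ext_def[of g] lin_ext_sum lin_ext_scale by (simp add: lin_ext_def)

lemma lin_ext_swap: "lin_ext (\<lambda>p. lin_ext (f p) y) x = lin_ext (\<lambda>q. lin_ext (\<lambda>p. f p q) x) y"
  unfolding lin_ext_def scale_sum scale_scale by (subst sum.swap) (simp only: mult.commute)

lemma lin_ext_bas_id [simp]: "lin_ext bas x = x"
proof (rule poly_mapping_eqI)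
  fix b
  have "Poly_Mapping.lookup (lin_ext bas x) b =
      (\<Sum>c\<in>Poly_Mapping.keys x. Poly_Mapping.lookup x c * (if c = b then 1 else 0))"
    by (simp add: lin_ext_def lookup_sum lookup_scale bas_def lookup_single when_def)
  also have "\<dots> = Poly_Mapping.lookup x b"
    by (simp add: if_distrib in_keys_iff cong: if_cong)
  finally show "Poly_Mapping.lookup (lin_ext bas x) b = Poly_Mapping.lookup x b" .
qed

lemma keys_lin_ext:
  "Poly_Mapping.keys (lin_ext f x) \<subseteq> (\<Union>b\<in>Poly_Mapping.keys x. Poly_Mapping.keys (f b))"
  unfolding lin_ext_def using keys_sum keys_scale by fastforce


section \<open>Quivers, paths and the path algebra\<close>

text \<open>
  Quivers are digraphs of the library, with \<open>s = tail\<close> and \<open>t = head\<close>. A path consists of its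
  source and the list of its arrows in the order in which they are written, so the list
  \<open>[c\<^sub>m, \<dots>, c\<^sub>1]\<close> stands for \<open>c\<^sub>m \<cdots> c\<^sub>1\<close>, whose first arrow is \<open>c\<^sub>1\<close>. The source component is what
  tells the paths of length 0 apart.
\<close>

datatype ('v, 'a) path = Path (src: 'v) (arrows: "'a list")

definition tgt :: "('v, 'a) pre_digraph \<Rightarrow> ('v, 'a) path \<Rightarrow> 'v" where
  "tgt Q p = (if arrows p = [] then src p else head Q (hd (arrows p)))"

definition paths :: "('v, 'a) pre_digraph \<Rightarrow> ('v, 'a) path set" where
  "paths Q = {p. pre_digraph.awalk Q (src p) (rev (arrows p)) (tgt Q p)}"

abbreviation len :: "('v, 'a) path \<Rightarrow> nat" where
  "len p \<equiv> length (arrows p)"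

definition vert :: "'v \<Rightarrow> ('v, 'a) path" where
  "vert e = Path e []"

definition arrow :: "('v, 'a) pre_digraph \<Rightarrow> 'a \<Rightarrow> ('v, 'a) path" where
  "arrow Q c = Path (tail Q c) [c]"

text \<open>The product is meaningful only if \<open>src p = tgt Q q\<close>.\<close>

definition pcomp :: "('v, 'a) path \<Rightarrow> ('v, 'a) path \<Rightarrow> ('v, 'a) path" (infixr \<open>\<cdot>\<close> 70) where
  "p \<cdot> q = Path (src q) (arrows p @ arrows q)"

definition subpath :: "('v, 'a) pre_digraph \<Rightarrow> ('v, 'a) path \<Rightarrow> ('v, 'a) path \<Rightarrow> bool" where
  "subpath Q q p \<longleftrightarrow> (\<exists>g\<in>paths Q. \<exists>d\<in>paths Q.
     q \<in> paths Q \<and> src g = tgt Q q \<and> src q = tgt Q d \<and> p = g \<cdot> q \<cdot> d)"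

text \<open>
  For a path \<open>p\<close> of positive length: its last arrow \<open>\<ell>(p)\<close> and its first arrow \<open>f(p)\<close>, as paths,
  and the paths with \<open>p = \<ell>(p) \<cdot> \<ell>'(p) = f'(p) \<cdot> f(p)\<close>.
\<close>

definition last_arrow :: "('v, 'a) pre_digraph \<Rightarrow> ('v, 'a) path \<Rightarrow> ('v, 'a) path" where
  "last_arrow Q p = arrow Q (hd (arrows p))"

definition drop_last :: "('v, 'a) path \<Rightarrow> ('v, 'a) path" where
  "drop_last p = Path (src p) (tl (arrows p))"

definition first_arrow :: "('v, 'a) pre_digraph \<Rightarrow> ('v, 'a) path \<Rightarrow> ('v, 'a) path" where
  "first_arrow Q p = arrow Q (last (arrows p))"

definition drop_first :: "('v, 'a) pre_digraph \<Rightarrow> ('v, 'a) path \<Rightarrow> ('v, 'a) path" where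
  "drop_first Q p = Path (head Q (last (arrows p))) (butlast (arrows p))"

definition path_mult ::
  "('v, 'a) pre_digraph \<Rightarrow> (('v, 'a) path \<Rightarrow>\<^sub>0 'k::field) \<Rightarrow> (('v, 'a) path \<Rightarrow>\<^sub>0 'k) \<Rightarrow> ('v, 'a) path \<Rightarrow>\<^sub>0 'k"
  where
  "path_mult Q x y =
     lin_ext (\<lambda>p. lin_ext (\<lambda>q. if src p = tgt Q q then bas (p \<cdot> q) else 0) y) x"

definition path_algebra :: "('v, 'a) pre_digraph \<Rightarrow> (('v, 'a) path \<Rightarrow>\<^sub>0 'k::field) ring" where
  "path_algebra Q =
     \<lparr> carrier = {x. Poly_Mapping.keys x \<subseteq> paths Q}, mult = path_mult Q,
       one = (\<Sum>e\<in>verts Q. bas (vert e)), zero = 0, add = (+) \<rparr>"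


lemma tgt_pcomp: "src p = tgt Q q \<Longrightarrow> tgt Q (p \<cdot> q) = tgt Q p"
  by (auto simp: tgt_def pcomp_def)

lemma src_pcomp [simp]: "src (p \<cdot> q) = src q"
  by (simp add: pcomp_def)

lemma pcomp_assoc: "(p \<cdot> q) \<cdot> r = p \<cdot> q \<cdot> r"
  by (simp add: pcomp_def)

lemma pcomp_in_paths:
  assumes "wf_digraph Q" "p \<in> paths Q" "q \<in> paths Q" "src p = tgt Q q"
  shows "p \<cdot> q \<in> paths Q"
proof -
  have "pre_digraph.awalk Q (src q) (rev (arrows q) @ rev (arrows p)) (tgt Q p)"
    by (rule wf_digraph.awalk_appendI[OF assms(1)])
       (use assms in \<open>simp_all add: paths_def\<close>)
  then show ?thesis
    unfolding paths_def mem_Collect_eq tgt_pcomp[OF assms(4)] by (simp add: pcomp_def)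
qed

lemma vert_in_paths: "e \<in> verts Q \<Longrightarrow> vert e \<in> paths Q"
  by (simp add: paths_def vert_def tgt_def pre_digraph.awalk_def pre_digraph.cas.simps)

lemma src_tgt_in_verts:
  assumes "wf_digraph Q" "p \<in> paths Q"
  shows "src p \<in> verts Q" "tgt Q p \<in> verts Q"
proof -
  have "pre_digraph.awalk Q (src p) (rev (arrows p)) (tgt Q p)"
    using assms(2) by (simp only: paths_def mem_Collect_eq)
  then show "src p \<in> verts Q" "tgt Q p \<in> verts Q"
    by (rule wf_digraph.awalk_hd_in_verts[OF assms(1)] wf_digraph.awalk_last_in_verts[OF assms(1)])+
qed

text \<open>In particular, ideals generated by sets of paths are meaningful for finite quivers.\<close>

lemma ring_path_algebra:
  assumes "fin_digraph Q"
  shows "ring (path_algebra Q :: (('v, 'a) path \<Rightarrow>\<^sub>0 'k::field) ring)"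
proof -
  interpret fin_digraph Q by (rule assms)
  let ?R = "path_algebra Q :: (('v, 'a) path \<Rightarrow>\<^sub>0 'k) ring"
  let ?P = "\<lambda>x :: ('v, 'a) path \<Rightarrow>\<^sub>0 'k. Poly_Mapping.keys x \<subseteq> paths Q"
  let ?e = "(\<Sum>e\<in>verts Q. bas (vert e)) :: ('v, 'a) path \<Rightarrow>\<^sub>0 'k"
  have mult_closed: "?P (path_mult Q x y)" if "?P x" "?P y" for x y
  proof -
    have "?P (lin_ext (\<lambda>q. if src p = tgt Q q then bas (p \<cdot> q) else 0) y)" if "p \<in> paths Q" for p
    proof (rule order_trans[OF keys_lin_ext UN_least])
      fix q assume "q \<in> Poly_Mapping.keys y"
      with \<open>?P y\<close> have "q \<in> paths Q" by (rule subsetD)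
      then have "p \<cdot> q \<in> paths Q" if "src p = tgt Q q"
        using that by (rule pcomp_in_paths[OF wf_digraph \<open>p \<in> paths Q\<close>])
      then show "?P (if src p = tgt Q q then bas (p \<cdot> q) else 0)"
        by simp
    qed
    from this[OF subsetD[OF \<open>?P x\<close>]] show ?thesis
      unfolding path_mult_def by (rule order_trans[OF keys_lin_ext UN_least])
  qed
  have one_closed: "?P ?e"
    using keys_sum[of "\<lambda>e. bas (vert e) :: ('v, 'a) path \<Rightarrow>\<^sub>0 'k" "verts Q"] vert_in_paths
    by fastforce
  have mult_bas: "path_mult Q (bas p) (bas q) = (if src p = tgt Q q then bas (p \<cdot> q) else 0)"
    for p q :: "('v, 'a) path"
    by (simp add: path_mult_def)
  have lmult: "path_mult Q x y = lin_ext (\<lambda>p. path_mult Q (bas p) y) x"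
    for x y :: "('v, 'a) path \<Rightarrow>\<^sub>0 'k"
    by (simp add: path_mult_def)
  have rmult: "path_mult Q x y = lin_ext (\<lambda>q. path_mult Q x (bas q)) y"
    for x y :: "('v, 'a) path \<Rightarrow>\<^sub>0 'k"
    unfolding path_mult_def lin_ext_bas by (rule lin_ext_swap)
  have l_add: "path_mult Q (x + y) z = path_mult Q x z + path_mult Q y z"
    for x y z :: "('v, 'a) path \<Rightarrow>\<^sub>0 'k"
    by (simp add: path_mult_def lin_ext_add)
  have r_add: "path_mult Q x (y + z) = path_mult Q x y + path_mult Q x z"
    for x y z :: "('v, 'a) path \<Rightarrow>\<^sub>0 'k"
    by (simp add: path_mult_def lin_ext_add lin_ext_fun_add)
  have assoc_bas: "path_mult Q (path_mult Q (bas p) (bas q)) (bas r)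
      = path_mult Q (bas p) (path_mult Q (bas q) (bas r) :: ('v, 'a) path \<Rightarrow>\<^sub>0 'k)"
    for p q r :: "('v, 'a) path"
    by (auto simp: mult_bas tgt_pcomp pcomp_assoc) (auto simp: path_mult_def)
  have assoc: "path_mult Q (path_mult Q x y) z = path_mult Q x (path_mult Q y z)"
    for x y z :: "('v, 'a) path \<Rightarrow>\<^sub>0 'k"
  proof -
    have 1: "path_mult Q (path_mult Q (bas p) (bas q)) z
        = path_mult Q (bas p) (path_mult Q (bas q) z)" for p q
    proof -
      have "path_mult Q (path_mult Q (bas p) (bas q)) z
          = lin_ext (\<lambda>r. path_mult Q (bas p) (path_mult Q (bas q) (bas r))) z"
        by (subst rmult) (simp add: assoc_bas)
      also have "\<dots> = lin_ext (\<lambda>r. path_mult Q (bas p) (bas r)) (path_mult Q (bas q) z)"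
        by (subst rmult[of "bas q" z], subst lin_ext_lin_ext, rule lin_ext_cong) (rule rmult)
      finally show ?thesis by (simp add: rmult[of "bas p" "path_mult Q (bas q) z"])
    qed
    have 2: "path_mult Q (path_mult Q (bas p) y) z = path_mult Q (bas p) (path_mult Q y z)" for p
    proof -
      have "path_mult Q (path_mult Q (bas p) y) z
          = lin_ext (\<lambda>s. path_mult Q (bas s) z) (lin_ext (\<lambda>q. path_mult Q (bas p) (bas q)) y)"
        by (subst lmult, subst rmult[of "bas p" y]) simp
      also have "\<dots> = lin_ext (\<lambda>q. path_mult Q (path_mult Q (bas p) (bas q)) z) y"
        by (subst lin_ext_lin_ext, rule lin_ext_cong) (rule lmult[symmetric])
      also have "\<dots> = lin_ext (\<lambda>q. path_mult Q (bas p) (path_mult Q (bas q) z)) y"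
        by (simp add: 1)
      also have "\<dots> = lin_ext (\<lambda>q. path_mult Q (bas p) (bas q)) (path_mult Q y z)"
        by (subst lmult[of y z], subst lin_ext_lin_ext, rule lin_ext_cong) (rule rmult)
      finally show ?thesis by (simp add: rmult[of "bas p" "path_mult Q y z"])
    qed
    have "path_mult Q (path_mult Q x y) z
        = lin_ext (\<lambda>s. path_mult Q (bas s) z) (lin_ext (\<lambda>p. path_mult Q (bas p) y) x)"
      by (subst lmult, subst lmult[of x y]) simp
    also have "\<dots> = lin_ext (\<lambda>p. path_mult Q (path_mult Q (bas p) y) z) x"
      by (subst lin_ext_lin_ext, rule lin_ext_cong) (rule lmult[symmetric])
    also have "\<dots> = path_mult Q x (path_mult Q y z)"
      by (subst lmult[of x]) (simp add: 2)
    finally show ?thesis .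
  qed
  have mult_sum_l: "path_mult Q (sum f A) y = (\<Sum>a\<in>A. path_mult Q (f a) y)"
    for f :: "'v \<Rightarrow> ('v, 'a) path \<Rightarrow>\<^sub>0 'k" and A y
    by (simp add: path_mult_def lin_ext_sum)
  have l_one: "path_mult Q ?e x = x" if "?P x" for x
  proof -
    have "path_mult Q ?e (bas p) = bas p" if "p \<in> paths Q" for p
    proof -
      have "path_mult Q ?e (bas p)
          = (\<Sum>e\<in>verts Q. if e = tgt Q p then bas p else (0 :: ('v, 'a) path \<Rightarrow>\<^sub>0 'k))"
        unfolding mult_sum_l by (intro sum.cong refl) (simp add: mult_bas vert_def pcomp_def)
      then show ?thesis using src_tgt_in_verts[OF wf_digraph that] by simp
    qed
    then have "path_mult Q ?e x = lin_ext bas x"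
      by (subst rmult) (intro lin_ext_cong, use \<open>?P x\<close> in auto)
    then show ?thesis by simp
  qed
  have r_one: "path_mult Q x ?e = x" if "?P x" for x
  proof -
    have "path_mult Q (bas p) ?e = bas p" if "p \<in> paths Q" for p
    proof -
      have "path_mult Q (bas p) ?e
          = (\<Sum>e\<in>verts Q. path_mult Q (bas p) (bas (vert e) :: ('v, 'a) path \<Rightarrow>\<^sub>0 'k))"
        by (simp add: path_mult_def lin_ext_sum)
      also have "\<dots> = (\<Sum>e\<in>verts Q. if src p = e then bas p else 0)"
        by (intro sum.cong refl) (auto simp: mult_bas vert_def pcomp_def tgt_def)
      finally show ?thesis using src_tgt_in_verts[OF wf_digraph that] by simp
    qed
    then have "path_mult Q x ?e = lin_ext bas x"
      by (subst lmult) (intro lin_ext_cong, use \<open>?P x\<close> in auto)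
    then show ?thesis by simp
  qed
  show ?thesis
  proof (rule ringI)
    show "abelian_group ?R"
    proof (rule abelian_groupI)
      fix x assume "x \<in> carrier ?R"
      then show "\<exists>y\<in>carrier ?R. y \<oplus>\<^bsub>?R\<^esub> x = \<zero>\<^bsub>?R\<^esub>"
        by (intro bexI[of _ "- x"]) (auto simp: path_algebra_def)
    next
      fix x y assume "x \<in> carrier ?R" "y \<in> carrier ?R"
      then show "x \<oplus>\<^bsub>?R\<^esub> y \<in> carrier ?R"
        using keys_add[of x y] by (auto simp: path_algebra_def)
    qed (simp_all add: path_algebra_def add_ac)
    show "monoid ?R"
      by (rule monoidI)
        (use mult_closed one_closed assoc l_one r_one in \<open>simp_all add: path_algebra_def\<close>)
  qed (simp_all add: path_algebra_def l_add r_add)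
qed


section \<open>Spanning trees\<close>

text \<open>
  An undirected cycle of a quiver is a cycle of its double (every arrow may be traversed in both
  directions) that uses no arrow twice; so loops and pairs of parallel or opposite arrows
  give undirected cycles, but an arrow followed by its own reverse does not.
\<close>

definition double :: "('v, 'a) pre_digraph \<Rightarrow> ('v, 'a \<times> bool) pre_digraph" where
  "double Q = \<lparr> verts = verts Q, arcs = arcs Q \<times> UNIV,
     tail = (\<lambda>(c, b). if b then tail Q c else head Q c),
     head = (\<lambda>(c, b). if b then head Q c else tail Q c) \<rparr>"

definition undirected_acyclic :: "('v, 'a) pre_digraph \<Rightarrow> bool" where
  "undirected_acyclic Q \<longleftrightarrow> \<not> (\<exists>p. pre_digraph.cycle (double Q) p \<and> distinct (map fst p))"

definition is_spanning_tree :: "('v, 'a) pre_digraph \<Rightarrow> 'a set \<Rightarrow> bool" where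
  "is_spanning_tree Q T \<longleftrightarrow>
     T \<subseteq> arcs Q \<and> connected (Q\<lparr>arcs := T\<rparr>) \<and> undirected_acyclic (Q\<lparr>arcs := T\<rparr>)"


section \<open>Gentle presentations\<close>

definition gentle_presentation ::
  "('v, 'a) pre_digraph \<Rightarrow> (('v, 'a) path \<Rightarrow>\<^sub>0 'k::field) set \<Rightarrow> bool" where
  "gentle_presentation Q I \<longleftrightarrow>
     (\<exists>X \<subseteq> {p \<in> paths Q. len p = 2}. I = Idl\<^bsub>path_algebra Q\<^esub> (bas ` X)) \<and>
     (\<forall>e\<in>verts Q. card (out_arcs Q e) \<le> 2 \<and> card (in_arcs Q e) \<le> 2) \<and>
     (\<forall>a\<in>arcs Q.
        card {b \<in> arcs Q. head Q b = tail Q a \<and> bas (arrow Q a \<cdot> arrow Q b) \<notin> I} \<le> 1 \<and>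
        card {c \<in> arcs Q. head Q a = tail Q c \<and> bas (arrow Q c \<cdot> arrow Q a) \<notin> I} \<le> 1 \<and>
        card {b \<in> arcs Q. head Q b = tail Q a \<and> bas (arrow Q a \<cdot> arrow Q b) \<in> I} \<le> 1 \<and>
        card {c \<in> arcs Q. head Q a = tail Q c \<and> bas (arrow Q c \<cdot> arrow Q a) \<in> I} \<le> 1)"

definition rels ::
  "('v, 'a) pre_digraph \<Rightarrow> (('v, 'a) path \<Rightarrow>\<^sub>0 'k::field) set \<Rightarrow> ('v, 'a) path set" where
  "rels Q I = {p \<in> paths Q. len p = 2 \<and> bas p \<in> I}"

definition Bset ::
  "('v, 'a) pre_digraph \<Rightarrow> (('v, 'a) path \<Rightarrow>\<^sub>0 'k::field) set \<Rightarrow> ('v, 'a) path set" where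
  "Bset Q I = {p \<in> paths Q. \<not> (\<exists>q\<in>rels Q I. subpath Q q p)}"

definition Gam ::
  "('v, 'a) pre_digraph \<Rightarrow> (('v, 'a) path \<Rightarrow>\<^sub>0 'k::field) set \<Rightarrow> ('v, 'a) path set" where
  "Gam Q I = {p \<in> paths Q. \<forall>q. subpath Q q p \<and> len q = 2 \<longrightarrow> q \<in> rels Q I}"

definition maximal_in ::
  "('v, 'a) pre_digraph \<Rightarrow> ('v, 'a) path set \<Rightarrow> ('v, 'a) path \<Rightarrow> bool" where
  "maximal_in Q S p \<longleftrightarrow> p \<in> S \<and> \<not> (\<exists>q\<in>S. q \<noteq> p \<and> subpath Q p q)"


section \<open>Cycles and circuits\<close>

definition cycles :: "('v, 'a) pre_digraph \<Rightarrow> ('v, 'a) path set" where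
  "cycles Q = {p \<in> paths Q. 0 < len p \<and> src p = tgt Q p}"

definition rot :: "('v, 'a) pre_digraph \<Rightarrow> ('v, 'a) path \<Rightarrow> ('v, 'a) path" where
  "rot Q p = Path (tail Q (last (rotate1 (arrows p)))) (rotate1 (arrows p))"

abbreviation rotn :: "('v, 'a) pre_digraph \<Rightarrow> nat \<Rightarrow> ('v, 'a) path \<Rightarrow> ('v, 'a) path" where
  "rotn Q i \<equiv> rot Q ^^ i"

text \<open>The \<open>k\<close>-th power of a cycle; the power 0 is its source, a path of length 0.\<close>

definition cpow :: "('v, 'a) path \<Rightarrow> nat \<Rightarrow> ('v, 'a) path" where
  "cpow p k = Path (src p) (concat (replicate k (arrows p)))"

definition period :: "('v, 'a) pre_digraph \<Rightarrow> ('v, 'a) path \<Rightarrow> nat" where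
  "period Q p = (LEAST i. 1 \<le> i \<and> rotn Q i p = p)"

definition primitive :: "('v, 'a) pre_digraph \<Rightarrow> ('v, 'a) path \<Rightarrow> bool" where
  "primitive Q p \<longleftrightarrow> p \<in> cycles Q \<and> \<not> (\<exists>q\<in>cycles Q. \<exists>k\<ge>2. p = cpow q k)"

definition complete ::
  "('v, 'a) pre_digraph \<Rightarrow> (('v, 'a) path \<Rightarrow>\<^sub>0 'k::field) set \<Rightarrow> ('v, 'a) path \<Rightarrow> bool" where
  "complete Q I p \<longleftrightarrow> p \<in> cycles Q \<and> cpow p 2 \<in> Gam Q I"

definition cocomplete ::
  "('v, 'a) pre_digraph \<Rightarrow> (('v, 'a) path \<Rightarrow>\<^sub>0 'k::field) set \<Rightarrow> ('v, 'a) path \<Rightarrow> bool" where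
  "cocomplete Q I p \<longleftrightarrow> p \<in> cycles Q \<and> cpow p 2 \<in> Bset Q I"

definition circuit_of :: "('v, 'a) pre_digraph \<Rightarrow> ('v, 'a) path \<Rightarrow> ('v, 'a) path set" where
  "circuit_of Q p = {rotn Q i p |i. True}"

definition complete_circuits ::
  "('v, 'a) pre_digraph \<Rightarrow> (('v, 'a) path \<Rightarrow>\<^sub>0 'k::field) set \<Rightarrow> ('v, 'a) path set set" where
  "complete_circuits Q I = circuit_of Q ` {p. complete Q I p}"

definition cocomplete_circuits ::
  "('v, 'a) pre_digraph \<Rightarrow> (('v, 'a) path \<Rightarrow>\<^sub>0 'k::field) set \<Rightarrow> ('v, 'a) path set set" where
  "cocomplete_circuits Q I = circuit_of Q ` {p. cocomplete Q I p}"

definition primitive_circuits :: "('v, 'a) pre_digraph \<Rightarrow> ('v, 'a) path set set" where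
  "primitive_circuits Q = circuit_of Q ` {p. primitive Q p}"

text \<open>The circuits among whose elements a representative is chosen.\<close>

definition base_circuits ::
  "('v, 'a) pre_digraph \<Rightarrow> (('v, 'a) path \<Rightarrow>\<^sub>0 'k::field) set \<Rightarrow> ('v, 'a) path set set" where
  "base_circuits Q I =
     primitive_circuits Q \<inter> (complete_circuits Q I \<union> cocomplete_circuits Q I)"

definition circuit_reps ::
  "('v, 'a) pre_digraph \<Rightarrow> (('v, 'a) path \<Rightarrow>\<^sub>0 'k::field) set
    \<Rightarrow> (('v, 'a) path set \<Rightarrow> ('v, 'a) path) \<Rightarrow> bool" where
  "circuit_reps Q I rep \<longleftrightarrow> (\<forall>C\<in>base_circuits Q I. rep C \<in> C)"

text \<open>The cycle \<open>\<bar>C\<close>, for \<open>C\<close> a complete or cocomplete circuit.\<close>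

definition bar ::
  "('v, 'a) pre_digraph \<Rightarrow> (('v, 'a) path \<Rightarrow>\<^sub>0 'k::field) set
    \<Rightarrow> (('v, 'a) path set \<Rightarrow> ('v, 'a) path) \<Rightarrow> ('v, 'a) path set \<Rightarrow> ('v, 'a) path" where
  "bar Q I rep C = (THE p. p \<in> C \<and> (\<exists>P\<in>base_circuits Q I. \<exists>k\<ge>1. p = cpow (rep P) k))"

definition basic_B ::
  "('v, 'a) pre_digraph \<Rightarrow> (('v, 'a) path \<Rightarrow>\<^sub>0 'k::field) set
    \<Rightarrow> (('v, 'a) path set \<Rightarrow> ('v, 'a) path) \<Rightarrow> ('v, 'a) path set" where
  "basic_B Q I rep = rep ` (primitive_circuits Q \<inter> cocomplete_circuits Q I)"

definition basic_Gam ::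
  "('v, 'a) pre_digraph \<Rightarrow> (('v, 'a) path \<Rightarrow>\<^sub>0 'k::field) set
    \<Rightarrow> (('v, 'a) path set \<Rightarrow> ('v, 'a) path) \<Rightarrow> ('v, 'a) path set" where
  "basic_Gam Q I rep =
     (let Ds = rep ` (primitive_circuits Q \<inter> complete_circuits Q I) in
      if CHAR('k) = 2 then Ds
      else {D \<in> Ds. even (len D)} \<union> {cpow D 2 |D. D \<in> Ds \<and> odd (len D)})"

text \<open>
  The number of times the cycle \<open>p\<close> passes through the vertex \<open>e\<close>. A primitive cocomplete cycle
  can pass through a vertex twice: for arrows \<open>x: e \<rightarrow> f\<close>, \<open>y: f \<rightarrow> e\<close>, \<open>z: e \<rightarrow> e\<close> and \<open>I = (xy, zz)\<close>
  the cycle \<open>\<alpha> = zyx\<close> does so at \<open>e\<close>. The product \<open>(e,e) \<frown> \<langle>\<langle>\<alpha>\<rangle>\<rangle>\<close> has one summand \<open>(\<beta>, e)\<close> for every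
  rotation \<open>\<beta>\<close> of \<open>\<alpha>\<close> that starts at \<open>e\<close>, and each is homologous to \<open>(\<alpha>, s(\<alpha>))\<close>; so the product
  is \<open>(\<alpha>, s(\<alpha>))\<close> counted once per passage, here \<open>2 \<cdot> (\<alpha>, s(\<alpha>))\<close>.
\<close>

definition passes :: "('v, 'a) pre_digraph \<Rightarrow> ('v, 'a) path \<Rightarrow> 'v \<Rightarrow> nat" where
  "passes Q p e = card {i. i < len p \<and> tail Q (arrows p ! i) = e}"


section \<open>Hochschild cohomology\<close>

text \<open>
  Both complexes are handled as total (direct sum) complexes; the degree of a basis pair is the
  length of its component in \<open>\<Gamma>\<close>, and the differentials are homogeneous. A (co)homology
  class is represented by the coset of all (co)cycles that differ from a given one by a (co)boundary.
\<close>

definition coh_pairs ::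
  "('v, 'a) pre_digraph \<Rightarrow> (('v, 'a) path \<Rightarrow>\<^sub>0 'k::field) set
    \<Rightarrow> (('v, 'a) path \<times> ('v, 'a) path) set" where
  "coh_pairs Q I = {(g, p). g \<in> Gam Q I \<and> p \<in> Bset Q I \<and> src g = src p \<and> tgt Q g = tgt Q p}"

definition coh_diff ::
  "('v, 'a) pre_digraph \<Rightarrow> (('v, 'a) path \<Rightarrow>\<^sub>0 'k::field) set
    \<Rightarrow> (('v, 'a) path \<times> ('v, 'a) path \<Rightarrow>\<^sub>0 'k) \<Rightarrow> (('v, 'a) path \<times> ('v, 'a) path \<Rightarrow>\<^sub>0 'k)" where
  "coh_diff Q I = lin_ext (\<lambda>(g, p).
     (\<Sum>b \<in> {b \<in> arcs Q. tail Q b = tgt Q g \<and> (arrow Q b \<cdot> g, arrow Q b \<cdot> p) \<in> coh_pairs Q I}.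
        bas (arrow Q b \<cdot> g, arrow Q b \<cdot> p)) -
     scale ((-1) ^ len g)
     (\<Sum>a \<in> {a \<in> arcs Q. src g = head Q a \<and> (g \<cdot> arrow Q a, p \<cdot> arrow Q a) \<in> coh_pairs Q I}.
        bas (g \<cdot> arrow Q a, p \<cdot> arrow Q a)))"

definition cochains ::
  "('v, 'a) pre_digraph \<Rightarrow> (('v, 'a) path \<Rightarrow>\<^sub>0 'k::field) set
    \<Rightarrow> (('v, 'a) path \<times> ('v, 'a) path \<Rightarrow>\<^sub>0 'k) set" where
  "cochains Q I = {x. Poly_Mapping.keys x \<subseteq> coh_pairs Q I}"

definition coh_class ::
  "('v, 'a) pre_digraph \<Rightarrow> (('v, 'a) path \<Rightarrow>\<^sub>0 'k::field) set
    \<Rightarrow> (('v, 'a) path \<times> ('v, 'a) path \<Rightarrow>\<^sub>0 'k) \<Rightarrow> (('v, 'a) path \<times> ('v, 'a) path \<Rightarrow>\<^sub>0 'k) set" where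
  "coh_class Q I x =
     {y \<in> cochains Q I. coh_diff Q I y = 0 \<and> y - x \<in> coh_diff Q I ` cochains Q I}"


section \<open>Hochschild homology\<close>

definition hom_pairs ::
  "('v, 'a) pre_digraph \<Rightarrow> (('v, 'a) path \<Rightarrow>\<^sub>0 'k::field) set
    \<Rightarrow> (('v, 'a) path \<times> ('v, 'a) path) set" where
  "hom_pairs Q I = {(p, g). p \<in> Bset Q I \<and> g \<in> Gam Q I \<and> src p = tgt Q g \<and> tgt Q p = src g}"

text \<open>The basis element \<open>(p, g)\<close>, read as 0 if \<open>p\<close> is in the ideal.\<close>

definition hom_bas ::
  "(('v, 'a) path \<Rightarrow>\<^sub>0 'k::field) set \<Rightarrow> ('v, 'a) path \<Rightarrow> ('v, 'a) path
    \<Rightarrow> ('v, 'a) path \<times> ('v, 'a) path \<Rightarrow>\<^sub>0 'k" where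
  "hom_bas I p g = (if bas p \<in> I then 0 else bas (p, g))"

definition hom_diff ::
  "('v, 'a) pre_digraph \<Rightarrow> (('v, 'a) path \<Rightarrow>\<^sub>0 'k::field) set
    \<Rightarrow> (('v, 'a) path \<times> ('v, 'a) path \<Rightarrow>\<^sub>0 'k) \<Rightarrow> (('v, 'a) path \<times> ('v, 'a) path \<Rightarrow>\<^sub>0 'k)" where
  "hom_diff Q I = lin_ext (\<lambda>(p, g).
     if len g = 0 then 0
     else hom_bas I (p \<cdot> last_arrow Q g) (drop_last g) +
          scale ((-1) ^ len g) (hom_bas I (first_arrow Q g \<cdot> p) (drop_first Q g)))"

definition hom_chains ::
  "('v, 'a) pre_digraph \<Rightarrow> (('v, 'a) path \<Rightarrow>\<^sub>0 'k::field) set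
    \<Rightarrow> (('v, 'a) path \<times> ('v, 'a) path \<Rightarrow>\<^sub>0 'k) set" where
  "hom_chains Q I = {x. Poly_Mapping.keys x \<subseteq> hom_pairs Q I}"

definition hom_class ::
  "('v, 'a) pre_digraph \<Rightarrow> (('v, 'a) path \<Rightarrow>\<^sub>0 'k::field) set
    \<Rightarrow> (('v, 'a) path \<times> ('v, 'a) path \<Rightarrow>\<^sub>0 'k) \<Rightarrow> (('v, 'a) path \<times> ('v, 'a) path \<Rightarrow>\<^sub>0 'k) set" where
  "hom_class Q I x =
     {y \<in> hom_chains Q I. hom_diff Q I y = 0 \<and> y - x \<in> hom_diff Q I ` hom_chains Q I}"


section \<open>The cap product\<close>

text \<open>The index set of the sum has at most one element.\<close>

definition cap_chain ::
  "('v, 'a) pre_digraph \<Rightarrow> (('v, 'a) path \<Rightarrow>\<^sub>0 'k::field) set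
    \<Rightarrow> (('v, 'a) path \<times> ('v, 'a) path \<Rightarrow>\<^sub>0 'k) \<Rightarrow> (('v, 'a) path \<times> ('v, 'a) path \<Rightarrow>\<^sub>0 'k)
    \<Rightarrow> (('v, 'a) path \<times> ('v, 'a) path \<Rightarrow>\<^sub>0 'k)" where
  "cap_chain Q I v u = lin_ext (\<lambda>(a, x). lin_ext (\<lambda>(y, b).
     \<Sum>z \<in> {z \<in> paths Q. src y = tgt Q z \<and> x = y \<cdot> z}.
       scale ((-1) ^ ((len x + len y) * len y)) (hom_bas I (a \<cdot> b) z)) u) v"

definition cap ::
  "('v, 'a) pre_digraph \<Rightarrow> (('v, 'a) path \<Rightarrow>\<^sub>0 'k::field) set
    \<Rightarrow> (('v, 'a) path \<times> ('v, 'a) path \<Rightarrow>\<^sub>0 'k) set \<Rightarrow> (('v, 'a) path \<times> ('v, 'a) path \<Rightarrow>\<^sub>0 'k) set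
    \<Rightarrow> (('v, 'a) path \<times> ('v, 'a) path \<Rightarrow>\<^sub>0 'k) set" where
  "cap Q I v u = (\<Union>x\<in>v. \<Union>y\<in>u. hom_class Q I (cap_chain Q I x y))"


section \<open>The generators of cohomology and the basis of homology\<close>

text \<open>The cocycles \<open>\<langle>\<langle>\<alpha>\<rangle>\<rangle>\<close> for cocomplete \<open>\<alpha>\<close> and \<open>\<langle>\<langle>C\<rangle>\<rangle>\<close> for complete \<open>C\<close>.\<close>

definition angle_cocomplete ::
  "('v, 'a) pre_digraph \<Rightarrow> ('v, 'a) path \<Rightarrow> ('v, 'a) path \<times> ('v, 'a) path \<Rightarrow>\<^sub>0 'k::field" where
  "angle_cocomplete Q p = (\<Sum>i<period Q p. bas (vert (src (rotn Q i p)), rotn Q i p))"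

definition angle_complete ::
  "('v, 'a) pre_digraph \<Rightarrow> ('v, 'a) path \<Rightarrow> ('v, 'a) path \<times> ('v, 'a) path \<Rightarrow>\<^sub>0 'k::field" where
  "angle_complete Q p = (\<Sum>i<period Q p. bas (rotn Q i p, vert (src (rotn Q i p))))"

text \<open>The cycles \<open>\<lbrakk>\<bar>C\<rbrakk>\<close> for cocomplete and for complete \<open>C\<close>.\<close>

definition bracket_cocomplete ::
  "('v, 'a) pre_digraph \<Rightarrow> ('v, 'a) path \<Rightarrow> ('v, 'a) path \<times> ('v, 'a) path \<Rightarrow>\<^sub>0 'k::field" where
  "bracket_cocomplete Q p =
     (\<Sum>i<period Q p. bas (drop_first Q (rotn Q i p), first_arrow Q (rotn Q i p)))"

definition bracket_complete ::
  "('v, 'a) pre_digraph \<Rightarrow> ('v, 'a) path \<Rightarrow> ('v, 'a) path \<times> ('v, 'a) path \<Rightarrow>\<^sub>0 'k::field" where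
  "bracket_complete Q p =
     (\<Sum>i<period Q p. scale ((-1) ^ ((len p + 1) * i)) (bas (vert (src (rotn Q i p)), rotn Q i p)))"

text \<open>A path of length 0 neither begins nor ends with an arrow.\<close>

definition share_end :: "('v, 'a) path \<Rightarrow> ('v, 'a) path \<Rightarrow> bool" where
  "share_end p q \<longleftrightarrow> arrows p \<noteq> [] \<and> arrows q \<noteq> [] \<and>
     (hd (arrows p) = hd (arrows q) \<or> last (arrows p) = last (arrows q))"

definition coh_generators ::
  "('v, 'a) pre_digraph \<Rightarrow> (('v, 'a) path \<Rightarrow>\<^sub>0 'k::field) set
    \<Rightarrow> (('v, 'a) path set \<Rightarrow> ('v, 'a) path) \<Rightarrow> 'a set
    \<Rightarrow> (('v, 'a) path \<times> ('v, 'a) path \<Rightarrow>\<^sub>0 'k) set set" where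
  "coh_generators Q I rep T =
     {coh_class Q I (bas (vert (src p), p)) |p. p \<in> cycles Q \<and> maximal_in Q (Bset Q I) p} \<union>
     {coh_class Q I (angle_cocomplete Q p) |p. p \<in> basic_B Q I rep} \<union>
     {coh_class Q I (bas (arrow Q c, arrow Q c)) |c. c \<in> arcs Q - T} \<union>
     {coh_class Q I (bas (g, p)) |g p.
        (g, p) \<in> coh_pairs Q I \<and> maximal_in Q (Gam Q I) g \<and> \<not> share_end g p} \<union>
     {coh_class Q I (angle_complete Q p) |p. p \<in> basic_Gam Q I rep}"

definition hom_basis ::
  "('v, 'a) pre_digraph \<Rightarrow> (('v, 'a) path \<Rightarrow>\<^sub>0 'k::field) set
    \<Rightarrow> (('v, 'a) path set \<Rightarrow> ('v, 'a) path)
    \<Rightarrow> (('v, 'a) path \<times> ('v, 'a) path \<Rightarrow>\<^sub>0 'k) set set" where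
  "hom_basis Q I rep =
     {hom_class Q I (bas (vert e, vert e)) |e. e \<in> verts Q} \<union>
     (\<Union>C\<in>cocomplete_circuits Q I. let c = bar Q I rep C in
        {hom_class Q I (bas (c, vert (src c))), hom_class Q I (bracket_cocomplete Q c)}) \<union>
     (\<Union>C\<in>{C \<in> complete_circuits Q I. let c = bar Q I rep C in
               (-1 :: 'k) ^ ((len c + 1) * period Q c) = 1}.
        let c = bar Q I rep C in
        {hom_class Q I (bracket_complete Q c), hom_class Q I (bas (last_arrow Q c, drop_last c))})"

end

theory Submission
  imports Defs
begin

text \<open>
  Gentleness says that an arrow has at most one continuation, on either side, of each of the two
  kinds (composite in \<open>I\<close> or not). So a complete or cocomplete cycle is determined by any one of
  its arrows, and a primitive one has pairwise distinct arrows. The cap product satisfies a Leibniz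
  rule for the differentials of the two complexes and may therefore be computed on the given
  representatives. There, a product of basis pairs whose word contains a relation is \<open>0\<close>, and
  any other one is read off from common arrows. What does not occur in the list is a boundary,
  because \<open>d(xs, y \<cdot> ys)\<close> has \<open>(xs \<cdot> y, ys)\<close> as one of its two summands and the other summand
  is \<open>0\<close> or cancels. The few configurations in which this fails need all the arrows at some vertex
  to be loops, which a connected quiver with a second vertex excludes.
\<close>

section \<open>Cyclic words\<close>

text \<open>On words of arrows, membership in \<open>I\<close> and in the two families of paths is a
  condition on adjacent letters (\<open>bas_in_ideal_iff\<close>, \<open>Bset_iff\<close>,
  \<open>Gam_iff\<close>), so whether a composite vanishes is decided at the junction where two
  words meet. The bracket and angle elements are sums over the rotations within one period; their
  differentials telescope as soon as going round once costs the sign 1. This is the origin of the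
  condition (-1)^((m+1)r) = 1 and of the squares among the basic complete cycles. In a product of
  two such sums of the same kind each rotation finds at most one partner, loops aside, and the
  result is again a sum over rotations. If the kinds differ, products can be nonzero as chains, and
  a boundary has to be found by moving one arrow from the left component to the right one. Words of
  one letter shape the case distinctions: a loop without its arrow is a vertex, and no junction is
  left that could be a relation.\<close>

definition lpow :: "'a list \<Rightarrow> nat \<Rightarrow> 'a list" where
  "lpow xs k = concat (replicate k xs)"

lemma lpow_simps [simp]: "lpow xs 0 = []" "lpow xs (Suc k) = xs @ lpow xs k"
  by (simp_all add: lpow_def)

lemma lpow_Nil [simp]: "lpow [] k = []"
  by (induction k) simp_all

lemma lpow_commute: "lpow xs k @ xs = xs @ lpow xs k"
  by (induction k) simp_all

lemma lpow_add: "lpow xs (k + l) = lpow xs k @ lpow xs l"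
  by (induction k) simp_all

lemma length_lpow [simp]: "length (lpow xs k) = k * length xs"
  by (induction k) simp_all

lemma lpow_eq_Nil_iff [simp]: "lpow xs k = [] \<longleftrightarrow> xs = [] \<or> k = 0"
  by (cases k) (auto simp: lpow_def)

lemma set_lpow: "1 \<le> k \<Longrightarrow> set (lpow xs k) = set xs"
  by (auto simp: lpow_def)

lemma hd_lpow [simp]: "1 \<le> k \<Longrightarrow> hd (lpow xs k) = hd xs"
  by (cases k; cases xs) (simp_all add: lpow_def)

lemma last_lpow [simp]: "1 \<le> k \<Longrightarrow> last (lpow xs k) = last xs"
  by (cases k; cases "xs = []") (auto simp: lpow_commute[symmetric])

text \<open>With \<open>xs = a # ys\<close>, this is the identity a (ys a)^k = (a ys)^k a: only the
  seam between the factors moves.\<close>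

lemma rotate1_lpow: "rotate1 (lpow xs k) = lpow (rotate1 xs) k"
proof (cases xs)
  case (Cons a ys)
  have "lpow xs k @ [a] = a # lpow (ys @ [a]) k" for k
    by (induction k) (simp_all add: Cons)
  moreover have "ys @ lpow (a # ys) j @ [a] = ys @ a # lpow (ys @ [a]) j" for j
    by (metis Cons calculation)
  ultimately show ?thesis
    by (cases k) (simp_all add: Cons)
qed (simp add: lpow_def)

lemma rotate_lpow: "rotate i (lpow xs k) = lpow (rotate i xs) k"
  by (induction i) (simp_all add: rotate_def rotate1_lpow)

lemma lpow_nth: "i < k * length xs \<Longrightarrow> lpow xs k ! i = xs ! (i mod length xs)"
proof (induction k arbitrary: i)
  case (Suc k)
  then show ?case
    by (cases "i < length xs") (simp_all add: nth_append le_mod_geq)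
qed simp

lemma hd_rotate: "xs \<noteq> [] \<Longrightarrow> hd (rotate i xs) = xs ! (i mod length xs)"
  by (simp add: hd_rotate_conv_nth)

lemma last_rotate1: "xs \<noteq> [] \<Longrightarrow> last (rotate1 xs) = hd xs"
  by (cases xs) simp_all

lemma last_rotate_Suc: "xs \<noteq> [] \<Longrightarrow> last (rotate (Suc i) xs) = hd (rotate i xs)"
  by (simp add: last_rotate1)

text \<open>Cyclic reindexing. The sums over rotations run over one period, and
  \<open>f n = f 0\<close> says that the period closes up, signs included.\<close>

lemma sum_shift:
  fixes f :: "nat \<Rightarrow> 'b::comm_monoid_add"
  assumes "f n = f 0"
  shows "(\<Sum>i<n. f (Suc i)) = (\<Sum>i<n. f i)"
proof (cases n)
  case (Suc m)
  have "(\<Sum>i<Suc m. f (Suc i)) = (\<Sum>i<m. f (Suc i)) + f 0"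
    using assms Suc by simp
  also have "\<dots> = (\<Sum>i<Suc m. f i)"
    unfolding sum.lessThan_Suc_shift[of f m] by (rule add.commute)
  finally show ?thesis using Suc by simp
qed simp

lemma sum_telescope_cyclic:
  fixes f :: "nat \<Rightarrow> 'b::ab_group_add"
  assumes "f n = f 0"
  shows "(\<Sum>i<n. f i - f (Suc i)) = 0"
  by (simp add: sum_subtractf sum_shift[OF assms])

text \<open>In a word with distinct letters the first letter identifies the rotation, so the
  condition on heads leaves the single index \<open>i mod length ds\<close>.\<close>

lemma sum_rotate_pick:
  fixes F :: "'a list \<Rightarrow> 'b::comm_monoid_add"
  assumes "distinct ds" "ds \<noteq> []"
    and "\<And>j. F (rotate j ds) \<noteq> 0 \<Longrightarrow> hd (rotate j ds) = hd (rotate i ds)"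
  shows "(\<Sum>j<length ds. F (rotate j ds)) = F (rotate i ds)"
proof -
  let ?i = "i mod length ds"
  have i: "?i < length ds" using assms(2) by simp
  have "j = ?i" if "j < length ds" "F (rotate j ds) \<noteq> 0" for j
    using assms(1,2) assms(3)[OF that(2)] that(1) i
    by (simp add: hd_rotate nth_eq_iff_index_eq)
  then have "(\<Sum>j<length ds. F (rotate j ds)) = (\<Sum>j\<in>{?i}. F (rotate j ds))"
    by (intro sum.mono_neutral_right) (use i in \<open>blast+\<close>)
  also have "\<dots> = F (rotate i ds)"
    using rotate_conv_mod[of i ds] by simp
  finally show ?thesis .
qed

lemma ex_rotate_hd: "a \<in> set ds \<Longrightarrow> \<exists>i<length ds. hd (rotate i ds) = a"
  by (auto simp: in_set_conv_nth) (metis hd_rotate length_0_conv less_nat_zero_code mod_less)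

lemma rotate_eq_self_iff:
  assumes "distinct ds" "ds \<noteq> []"
  shows "rotate i ds = ds \<longleftrightarrow> length ds dvd i"
proof -
  have "i mod length ds = 0" if "rotate i ds = ds"
  proof -
    have "ds ! (i mod length ds) = ds ! 0"
      using that assms(2) by (metis hd_conv_nth hd_rotate)
    then show ?thesis
      using assms by (simp add: nth_eq_iff_index_eq)
  qed
  then show ?thesis by (metis rotate_id mod_eq_0_iff_dvd)
qed

text \<open>The step from the last letter to the head is the closing junction. With
  \<open>gstep\<close>, \<open>bstep\<close> or \<open>comp\<close> for \<open>S\<close> these words
  will be the complete cycles, the cocomplete cycles and all cycles.\<close>

definition cyclic :: "('a \<Rightarrow> 'a \<Rightarrow> bool) \<Rightarrow> 'a list \<Rightarrow> bool" where
  "cyclic S xs \<longleftrightarrow> xs \<noteq> [] \<and> successively S xs \<and> S (last xs) (hd xs)"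

lemma cyclic_mono: "cyclic S xs \<Longrightarrow> (\<And>a b. S a b \<Longrightarrow> S' a b) \<Longrightarrow> cyclic S' xs"
  unfolding cyclic_def by (meson successively_mono)

lemma cyclic_rotate1: "cyclic S xs \<Longrightarrow> cyclic S (rotate1 xs)"
proof (cases xs)
  case (Cons a ys)
  then show "cyclic S xs \<Longrightarrow> cyclic S (rotate1 xs)"
    by (auto simp: cyclic_def successively_append_iff successively_Cons hd_append split: if_splits)
qed (simp add: cyclic_def)

lemma cyclic_rotate: "cyclic S xs \<Longrightarrow> cyclic S (rotate i xs)"
  by (induction i) (simp_all add: rotate_def cyclic_rotate1)

lemma cyclic_lpow: "cyclic S xs \<Longrightarrow> 1 \<le> k \<Longrightarrow> cyclic S (lpow xs k)"
proof (induction k)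
  case (Suc k)
  then show ?case
    by (cases "k = 0") (auto simp: cyclic_def successively_append_iff)
qed simp

lemma cyclic_nth:
  assumes "cyclic S xs"
  shows "S (xs ! (i mod length xs)) (xs ! (Suc i mod length xs))"
proof -
  let ?w = "rotate i xs"
  have w: "cyclic S ?w" and x: "xs \<noteq> []" using assms cyclic_rotate by (auto simp: cyclic_def)
  have 1: "hd ?w = xs ! (i mod length xs)" "hd (rotate1 ?w) = xs ! (Suc i mod length xs)"
    using x hd_rotate[of xs i] hd_rotate[of xs "Suc i"] by simp_all
  have "S (hd ?w) (hd (rotate1 ?w))"
    using w by (cases ?w; cases "tl ?w") (auto simp: cyclic_def)
  then show ?thesis by (simp only: 1)
qed

lemma cyclic_nth_eq:
  assumes "\<And>a b c. S a b \<Longrightarrow> S a c \<Longrightarrow> b = c"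
    and "cyclic S xs" "cyclic S ys" "hd xs = hd ys"
  shows "xs ! (i mod length xs) = ys ! (i mod length ys)"
proof (induction i)
  case 0
  then show ?case using assms by (simp add: cyclic_def hd_conv_nth)
next
  case (Suc i)
  then show ?case
    using assms(1) cyclic_nth[OF assms(2)] cyclic_nth[OF assms(3)] by metis
qed

lemma cyclic_nth_back:
  assumes "\<And>a b c. S b a \<Longrightarrow> S c a \<Longrightarrow> b = c" and "cyclic S xs"
    and "xs ! ((i + l) mod length xs) = xs ! ((j + l) mod length xs)"
  shows "xs ! (i mod length xs) = xs ! (j mod length xs)"
  using assms(3)
proof (induction l)
  case (Suc l)
  then show ?case
    using assms(1) cyclic_nth[OF assms(2), of "i + l"] cyclic_nth[OF assms(2), of "j + l"]
    by (metis add_Suc_right)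
qed simp

text \<open>Let \<open>m\<close> be the first return to the first letter. Forward determinism turns
  this return into a period, and minimality makes \<open>m\<close> divide the length, so the word is
  a power of its first \<open>m\<close> letters. Backward determinism makes these distinct: a
  repetition at i < j < \<open>m\<close> can be walked back to a return at j - i.\<close>

lemma cyclic_root:
  assumes inj: "\<And>a b c. S b a \<Longrightarrow> S c a \<Longrightarrow> b = c"
    and det: "\<And>a b c. S a b \<Longrightarrow> S a c \<Longrightarrow> b = c"
    and xs: "cyclic S xs"
  obtains ys k where "1 \<le> k" "xs = lpow ys k" "distinct ys" "cyclic S ys"
proof -
  let ?n = "length xs"
  let ?P = "\<lambda>m. 0 < m \<and> xs ! (m mod ?n) = xs ! 0"
  define m where "m = (LEAST m. ?P m)"
  have n0: "0 < ?n" using xs by (simp add: cyclic_def)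
  then have "?P ?n" by simp
  then have m: "?P m" and mn: "m \<le> ?n"
    unfolding m_def by (rule LeastI, rule Least_le)
  have least: "\<not> ?P l" if "l < m" for l
    using that unfolding m_def by (rule not_less_Least)
  have "hd (rotate m xs) = hd xs"
    using n0 m by (metis hd_conv_nth hd_rotate length_greater_0_conv)
  from cyclic_nth_eq[OF det cyclic_rotate[OF xs] xs this]
  have "rotate m xs ! (i mod ?n) = xs ! (i mod ?n)" for i by simp
  then have per: "xs ! ((m + i) mod ?n) = xs ! (i mod ?n)" for i
    using n0 by (simp add: nth_rotate mod_add_right_eq)
  have per2: "xs ! ((q * m + i) mod ?n) = xs ! (i mod ?n)" for q i
  proof (induction q)
    case (Suc q)
    then show ?case using per[of "q * m + i"] by (simp add: add.assoc)
  qed simp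
  \<comment> \<open>A nonzero remainder would be a return earlier than \<open>m\<close>.\<close>
  have "?n mod m = 0"
  proof (rule ccontr)
    assume "?n mod m \<noteq> 0"
    moreover have "xs ! ((?n mod m) mod ?n) = xs ! 0"
      using per2[of "?n div m" "?n mod m"] n0 by simp
    ultimately show False using least[of "?n mod m"] m by simp
  qed
  then obtain k where k: "?n = k * m" by (metis mult.commute mult_div_mod_eq add_0_right)
  have "1 \<le> k" using k n0 by (cases k) auto
  define ys where "ys = take m xs"
  have ly: "length ys = m" using mn by (simp add: ys_def)
  have "xs = lpow ys k"
  proof (rule nth_equalityI)
    show "length xs = length (lpow ys k)" using k ly by simp
    fix i assume i: "i < ?n"
    have "xs ! i = xs ! ((i div m * m + i mod m) mod ?n)" using i by simp
    also have "\<dots> = xs ! ((i mod m) mod ?n)" by (rule per2)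
    also have "\<dots> = ys ! (i mod m)"
    proof -
      have "i mod m < m" using m by simp
      then show ?thesis using mn by (simp add: ys_def)
    qed
    finally show "xs ! i = lpow ys k ! i" using i k ly by (simp add: lpow_nth)
  qed
  have eq: "i = j" if "i < m" "j < m" "i \<le> j" "xs ! i = xs ! j" for i j
  proof (rule ccontr)
    assume "i \<noteq> j"
    have "xs ! ((0 + i) mod ?n) = xs ! ((j - i + i) mod ?n)"
      using that mn by simp
    from cyclic_nth_back[OF inj xs this] have "xs ! ((j - i) mod ?n) = xs ! 0"
      by simp
    moreover have "j - i < m" "0 < j - i" using that \<open>i \<noteq> j\<close> by linarith+
    ultimately show False using least[of "j - i"] by blast
  qed
  have "i = j" if "i < m" "j < m" "ys ! i = ys ! j" for i j
    using eq[of i j] eq[of j i] that unfolding ys_def by (cases "i \<le> j") auto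
  then have d: "distinct ys" unfolding distinct_conv_nth ly by blast
  have "cyclic S ys"
    unfolding cyclic_def
  proof (intro conjI)
    show "ys \<noteq> []" using ly m by auto
    show "successively S ys"
      using xs unfolding cyclic_def ys_def
      using successively_append_iff[of S "take m xs" "drop m xs"] by simp
    have "S (xs ! ((m - 1) mod ?n)) (xs ! (Suc (m - 1) mod ?n))"
      by (rule cyclic_nth[OF xs])
    moreover have "last ys = xs ! (m - 1)" "hd ys = xs ! 0"
      using ly m mn by (simp_all add: last_conv_nth hd_conv_nth ys_def flip: length_greater_0_conv)
    moreover have "m - 1 < ?n" using m mn by linarith
    then have "(m - 1) mod ?n = m - 1" by simp
    ultimately show "S (last ys) (hd ys)"
      using m by simp
  qed
  from that[OF \<open>1 \<le> k\<close> \<open>xs = lpow ys k\<close> d this] show thesis .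
qed

text \<open>If \<open>ys\<close> were longer, reading both words from the common head would show
  \<open>ys\<close> repeating its head at position \<open>length xs\<close>. So the lengths agree,
  and determinism gives the letters.\<close>

lemma cyclic_distinct_eq:
  assumes det: "\<And>a b c. S a b \<Longrightarrow> S a c \<Longrightarrow> b = c"
    and "cyclic S xs" "cyclic S ys" "distinct xs" "distinct ys" "hd xs = hd ys"
  shows "xs = ys"
proof -
  have le: "length ys \<le> length xs" if "cyclic S xs" "cyclic S ys" "distinct ys" "hd xs = hd ys" for xs ys
  proof (rule ccontr)
    assume l: "\<not> length ys \<le> length xs"
    have "ys ! (length xs mod length ys) = ys ! 0"
      using cyclic_nth_eq[OF det that(1,2,4), where i = "length xs"] that by (simp add: cyclic_def hd_conv_nth)
    then show False
      using l that by (simp add: nth_eq_iff_index_eq cyclic_def)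
  qed
  have len: "length xs = length ys"
    using le[of xs ys] le[of ys xs] assms by simp
  have "xs ! i = ys ! i" if "i < length xs" for i
    using cyclic_nth_eq[OF det assms(2,3,6), where i = i] that len by simp
  with len show ?thesis by (simp add: nth_equalityI)
qed

lemma cyclic_distinct_share:
  assumes det: "\<And>a b c. S a b \<Longrightarrow> S a c \<Longrightarrow> b = c"
    and "cyclic S xs" "cyclic S ys" "distinct xs" "distinct ys" "a \<in> set xs" "a \<in> set ys"
  obtains i where "ys = rotate i xs"
proof -
  obtain i j where i: "hd (rotate i xs) = a" and j: "j < length ys" "hd (rotate j ys) = a"
    using ex_rotate_hd assms(6,7) by metis
  have "rotate i xs = rotate j ys"
    by (rule cyclic_distinct_eq[of S]) (use assms i j in \<open>auto intro: cyclic_rotate\<close>)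
  \<comment> \<open>Going on by \<open>length ys - j\<close> completes a full turn of
    \<open>ys\<close> and so removes the rotation on that side.\<close>
  then have "rotate (length ys - j + i) xs = rotate (length ys - j + j) ys"
    by (metis rotate_rotate)
  also have "\<dots> = ys" using j(1) by (simp add: rotate_id)
  finally show thesis using that by metis
qed

section \<open>Paths as lists of arrows\<close>

lemma not_successively_split:
  "\<not> successively S xs \<Longrightarrow> \<exists>us a b vs. xs = us @ a # b # vs \<and> \<not> S a b"
proof (induction xs rule: induct_list012)
  case (3 a b xs)
  show ?case
  proof (cases "S a b")
    case True
    then obtain us c d vs where "b # xs = us @ c # d # vs" "\<not> S c d"
      using 3 by auto
    then have "a # b # xs = (a # us) @ c # d # vs \<and> \<not> S c d" by simp
    then show ?thesis by blast
  qed (metis append_Nil)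
qed simp_all

context wf_digraph
begin

definition comp :: "'b \<Rightarrow> 'b \<Rightarrow> bool" where
  "comp a b \<longleftrightarrow> a \<in> arcs G \<and> b \<in> arcs G \<and> tail G a = head G b"

text \<open>The source is recovered from the word, so that paths of positive length become the same
  thing as words. On the empty list the source is unspecified; \<open>mk\<close> is meant for
  nonempty words.\<close>

definition mk :: "'b list \<Rightarrow> ('a, 'b) path" where
  "mk xs = Path (tail G (last xs)) xs"

lemma cas_snoc: "cas u (p @ [x]) v \<longleftrightarrow> cas u p (tail G x) \<and> head G x = v"
  by (induction p arbitrary: u) (auto simp: cas.simps)

text \<open>Walks list their arrows in the order of traversal, paths in the opposite order, hence
  the \<open>rev\<close>; the induction therefore peels off the end of the walk.\<close>

lemma cas_rev:
  "cas u (rev xs) v \<longleftrightarrow> (if xs = [] then u = v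
     else v = head G (hd xs) \<and> u = tail G (last xs) \<and>
       successively (\<lambda>a b. tail G a = head G b) xs)"
proof (induction xs arbitrary: v)
  case (Cons x xs)
  have "cas u (rev (x # xs)) v \<longleftrightarrow> cas u (rev xs) (tail G x) \<and> head G x = v"
    by (simp only: rev.simps cas_snoc)
  then show ?case
    unfolding Cons.IH by (cases xs) auto
qed simp

lemma successively_comp:
  "successively comp xs \<and> set xs \<subseteq> arcs G \<longleftrightarrow>
    successively (\<lambda>a b. tail G a = head G b) xs \<and> set xs \<subseteq> arcs G"
  by (induction xs rule: induct_list012) (auto simp: comp_def)

lemma paths_iff:
  "Path s xs \<in> paths G \<longleftrightarrow> s \<in> verts G \<and> set xs \<subseteq> arcs G \<and> successively comp xs \<and>
     (xs \<noteq> [] \<longrightarrow> s = tail G (last xs))"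
  using successively_comp[of xs]
  by (auto simp: paths_def awalk_def cas_rev tgt_def)

lemma paths_nonempty_iff:
  "xs \<noteq> [] \<Longrightarrow> Path s xs \<in> paths G \<longleftrightarrow>
     set xs \<subseteq> arcs G \<and> successively comp xs \<and> s = tail G (last xs)"
  by (auto simp: paths_iff) (meson last_in_set subsetD wellformed(1))

lemma tgt_Path: "tgt G (Path s xs) = (if xs = [] then s else head G (hd xs))"
  by (simp add: tgt_def)

lemma tgt_mk [simp]: "xs \<noteq> [] \<Longrightarrow> tgt G (mk xs) = head G (hd xs)"
  by (simp add: mk_def tgt_def)

lemma arrows_mk [simp]: "arrows (mk xs) = xs"
  and src_mk [simp]: "src (mk xs) = tail G (last xs)"
  by (simp_all add: mk_def)

lemma mk_eq_iff [simp]: "mk xs = mk ys \<longleftrightarrow> xs = ys"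
  by (auto simp: mk_def)

lemma path_eq_mk: "p \<in> paths G \<Longrightarrow> arrows p \<noteq> [] \<Longrightarrow> p = mk (arrows p)"
  by (cases p) (auto simp: paths_iff mk_def)

lemma arrow_eq_mk: "arrow G c = mk [c]"
  by (simp add: arrow_def mk_def)

lemma rot_mk: "xs \<noteq> [] \<Longrightarrow> rot G (mk xs) = mk (rotate1 xs)"
  by (simp add: rot_def mk_def)

lemma rotn_mk: "xs \<noteq> [] \<Longrightarrow> rotn G i (mk xs) = mk (rotate i xs)"
proof (induction i)
  case (Suc i)
  then have "rot G (rotn G i (mk xs)) = mk (rotate1 (rotate i xs))"
    by (simp add: rot_mk)
  then show ?case by simp
qed simp

lemma cpow_mk: "1 \<le> k \<Longrightarrow> cpow (mk xs) k = mk (lpow xs k)"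
  by (cases "xs = []") (simp_all add: cpow_def mk_def lpow_def[symmetric])

lemma cycles_iff: "p \<in> cycles G \<longleftrightarrow> (\<exists>xs. p = mk xs \<and> cyclic comp xs)"
proof
  assume p: "p \<in> cycles G"
  then have "p \<in> paths G" "arrows p \<noteq> []" "src p = tgt G p" by (auto simp: cycles_def)
  then obtain xs where xs: "p = mk xs" "xs \<noteq> []" using path_eq_mk by blast
  with \<open>p \<in> paths G\<close> \<open>src p = tgt G p\<close> have "cyclic comp xs"
    by (auto simp: cyclic_def mk_def paths_iff tgt_def comp_def)
  with xs show "\<exists>xs. p = mk xs \<and> cyclic comp xs" by blast
next
  \<comment> \<open>\<open>comp\<close> contains membership in \<open>arcs G\<close>; the extra
    letter \<open>y\<close> puts every letter of \<open>xs\<close>, even a single one, into an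
    adjacent pair.\<close>
  have arcs: "set xs \<subseteq> arcs G" if "successively comp (xs @ [y])" for xs y
    using that by (induction xs) (auto simp: successively_Cons comp_def)
  assume "\<exists>xs. p = mk xs \<and> cyclic comp xs"
  then obtain xs where "p = mk xs" "cyclic comp xs" by blast
  then show "p \<in> cycles G"
    using arcs[of xs "hd xs"]
    by (auto simp: cycles_def cyclic_def mk_def paths_nonempty_iff tgt_def comp_def successively_append_iff)
qed

end

section \<open>Relations of a gentle presentation\<close>

locale gentle_quiver = fin_digraph Q for Q :: "('v, 'a) pre_digraph" +
  fixes I :: "(('v, 'a) path \<Rightarrow>\<^sub>0 'k::field) set"
  assumes gentle: "gentle_presentation Q I"
begin

definition gstep :: "'a \<Rightarrow> 'a \<Rightarrow> bool" where
  "gstep a b \<longleftrightarrow> comp a b \<and> bas (arrow Q a \<cdot> arrow Q b) \<in> I"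

definition bstep :: "'a \<Rightarrow> 'a \<Rightarrow> bool" where
  "bstep a b \<longleftrightarrow> comp a b \<and> bas (arrow Q a \<cdot> arrow Q b) \<notin> I"

lemma bstep_or_gstep: "comp a b \<Longrightarrow> bstep a b \<or> gstep a b"
  by (auto simp: bstep_def gstep_def)

lemma bstep_not_gstep: "bstep a b \<Longrightarrow> \<not> gstep a b"
  by (auto simp: bstep_def gstep_def)

lemma bstep_comp: "bstep a b \<Longrightarrow> comp a b"
  by (simp add: bstep_def)

lemma gstep_comp: "gstep a b \<Longrightarrow> comp a b"
  by (simp add: gstep_def)

lemma card_le_1_eq: "finite A \<Longrightarrow> card A \<le> 1 \<Longrightarrow> x \<in> A \<Longrightarrow> y \<in> A \<Longrightarrow> x = y"
  by (metis One_nat_def card_le_Suc0_iff_eq)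

lemma gstep_bstep_det:
  "gstep a b \<Longrightarrow> gstep a c \<Longrightarrow> b = c" "gstep b a \<Longrightarrow> gstep c a \<Longrightarrow> b = c"
  "bstep a b \<Longrightarrow> bstep a c \<Longrightarrow> b = c" "bstep b a \<Longrightarrow> bstep c a \<Longrightarrow> b = c"
proof -
  have g: "a \<in> arcs Q \<Longrightarrow>
      card {b \<in> arcs Q. head Q b = tail Q a \<and> bas (arrow Q a \<cdot> arrow Q b) \<notin> I} \<le> 1 \<and>
      card {c \<in> arcs Q. head Q a = tail Q c \<and> bas (arrow Q c \<cdot> arrow Q a) \<notin> I} \<le> 1 \<and>
      card {b \<in> arcs Q. head Q b = tail Q a \<and> bas (arrow Q a \<cdot> arrow Q b) \<in> I} \<le> 1 \<and>
      card {c \<in> arcs Q. head Q a = tail Q c \<and> bas (arrow Q c \<cdot> arrow Q a) \<in> I} \<le> 1" for a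
    using gentle unfolding gentle_presentation_def by blast
  note u = card_le_1_eq[OF _ g[THEN conjunct1]]
    card_le_1_eq[OF _ g[THEN conjunct2, THEN conjunct1]]
    card_le_1_eq[OF _ g[THEN conjunct2, THEN conjunct2, THEN conjunct1]]
    card_le_1_eq[OF _ g[THEN conjunct2, THEN conjunct2, THEN conjunct2]]
  show "gstep a b \<Longrightarrow> gstep a c \<Longrightarrow> b = c"
    by (rule u(3)[of a]) (auto simp: gstep_def comp_def)
  show "gstep b a \<Longrightarrow> gstep c a \<Longrightarrow> b = c"
    by (rule u(4)[of a]) (auto simp: gstep_def comp_def)
  show "bstep a b \<Longrightarrow> bstep a c \<Longrightarrow> b = c"
    by (rule u(1)[of a]) (auto simp: bstep_def comp_def)
  show "bstep b a \<Longrightarrow> bstep c a \<Longrightarrow> b = c"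
    by (rule u(2)[of a]) (auto simp: bstep_def comp_def)
qed

lemma length_2_path:
  assumes "q \<in> paths Q" "len q = 2"
  obtains a b where "arrows q = [a, b]" "q = arrow Q a \<cdot> arrow Q b" "comp a b"
proof -
  obtain a b where ab: "arrows q = [a, b]"
    using assms(2) by (auto simp: numeral_2_eq_2 length_Suc_conv)
  with assms(1) have "q = arrow Q a \<cdot> arrow Q b" "comp a b"
    by (cases q; auto simp: paths_iff arrow_def pcomp_def)+
  with ab that show thesis by blast
qed

lemma path_split:
  assumes "Path t (us @ a # b # vs) \<in> paths Q"
  shows "Path (head Q a) us \<in> paths Q" "Path t vs \<in> paths Q" "comp a b" "tail Q b = tgt Q (Path t vs)"
  using assms
  by (auto simp: paths_iff tgt_Path successively_append_iff successively_Cons comp_def)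

lemma path_algebra_bas_mult:
  "bas p \<otimes>\<^bsub>path_algebra Q\<^esub> bas q =
    (if src p = tgt Q q then bas (p \<cdot> q) else (0 :: ('v, 'a) path \<Rightarrow>\<^sub>0 'k))"
  by (simp add: path_algebra_def path_mult_def)

text \<open>The ideal is spanned by the paths that contain a relation, since these span an ideal.\<close>

lemma bas_in_ideal_iff:
  assumes p: "p \<in> paths Q"
  shows "bas p \<in> I \<longleftrightarrow> \<not> successively bstep (arrows p)"
proof -
  let ?R = "path_algebra Q :: (('v, 'a) path \<Rightarrow>\<^sub>0 'k) ring"
  obtain X where X: "X \<subseteq> {p \<in> paths Q. len p = 2}" and I: "I = Idl\<^bsub>?R\<^esub> (bas ` X)"
    using gentle unfolding gentle_presentation_def by blast
  interpret R: ring ?R by (rule ring_path_algebra) unfold_locales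
  have car: "carrier ?R = {x. Poly_Mapping.keys x \<subseteq> paths Q}"
    by (simp add: path_algebra_def)
  have Xc: "bas ` X \<subseteq> carrier ?R" using X by (auto simp: car)
  let ?C = "\<lambda>p. \<exists>q\<in>X. \<exists>us vs. arrows p = us @ arrows q @ vs"
  \<comment> \<open>\<open>J\<close> is spanned by the paths with a generator as a factor of their
    word. Once it is known to be an ideal, minimality of the generated ideal shows that a path in
    \<open>I\<close> contains a generator.\<close>
  define J :: "(('v, 'a) path \<Rightarrow>\<^sub>0 'k) set" where
    "J = {x. Poly_Mapping.keys x \<subseteq> {p \<in> paths Q. ?C p}}"
  have Jc: "J \<subseteq> carrier ?R" by (auto simp: J_def car)
  have mult: "path_mult Q x y \<in> J" if "x \<in> carrier ?R" "y \<in> carrier ?R" "x \<in> J \<or> y \<in> J" for x y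
  proof -
    have "path_mult Q x y \<in> carrier ?R" using R.m_closed[OF that(1,2)]
      by (simp add: path_algebra_def)
    moreover have "?C k" if km: "k \<in> Poly_Mapping.keys (path_mult Q x y)" for k
    proof -
      obtain p where p: "p \<in> Poly_Mapping.keys x"
        and k: "k \<in> Poly_Mapping.keys (lin_ext (\<lambda>q. if src p = tgt Q q then bas (p \<cdot> q) else 0) y)"
        using subsetD[OF keys_lin_ext km[unfolded path_mult_def]] by (rule UN_E)
      from subsetD[OF keys_lin_ext k] obtain q where "q \<in> Poly_Mapping.keys y" "k = p \<cdot> q"
        by (rule UN_E) (simp split: if_splits)
      with p have pq: "p \<in> Poly_Mapping.keys x" "q \<in> Poly_Mapping.keys y" "k = p \<cdot> q" by simp_all
      then have "?C p \<or> ?C q" using \<open>x \<in> J \<or> y \<in> J\<close> by (auto simp: J_def)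
      then show ?thesis
      proof
        assume "?C p"
        then obtain q' us vs where "q' \<in> X" "arrows p = us @ arrows q' @ vs" by blast
        then have "arrows k = us @ arrows q' @ (vs @ arrows q)" by (simp add: pq(3) pcomp_def)
        with \<open>q' \<in> X\<close> show ?thesis by blast
      next
        assume "?C q"
        then obtain q' us vs where "q' \<in> X" "arrows q = us @ arrows q' @ vs" by blast
        then have "arrows k = (arrows p @ us) @ arrows q' @ vs" by (simp add: pq(3) pcomp_def)
        with \<open>q' \<in> X\<close> show ?thesis by blast
      qed
    qed
    ultimately show ?thesis by (auto simp: J_def car)
  qed
  have "ideal J ?R"
  proof (rule idealI)
    show "ring ?R" by (rule R.ring_axioms)
    show "subgroup J (add_monoid ?R)"
    proof
      show "J \<subseteq> carrier (add_monoid ?R)" using Jc by simp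
      show "x \<otimes>\<^bsub>add_monoid ?R\<^esub> y \<in> J" if "x \<in> J" "y \<in> J" for x y
        using that keys_add[of x y] by (auto simp: J_def path_algebra_def)
      show "\<one>\<^bsub>add_monoid ?R\<^esub> \<in> J" by (simp add: J_def path_algebra_def)
      show "inv\<^bsub>add_monoid ?R\<^esub> x \<in> J" if "x \<in> J" for x
      proof -
        have "\<ominus>\<^bsub>?R\<^esub> x = - x"
          by (rule R.minus_equality) (use that in \<open>auto simp: J_def path_algebra_def\<close>)
        then show ?thesis using that by (simp add: J_def a_inv_def)
      qed
    qed
    show "x \<otimes>\<^bsub>?R\<^esub> a \<in> J" "a \<otimes>\<^bsub>?R\<^esub> x \<in> J" if "a \<in> J" "x \<in> carrier ?R" for a x
      using mult[of x a] mult[of a x] that Jc by (auto simp: path_algebra_def)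
  qed
  moreover have "bas ` X \<subseteq> J"
  proof -
    have "?C q" if "q \<in> X" for q using that by (metis append_Nil append_Nil2)
    then show ?thesis using X by (auto simp: J_def)
  qed
  ultimately have IJ: "I \<subseteq> J" unfolding I by (rule R.genideal_minimal)
  have idl: "ideal I ?R" unfolding I by (rule R.genideal_ideal[OF Xc])
  show ?thesis
  proof
    assume "bas p \<in> I"
    then obtain q us vs where q: "q \<in> X" "arrows p = us @ arrows q @ vs"
    proof -
      have "bas p \<in> J" using \<open>bas p \<in> I\<close> IJ by blast
      then have "?C p" unfolding J_def mem_Collect_eq keys_bas by blast
      then show thesis using that by blast
    qed
    then obtain a b where ab: "arrows q = [a, b]" "q = arrow Q a \<cdot> arrow Q b"
      using X length_2_path by blast
    have "bas q \<in> I" unfolding I using q R.genideal_self[OF Xc] by blast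
    then have "\<not> bstep a b" using ab by (simp add: bstep_def)
    then show "\<not> successively bstep (arrows p)"
      using q(2) ab by (auto simp: successively_append_iff)
  next
    assume "\<not> successively bstep (arrows p)"
    then obtain us a b vs where s: "arrows p = us @ a # b # vs" "\<not> bstep a b"
      using not_successively_split by blast
    obtain t where t: "p = Path t (us @ a # b # vs)" using s by (cases p) auto
    note pp = path_split[OF p[unfolded t]]
    let ?g = "Path (head Q a) us" and ?d = "Path t vs"
    \<comment> \<open>Conversely, a junction that is not a \<open>bstep\<close> is a relation;
      multiplying it by the outer pieces \<open>?g\<close> and \<open>?d\<close> gives back
      \<open>p\<close>.\<close>
    have "bas (arrow Q a \<cdot> arrow Q b) \<in> I"
      using pp(3) s(2) by (auto simp: bstep_def)
    then have "bas ?g \<otimes>\<^bsub>?R\<^esub> (bas (arrow Q a \<cdot> arrow Q b) \<otimes>\<^bsub>?R\<^esub> bas ?d) \<in> I"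
      using pp(1,2) by (intro ideal.I_l_closed[OF idl] ideal.I_r_closed[OF idl]) (auto simp: car)
    moreover have "src (arrow Q b) = tgt Q ?d"
      using pp(4) by (simp add: arrow_def)
    ultimately show "bas p \<in> I"
      by (simp add: path_algebra_bas_mult t pcomp_def arrow_def tgt_Path)
  qed
qed

lemma subpath_2_iff:
  assumes p: "p \<in> paths Q"
  shows "subpath Q q p \<and> len q = 2 \<longleftrightarrow>
    (\<exists>us a b vs. arrows p = us @ a # b # vs \<and> q = arrow Q a \<cdot> arrow Q b)"
proof
  assume q: "subpath Q q p \<and> len q = 2"
  then obtain g d :: "('v, 'a) path"
    where "q \<in> paths Q" "arrows p = arrows g @ arrows q @ arrows d"
    by (auto simp: subpath_def pcomp_def)
  then show "\<exists>us a b vs. arrows p = us @ a # b # vs \<and> q = arrow Q a \<cdot> arrow Q b"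
    using q by (elim conjE length_2_path[of q]) auto
next
  assume "\<exists>us a b vs. arrows p = us @ a # b # vs \<and> q = arrow Q a \<cdot> arrow Q b"
  then obtain us a b vs where s: "arrows p = us @ a # b # vs" and q: "q = arrow Q a \<cdot> arrow Q b"
    by blast
  obtain t where t: "p = Path t (us @ a # b # vs)" using s by (cases p) auto
  note pp = path_split[OF p[unfolded t]]
  let ?g = "Path (head Q a) us" and ?d = "Path t vs"
  have "q \<in> paths Q"
    using pp(3) by (simp add: paths_nonempty_iff comp_def q pcomp_def arrow_def)
  moreover have "src ?g = tgt Q q" "src q = tgt Q ?d" "p = ?g \<cdot> q \<cdot> ?d"
    using pp(4) by (simp_all add: q arrow_def pcomp_def tgt_Path t)
  ultimately have "subpath Q q p" unfolding subpath_def using pp(1,2) by blast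
  then show "subpath Q q p \<and> len q = 2" by (simp add: q arrow_def pcomp_def)
qed

text \<open>A subpath of length 2 is a pair of adjacent letters, so avoiding relations can be tested
  junction by junction.\<close>

lemma Bset_iff: "p \<in> Bset Q I \<longleftrightarrow> p \<in> paths Q \<and> successively bstep (arrows p)"
proof -
  have "(\<exists>q\<in>rels Q I. subpath Q q p) \<longleftrightarrow> \<not> successively bstep (arrows p)" if p: "p \<in> paths Q"
  proof
    assume "\<exists>q\<in>rels Q I. subpath Q q p"
    then obtain q where q: "bas q \<in> I" "subpath Q q p \<and> len q = 2" by (auto simp: rels_def)
    then obtain us a b vs where "arrows p = us @ a # b # vs" "q = arrow Q a \<cdot> arrow Q b"
      using subpath_2_iff[OF p] by blast
    then show "\<not> successively bstep (arrows p)"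
      using q(1) by (auto simp: successively_append_iff bstep_def)
  next
    assume "\<not> successively bstep (arrows p)"
    then obtain us a b vs where s: "arrows p = us @ a # b # vs" "\<not> bstep a b"
      using not_successively_split by blast
    moreover have "comp a b"
      using p s(1) by (cases p) (auto simp: paths_iff successively_append_iff)
    ultimately have "bas (arrow Q a \<cdot> arrow Q b) \<in> I" by (simp add: bstep_def)
    moreover have sub: "subpath Q (arrow Q a \<cdot> arrow Q b) p \<and> len (arrow Q a \<cdot> arrow Q b) = 2"
      using subpath_2_iff[OF p] s(1) by blast
    ultimately have "arrow Q a \<cdot> arrow Q b \<in> rels Q I"
      by (auto simp: rels_def subpath_def)
    then show "\<exists>q\<in>rels Q I. subpath Q q p" using sub by blast
  qed
  then show ?thesis by (auto simp: Bset_def)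
qed

lemma Gam_iff: "p \<in> Gam Q I \<longleftrightarrow> p \<in> paths Q \<and> successively gstep (arrows p)"
proof -
  have "(\<forall>q. subpath Q q p \<and> len q = 2 \<longrightarrow> q \<in> rels Q I) \<longleftrightarrow> successively gstep (arrows p)"
    if p: "p \<in> paths Q"
  proof
    assume r: "\<forall>q. subpath Q q p \<and> len q = 2 \<longrightarrow> q \<in> rels Q I"
    show "successively gstep (arrows p)"
    proof (rule ccontr)
      assume "\<not> successively gstep (arrows p)"
      then obtain us a b vs where s: "arrows p = us @ a # b # vs" "\<not> gstep a b"
        using not_successively_split by blast
      moreover have "comp a b"
        using p s(1) by (cases p) (auto simp: paths_iff successively_append_iff)
      moreover have "arrow Q a \<cdot> arrow Q b \<in> rels Q I"
        using r subpath_2_iff[OF p] s(1) by blast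
      ultimately show False by (simp add: gstep_def rels_def)
    qed
  next
    assume g: "successively gstep (arrows p)"
    show "\<forall>q. subpath Q q p \<and> len q = 2 \<longrightarrow> q \<in> rels Q I"
    proof (intro allI impI)
      fix q assume q: "subpath Q q p \<and> len q = 2"
      then obtain us a b vs where "arrows p = us @ a # b # vs" "q = arrow Q a \<cdot> arrow Q b"
        using subpath_2_iff[OF p] by blast
      with g q show "q \<in> rels Q I"
        by (auto simp: successively_append_iff gstep_def rels_def subpath_def)
    qed
  qed
  then show ?thesis by (auto simp: Gam_def)
qed

end

section \<open>Boundaries\<close>

lemma scale_minus_one: "scale (- 1) x = - x"
  by (rule poly_mapping_eqI) (simp add: lookup_scale)

lemma scale_minus_right: "scale c (- x) = - scale c x"
  by (rule poly_mapping_eqI) (simp add: lookup_scale)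

lemma scale_minus_left: "scale (- c) x = - scale c x"
  by (rule poly_mapping_eqI) (simp add: lookup_scale)

lemma scale_diff: "scale c (x - y) = scale c x - scale c y"
  by (rule poly_mapping_eqI) (simp add: lookup_scale lookup_minus algebra_simps)

lemma lin_ext_minus: "lin_ext f (- x) = - lin_ext f x"
  by (metis lin_ext_scale scale_minus_one)

lemma lin_ext_diff: "lin_ext f (x - y) = lin_ext f x - lin_ext f y"
  by (metis diff_conv_add_uminus lin_ext_add lin_ext_minus)

context gentle_quiver
begin

abbreviation hb :: "('v, 'a) path \<Rightarrow> ('v, 'a) path \<Rightarrow> ('v, 'a) path \<times> ('v, 'a) path \<Rightarrow>\<^sub>0 'k" where
  "hb \<equiv> hom_bas I"

abbreviation hdiff :: "(('v, 'a) path \<times> ('v, 'a) path \<Rightarrow>\<^sub>0 'k) \<Rightarrow> ('v, 'a) path \<times> ('v, 'a) path \<Rightarrow>\<^sub>0 'k"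
  where "hdiff \<equiv> hom_diff Q I"

definition bdry :: "(('v, 'a) path \<times> ('v, 'a) path \<Rightarrow>\<^sub>0 'k) \<Rightarrow> bool" where
  "bdry x \<longleftrightarrow> x \<in> hdiff ` hom_chains Q I"

lemma hom_diff_linear:
  "hdiff (x + y) = hdiff x + hdiff y" "hdiff (scale c x) = scale c (hdiff x)"
  "hdiff (x - y) = hdiff x - hdiff y" "hdiff (sum f A) = (\<Sum>i\<in>A. hdiff (f i))"
  "hdiff 0 = 0" "hdiff (- x) = - hdiff x"
  by (simp_all add: hom_diff_def lin_ext_add lin_ext_scale lin_ext_diff lin_ext_sum lin_ext_minus)

lemma hom_diff_bas:
  "hdiff (bas (p, g)) = (if len g = 0 then 0
     else hb (p \<cdot> last_arrow Q g) (drop_last g) +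
       scale ((-1) ^ len g) (hb (first_arrow Q g \<cdot> p) (drop_first Q g)))"
  by (simp add: hom_diff_def)

lemma hom_chains_closed:
  "0 \<in> hom_chains Q I"
  "x \<in> hom_chains Q I \<Longrightarrow> y \<in> hom_chains Q I \<Longrightarrow> x + y \<in> hom_chains Q I"
  "x \<in> hom_chains Q I \<Longrightarrow> scale c x \<in> hom_chains Q I"
  "(\<And>i. i \<in> A \<Longrightarrow> f i \<in> hom_chains Q I) \<Longrightarrow> sum f A \<in> hom_chains Q I"
proof -
  show 0: "0 \<in> hom_chains Q I" by (simp add: hom_chains_def)
  show add: "x \<in> hom_chains Q I \<Longrightarrow> y \<in> hom_chains Q I \<Longrightarrow> x + y \<in> hom_chains Q I" for x y
    using keys_add[of x y] by (auto simp: hom_chains_def)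
  show "x \<in> hom_chains Q I \<Longrightarrow> scale c x \<in> hom_chains Q I"
    using keys_scale[of c x] by (auto simp: hom_chains_def)
  show "(\<And>i. i \<in> A \<Longrightarrow> f i \<in> hom_chains Q I) \<Longrightarrow> sum f A \<in> hom_chains Q I"
    by (induction A rule: infinite_finite_induct) (auto intro: 0 add)
qed

lemma bas_in_hom_chains: "bas v \<in> hom_chains Q I \<longleftrightarrow> v \<in> hom_pairs Q I"
  by (simp add: hom_chains_def)

lemma bdryI: "x \<in> hom_chains Q I \<Longrightarrow> bdry (hdiff x)"
  by (auto simp: bdry_def)

lemma bdry_zero [simp]: "bdry 0"
  using bdryI[OF hom_chains_closed(1)] by (simp add: hom_diff_linear)

lemma bdry_add: "bdry x \<Longrightarrow> bdry y \<Longrightarrow> bdry (x + y)"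
  unfolding bdry_def by (auto simp flip: hom_diff_linear intro!: imageI hom_chains_closed)

lemma bdry_scale: "bdry x \<Longrightarrow> bdry (scale c x)"
  unfolding bdry_def by (auto simp flip: hom_diff_linear intro!: imageI hom_chains_closed)

lemma bdry_minus: "bdry x \<Longrightarrow> bdry (- x)"
  using bdry_scale[of x "-1"] by (simp add: scale_minus_one)

lemma bdry_sum: "(\<And>i. i \<in> A \<Longrightarrow> bdry (f i)) \<Longrightarrow> bdry (sum f A)"
  by (induction A rule: infinite_finite_induct) (auto intro: bdry_add)

lemma bdry_trans: "bdry (x - y) \<Longrightarrow> bdry (y - z) \<Longrightarrow> bdry (x - z)"
  using bdry_add[of "x - y" "y - z"] by simp

lemma bdry_sym: "bdry (x - y) \<Longrightarrow> bdry (y - x)"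
  using bdry_minus[of "x - y"] by simp

lemma hom_class_cong: "bdry (x - y) \<Longrightarrow> hom_class Q I x = hom_class Q I y"
  using bdry_trans[of _ x y] bdry_trans[of _ y x] bdry_sym[of x y]
  unfolding hom_class_def bdry_def[symmetric] by blast

lemma hom_bas_eq:
  "p \<in> paths Q \<Longrightarrow> hb p g = (if successively bstep (arrows p) then bas (p, g) else 0)"
  by (simp add: hom_bas_def bas_in_ideal_iff)

lemma hom_pairs_iff:
  "(p, g) \<in> hom_pairs Q I \<longleftrightarrow> p \<in> paths Q \<and> successively bstep (arrows p) \<and>
     g \<in> paths Q \<and> successively gstep (arrows g) \<and> src p = tgt Q g \<and> tgt Q p = src g"
  by (auto simp: hom_pairs_def Bset_iff Gam_iff)

lemma coh_pairs_iff:
  "(g, p) \<in> coh_pairs Q I \<longleftrightarrow> p \<in> paths Q \<and> successively bstep (arrows p) \<and>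
     g \<in> paths Q \<and> successively gstep (arrows g) \<and> src g = src p \<and> tgt Q g = tgt Q p"
  by (auto simp: coh_pairs_def Bset_iff Gam_iff)

lemma bdry_hom_diff:
  assumes "(Path s xs, Path t (y # ys)) \<in> hom_pairs Q I"
  shows "bdry (hb (Path (tail Q y) (xs @ [y])) (Path t ys) +
    scale ((-1) ^ Suc (length ys))
      (hb (Path s (last (y # ys) # xs)) (Path (head Q (last (y # ys))) (butlast (y # ys)))))"
proof -
  have "bdry (hdiff (bas (Path s xs, Path t (y # ys))))"
    using assms by (intro bdryI) (simp add: bas_in_hom_chains)
  then show ?thesis
    by (simp add: hom_diff_bas pcomp_def last_arrow_def first_arrow_def drop_last_def
      drop_first_def arrow_def)
qed

text \<open>The differential of the pair of \<open>xs\<close> and \<open>y # ys\<close> moves the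
  first arrow \<open>y\<close> of the left component to the right one, where it becomes the last
  arrow; \<open>step\<close> keeps the longer path in \<Gamma>. The other summand carries the arrow
  at the opposite end, which is \<open>y\<close> itself when \<open>ys\<close> is empty.\<close>

lemma bdry_move:
  assumes pair: "(Path s (xs @ [y]), Path t ys) \<in> hom_pairs Q I"
    and step: "ys \<noteq> [] \<Longrightarrow> gstep y (hd ys)"
  shows "bdry (bas (Path s (xs @ [y]), Path t ys) + scale ((-1) ^ Suc (length ys))
      (hb (Path (head Q y) (last (y # ys) # xs)) (Path (head Q (last (y # ys))) (butlast (y # ys)))))"
proof -
  have s: "s = tail Q y" using pair by (auto simp: hom_pairs_iff paths_iff)
  have y: "y \<in> arcs Q" using pair by (auto simp: hom_pairs_iff paths_iff)
  have "(Path (head Q y) xs, Path t (y # ys)) \<in> hom_pairs Q I"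
    using pair step y
    by (auto simp: hom_pairs_iff paths_iff tgt_Path successively_append_iff successively_Cons comp_def
        dest: gstep_comp split: if_splits)
  from bdry_hom_diff[OF this] show ?thesis
    using pair by (subst (asm) hom_bas_eq) (auto simp: hom_pairs_iff s)
qed

text \<open>The hypothesis \<open>last\<close> puts a relation at the front of the second summand of
  \<open>bdry_move\<close>; nonempty \<open>xs\<close> provides the junction for it.\<close>

lemma bdry_kill:
  assumes pair: "(Path s (xs @ [y]), Path t ys) \<in> hom_pairs Q I"
    and step: "ys \<noteq> [] \<Longrightarrow> gstep y (hd ys)"
    and ne: "xs \<noteq> []" and last: "gstep (last (y # ys)) (hd xs)"
  shows "bdry (bas (Path s (xs @ [y]), Path t ys))"
proof -
  have "last (y # ys) \<in> arcs Q" using pair by (auto simp: hom_pairs_iff paths_iff)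
  then have "Path (head Q y) (last (y # ys) # xs) \<in> paths Q"
    using pair ne gstep_comp[OF last]
    by (auto simp: hom_pairs_iff paths_nonempty_iff successively_append_iff successively_Cons comp_def)
  moreover have "\<not> successively bstep (last (y # ys) # xs)"
    using ne last bstep_not_gstep by (cases xs) auto
  ultimately have "hb (Path (head Q y) (last (y # ys) # xs))
      (Path (head Q (last (y # ys))) (butlast (y # ys))) = 0"
    by (simp add: hom_bas_eq)
  with bdry_move[OF pair step] show ?thesis by simp
qed

section \<open>The cap product on basis elements\<close>

definition capb :: "('v, 'a) path \<times> ('v, 'a) path \<Rightarrow> ('v, 'a) path \<times> ('v, 'a) path \<Rightarrow>
    ('v, 'a) path \<times> ('v, 'a) path \<Rightarrow>\<^sub>0 'k" where
  "capb v u = cap_chain Q I (bas v) (bas u)"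

lemma cap_chain_eq: "cap_chain Q I x y = lin_ext (\<lambda>v. lin_ext (capb v) y) x"
  unfolding cap_chain_def capb_def lin_ext_bas by (simp add: case_prod_unfold)

lemma cap_chain_linear:
  "cap_chain Q I (x + x') y = cap_chain Q I x y + cap_chain Q I x' y"
  "cap_chain Q I x (y + y') = cap_chain Q I x y + cap_chain Q I x y'"
  "cap_chain Q I (scale c x) y = scale c (cap_chain Q I x y)"
  "cap_chain Q I x (scale c y) = scale c (cap_chain Q I x y)"
  "cap_chain Q I (sum f A) y = (\<Sum>i\<in>A. cap_chain Q I (f i) y)"
  "cap_chain Q I x (sum f A) = (\<Sum>i\<in>A. cap_chain Q I x (f i))"
  "cap_chain Q I (bas v) (bas u) = capb v u"
  "cap_chain Q I 0 y = 0" "cap_chain Q I x 0 = 0"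
  "cap_chain Q I (x - x') y = cap_chain Q I x y - cap_chain Q I x' y"
  "cap_chain Q I x (y - y') = cap_chain Q I x y - cap_chain Q I x y'"
proof -
  have swap: "cap_chain Q I x y = lin_ext (\<lambda>u. lin_ext (\<lambda>v. capb v u) x) y" for x y
    unfolding cap_chain_eq by (rule lin_ext_swap)
  show "cap_chain Q I (x + x') y = cap_chain Q I x y + cap_chain Q I x' y"
    "cap_chain Q I (scale c x) y = scale c (cap_chain Q I x y)"
    "cap_chain Q I (sum f A) y = (\<Sum>i\<in>A. cap_chain Q I (f i) y)"
    "cap_chain Q I 0 y = 0"
    "cap_chain Q I (x - x') y = cap_chain Q I x y - cap_chain Q I x' y"
    unfolding cap_chain_eq by (simp_all add: lin_ext_add lin_ext_scale lin_ext_sum lin_ext_diff)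
  show "cap_chain Q I x (y + y') = cap_chain Q I x y + cap_chain Q I x y'"
    "cap_chain Q I x (scale c y) = scale c (cap_chain Q I x y)"
    "cap_chain Q I x (sum f A) = (\<Sum>i\<in>A. cap_chain Q I x (f i))"
    "cap_chain Q I x 0 = 0"
    "cap_chain Q I x (y - y') = cap_chain Q I x y - cap_chain Q I x y'"
    unfolding swap by (simp_all add: lin_ext_add lin_ext_scale lin_ext_sum lin_ext_diff)
  show "cap_chain Q I (bas v) (bas u) = capb v u" by (simp add: capb_def)
qed

lemma path_suffix:
  assumes p: "Path s (arrows y @ zs) \<in> paths Q" "y \<in> paths Q"
    and t: "tgt Q y = tgt Q (Path s (arrows y @ zs))"
  shows "Path s zs \<in> paths Q" "src y = tgt Q (Path s zs)"
proof -
  show "Path s zs \<in> paths Q"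
    using p(1) by (simp add: paths_iff successively_append_iff)
  show "src y = tgt Q (Path s zs)"
  proof (cases "arrows y = []")
    case True
    then show ?thesis using t by (simp add: tgt_def)
  next
    case False
    then show ?thesis
      using p by (cases y; cases "zs = []") (simp_all add: paths_iff tgt_Path successively_append_iff comp_def)
  qed
qed

text \<open>A factorization \<open>x = y \<cdot> z\<close> determines \<open>z\<close>, so
  \<open>take\<close> and \<open>drop\<close> replace the sum. Equality of targets matters for
  \<open>y\<close> of length 0: the empty word is a prefix of every word, but its vertex still has
  to be the target of \<open>x\<close>.\<close>

lemma capb_eq:
  assumes x: "x \<in> paths Q" and y: "y \<in> paths Q"
  shows "capb (a, x) (y, b) =
    (if tgt Q y = tgt Q x \<and> take (len y) (arrows x) = arrows y
     then scale ((-1) ^ ((len x + len y) * len y))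
       (hb (a \<cdot> b) (Path (src x) (drop (len y) (arrows x))))
     else 0)"
proof -
  let ?z = "Path (src x) (drop (len y) (arrows x))"
  let ?c = "tgt Q y = tgt Q x \<and> take (len y) (arrows x) = arrows y"
  let ?S = "{z \<in> paths Q. src y = tgt Q z \<and> x = y \<cdot> z}"
  have S: "?S = (if ?c then {?z} else {})"
  proof -
    have 1: "z = ?z \<and> ?c" if "z \<in> paths Q" "src y = tgt Q z" "x = y \<cdot> z" for z
      using that by (auto simp: pcomp_def tgt_def)
    have 2: "?z \<in> paths Q \<and> src y = tgt Q ?z \<and> x = y \<cdot> ?z" if c: ?c
    proof -
      obtain zs where zs: "arrows x = arrows y @ zs"
        using c by (metis append_take_drop_id)
      obtain s where x': "x = Path s (arrows y @ zs)"
        using zs by (metis path.collapse)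
      have "tgt Q y = tgt Q (Path s (arrows y @ zs))" using c by (simp add: x')
      from path_suffix[OF x[unfolded x'] y this] show ?thesis by (simp add: x' pcomp_def)
    qed
    show ?thesis
    proof (cases ?c)
      case True
      then have "?S = {?z}" using 1 2[OF True] by blast
      then show ?thesis unfolding if_P[OF True] .
    next
      case False
      then have "?S = {}" using 1 by blast
      then show ?thesis unfolding if_not_P[OF False] .
    qed
  qed
  show ?thesis
    unfolding capb_def cap_chain_def lin_ext_bas prod.case S by simp
qed

section \<open>The Leibniz rule on basis pairs\<close>

lemma successively_take: "successively S xs \<Longrightarrow> successively S (take n xs)"
  using successively_append_iff[of S "take n xs" "drop n xs"] by simp

lemma arrow_in_paths: "c \<in> arcs Q \<Longrightarrow> arrow Q c \<in> paths Q"
  by (simp add: arrow_def paths_iff)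

lemma src_arrow [simp]: "src (arrow Q c) = tail Q c"
  and tgt_arrow [simp]: "tgt Q (arrow Q c) = head Q c"
  and arrows_arrow [simp]: "arrows (arrow Q c) = [c]"
  by (simp_all add: arrow_def tgt_def)

lemma arrows_pcomp [simp]: "arrows (p \<cdot> q) = arrows p @ arrows q"
  by (simp add: pcomp_def)

lemma comp_in_paths:
  "p \<in> paths Q \<Longrightarrow> q \<in> paths Q \<Longrightarrow> src p = tgt Q q \<Longrightarrow> p \<cdot> q \<in> paths Q"
  by (rule pcomp_in_paths[OF wf_digraph])

text \<open>If \<open>p\<close> contains a relation, the left side is 0 at once and the right side
  because \<open>p \<cdot> b\<close> contains the same relation. So the summands of a differential
  may be capped as if they were basis pairs.\<close>

lemma cap_chain_hb:
  assumes "p \<in> paths Q" "g \<in> paths Q" "y \<in> paths Q" "b \<in> paths Q"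
    "tgt Q y = tgt Q b" "src p = tgt Q g"
  shows "cap_chain Q I (hb p g) (bas (y, b)) = capb (p, g) (y, b)"
proof (cases "successively bstep (arrows p)")
  case True
  then show ?thesis using assms by (simp add: hom_bas_eq cap_chain_linear)
next
  case False
  have "hb (p \<cdot> b) z = 0" if "tgt Q y = tgt Q g" for z
    using False assms that comp_in_paths[of p b]
    by (simp add: hom_bas_eq successively_append_iff)
  then show ?thesis using False assms by (simp add: hom_bas_eq cap_chain_linear capb_eq)
qed

text \<open>Only \<open>c = hd xs\<close> can match. If this arrow is excluded from the sum, then
  \<open>c \<cdot> b\<close> contains a relation, because \<open>c \<cdot> y\<close> is a piece of
  \<open>xs\<close> and hence in \<Gamma>; then the right side vanishes as well. So the restriction
  to admissible pairs leaves no trace in the result.\<close>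

lemma sum_capb_left:
  assumes v: "(a, Path t xs) \<in> hom_pairs Q I" and u: "(y, b) \<in> coh_pairs Q I"
  shows "(\<Sum>c \<in> {c \<in> arcs Q. tail Q c = tgt Q y \<and> (arrow Q c \<cdot> y, arrow Q c \<cdot> b) \<in> coh_pairs Q I}.
        capb (a, Path t xs) (arrow Q c \<cdot> y, arrow Q c \<cdot> b)) =
    (if xs \<noteq> [] \<and> tgt Q y = tail Q (hd xs) \<and> take (len y) (tl xs) = arrows y
     then scale ((-1) ^ ((length xs + Suc (len y)) * Suc (len y)))
       (hb (a \<cdot> arrow Q (hd xs) \<cdot> b) (Path t (drop (len y) (tl xs)))) else 0)"
proof -
  let ?S = "{c \<in> arcs Q. tail Q c = tgt Q y \<and> (arrow Q c \<cdot> y, arrow Q c \<cdot> b) \<in> coh_pairs Q I}"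
  let ?F = "\<lambda>c. capb (a, Path t xs) (arrow Q c \<cdot> y, arrow Q c \<cdot> b)"
  let ?C = "xs \<noteq> [] \<and> tgt Q y = tail Q (hd xs) \<and> take (len y) (tl xs) = arrows y"
  have vp: "a \<in> paths Q" "Path t xs \<in> paths Q" "successively gstep xs" "src a = tgt Q (Path t xs)"
    using v by (auto simp: hom_pairs_iff)
  have up: "y \<in> paths Q" "b \<in> paths Q" "successively bstep (arrows b)" "src y = src b" "tgt Q y = tgt Q b"
    using u by (auto simp: coh_pairs_iff)
  have F: "?F c = (if xs \<noteq> [] \<and> c = hd xs \<and> take (len y) (tl xs) = arrows y
      then scale ((-1) ^ ((length xs + Suc (len y)) * Suc (len y)))
       (hb (a \<cdot> arrow Q (hd xs) \<cdot> b) (Path t (drop (len y) (tl xs)))) else 0)"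
    if "c \<in> ?S" for c
  proof -
    have "arrow Q c \<cdot> y \<in> paths Q" using that by (simp add: coh_pairs_iff)
    moreover have "tgt Q (arrow Q c \<cdot> y) = head Q c" by (simp add: tgt_def)
    ultimately show ?thesis
      using vp(2) by (cases xs) (auto simp: capb_eq tgt_Path)
  qed
  show ?thesis
  proof (cases ?C)
    case False
    then have "?F c = 0" if "c \<in> ?S" for c using F[OF that] that by auto
    then show ?thesis unfolding if_not_P[OF False] by (intro sum.neutral) blast
  next
    case True
    let ?h = "hd xs"
    have h: "?h \<in> arcs Q" "?h # tl xs = xs" using vp True by (auto simp: paths_iff)
    have hb: "arrow Q ?h \<cdot> b \<in> paths Q" and hy: "arrow Q ?h \<cdot> y \<in> paths Q"
      using h True up by (auto intro!: comp_in_paths arrow_in_paths)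
    show ?thesis
    proof (cases "?h \<in> ?S")
      case h: True
      have "(\<Sum>c\<in>?S. ?F c) = (\<Sum>c\<in>{?h}. ?F c)"
        using h F by (intro sum.mono_neutral_right) auto
      then show ?thesis using F[OF h] True by simp
    next
      case False
      have "successively gstep (arrows (arrow Q ?h \<cdot> y))"
        using successively_take[OF vp(3), of "Suc (len y)"] True h
        by (metis append_Cons append_Nil arrows_arrow arrows_pcomp take_Suc)
      then have "\<not> successively bstep (arrows (arrow Q ?h \<cdot> b))"
        using False h hb hy True up by (auto simp: coh_pairs_iff tgt_def)
      moreover have "a \<cdot> arrow Q ?h \<cdot> b \<in> paths Q"
        by (rule comp_in_paths[OF vp(1) hb]) (use vp(4) True in \<open>simp add: tgt_def\<close>)
      ultimately have "hb (a \<cdot> arrow Q ?h \<cdot> b) z = 0" for z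
        by (simp add: hom_bas_eq successively_append_iff)
      moreover have "?F c = 0" if "c \<in> ?S" for c using F[OF that] that False by auto
      ultimately show ?thesis by (subst sum.neutral) auto
    qed
  qed
qed

text \<open>Mirror image of \<open>sum_capb_left\<close>: the only candidate is the letter of
  \<open>xs\<close> that follows \<open>y\<close>.\<close>

lemma sum_capb_right:
  assumes v: "(a, Path t xs) \<in> hom_pairs Q I" and u: "(y, b) \<in> coh_pairs Q I"
  shows "(\<Sum>c \<in> {c \<in> arcs Q. src y = head Q c \<and> (y \<cdot> arrow Q c, b \<cdot> arrow Q c) \<in> coh_pairs Q I}.
        capb (a, Path t xs) (y \<cdot> arrow Q c, b \<cdot> arrow Q c)) =
    (if len y < length xs \<and> tgt Q y = tgt Q (Path t xs) \<and> take (len y) xs = arrows y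
     then scale ((-1) ^ ((length xs + Suc (len y)) * Suc (len y)))
       (hb (a \<cdot> b \<cdot> arrow Q (xs ! len y)) (Path t (drop (Suc (len y)) xs))) else 0)"
proof -
  let ?S = "{c \<in> arcs Q. src y = head Q c \<and> (y \<cdot> arrow Q c, b \<cdot> arrow Q c) \<in> coh_pairs Q I}"
  let ?F = "\<lambda>c. capb (a, Path t xs) (y \<cdot> arrow Q c, b \<cdot> arrow Q c)"
  let ?C = "len y < length xs \<and> tgt Q y = tgt Q (Path t xs) \<and> take (len y) xs = arrows y"
  have vp: "a \<in> paths Q" "Path t xs \<in> paths Q" "successively gstep xs" "src a = tgt Q (Path t xs)"
    using v by (auto simp: hom_pairs_iff)
  have up: "y \<in> paths Q" "b \<in> paths Q" "successively bstep (arrows b)" "src y = src b" "tgt Q y = tgt Q b"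
    using u by (auto simp: coh_pairs_iff)
  have take: "take (Suc (len y)) xs = arrows y @ [c] \<longleftrightarrow>
      len y < length xs \<and> take (len y) xs = arrows y \<and> c = xs ! len y" for c
  proof
    assume t: "take (Suc (len y)) xs = arrows y @ [c]"
    from arg_cong[OF t, of length] have "len y < length xs" by simp
    with t show "len y < length xs \<and> take (len y) xs = arrows y \<and> c = xs ! len y"
      by (simp add: take_Suc_conv_app_nth)
  qed (simp add: take_Suc_conv_app_nth)
  have F: "?F c = (if ?C \<and> c = xs ! len y
      then scale ((-1) ^ ((length xs + Suc (len y)) * Suc (len y)))
       (hb (a \<cdot> b \<cdot> arrow Q (xs ! len y)) (Path t (drop (Suc (len y)) xs))) else 0)"
    if "c \<in> ?S" for c
  proof -
    have "y \<cdot> arrow Q c \<in> paths Q" using that by (auto simp: coh_pairs_iff)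
    moreover have "tgt Q (y \<cdot> arrow Q c) = tgt Q y"
      using that by (intro tgt_pcomp) simp
    ultimately show ?thesis
      using vp(2) by (auto simp: capb_eq take)
  qed
  show ?thesis
  proof (cases ?C)
    case False
    then have "?F c = 0" if "c \<in> ?S" for c using F[OF that] by auto
    then show ?thesis unfolding if_not_P[OF False] by (intro sum.neutral) blast
  next
    case True
    let ?h = "xs ! len y"
    have split: "xs = arrows y @ ?h # drop (Suc (len y)) xs"
      using True by (metis append_take_drop_id Cons_nth_drop_Suc)
    have p: "Path t (arrows y @ ?h # drop (Suc (len y)) xs) \<in> paths Q"
      and "tgt Q y = tgt Q (Path t (arrows y @ ?h # drop (Suc (len y)) xs))"
      using vp(2) split True by simp_all
    from path_suffix(2)[OF p up(1) this(2)] have sy: "src y = head Q ?h" by (simp add: tgt_Path)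
    have h: "?h \<in> arcs Q" using True vp(2) by (auto simp: paths_iff)
    have hb: "b \<cdot> arrow Q ?h \<in> paths Q" and hy: "y \<cdot> arrow Q ?h \<in> paths Q"
      using h sy up by (auto intro!: comp_in_paths arrow_in_paths)
    show ?thesis
    proof (cases "?h \<in> ?S")
      case h: True
      have "(\<Sum>c\<in>?S. ?F c) = (\<Sum>c\<in>{?h}. ?F c)"
        using h F by (intro sum.mono_neutral_right) auto
      then show ?thesis using F[OF h] True by simp
    next
      case False
      have "successively gstep (arrows (y \<cdot> arrow Q ?h))"
        using successively_take[OF vp(3), of "Suc (len y)"] True
        by (simp add: take_Suc_conv_app_nth)
      moreover have "tgt Q (y \<cdot> arrow Q ?h) = tgt Q (b \<cdot> arrow Q ?h)"
        using up sy by (simp add: tgt_pcomp)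
      ultimately have "\<not> successively bstep (arrows (b \<cdot> arrow Q ?h))"
        using False h hb hy sy by (auto simp: coh_pairs_iff)
      moreover have "a \<cdot> b \<cdot> arrow Q ?h \<in> paths Q"
        by (rule comp_in_paths[OF vp(1) hb]) (use vp(4) True up sy in \<open>simp add: tgt_pcomp\<close>)
      ultimately have "hb (a \<cdot> b \<cdot> arrow Q ?h) z = 0" for z
        by (auto simp: hom_bas_eq successively_append_iff)
      moreover have "?F c = 0" if "c \<in> ?S" for c using F[OF that] that False by auto
      ultimately show ?thesis by (subst sum.neutral) auto
    qed
  qed
qed

lemma coh_diff_bas:
  "coh_diff Q I (bas (g, p)) =
     (\<Sum>b \<in> {b \<in> arcs Q. tail Q b = tgt Q g \<and> (arrow Q b \<cdot> g, arrow Q b \<cdot> p) \<in> coh_pairs Q I}.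
        bas (arrow Q b \<cdot> g, arrow Q b \<cdot> p)) -
     scale ((-1) ^ len g)
     (\<Sum>a \<in> {a \<in> arcs Q. src g = head Q a \<and> (g \<cdot> arrow Q a, p \<cdot> arrow Q a) \<in> coh_pairs Q I}.
        bas (g \<cdot> arrow Q a, p \<cdot> arrow Q a))"
  by (simp add: coh_diff_def)

lemma hom_diff_hb:
  assumes p: "p \<in> paths Q" "src p = tgt Q (Path t ys)" "tgt Q p = t" "Path t ys \<in> paths Q"
  shows "hdiff (hb p (Path t ys)) = (if ys = [] then 0
     else hb (p \<cdot> arrow Q (hd ys)) (Path t (tl ys)) +
       scale ((-1) ^ length ys) (hb (arrow Q (last ys) \<cdot> p) (Path (head Q (last ys)) (butlast ys))))"
proof (cases "successively bstep (arrows p)")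
  case True
  then show ?thesis using p
    by (simp add: hom_bas_eq[OF p(1)] hom_diff_bas last_arrow_def first_arrow_def drop_last_def drop_first_def)
next
  case False
  have "p \<cdot> arrow Q (hd ys) \<in> paths Q" "arrow Q (last ys) \<cdot> p \<in> paths Q" if "ys \<noteq> []"
    using p that by (auto intro!: comp_in_paths arrow_in_paths simp: tgt_Path paths_iff)
  then show ?thesis using False p(1)
    by (auto simp: hom_bas_eq hom_diff_linear successively_append_iff successively_Cons)
qed

lemma hom_diff_capb:
  assumes v: "(a, x) \<in> hom_pairs Q I" and u: "(y, b) \<in> coh_pairs Q I"
  shows "hdiff (capb (a, x) (y, b)) =
    cap_chain Q I (hdiff (bas (a, x))) (bas (y, b)) +
    scale ((-1) ^ (len x + len y)) (cap_chain Q I (bas (a, x)) (coh_diff Q I (bas (y, b))))"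
proof -
  obtain t xs where x: "x = Path t xs" by (cases x)
  let ?p = "length xs" and ?q = "len y"
  have vp: "a \<in> paths Q" "Path t xs \<in> paths Q" "successively gstep xs" "src a = tgt Q (Path t xs)"
      "tgt Q a = t"
    using v by (auto simp: hom_pairs_iff x)
  have up: "y \<in> paths Q" "b \<in> paths Q" "successively bstep (arrows b)" "src y = src b" "tgt Q y = tgt Q b"
    using u by (auto simp: coh_pairs_iff)
  \<comment> \<open>Three terms occur. In \<open>A\<close> the arrow of \<open>x\<close> next to
    \<open>y\<close> is absorbed at the right of \<open>a \<cdot> b\<close>, in \<open>B\<close> the
    first arrow of \<open>x\<close> is carried round to the left, in \<open>C\<close> the last arrow
    of \<open>x\<close> goes between \<open>a\<close> and \<open>b\<close>. The differential of the
    product yields \<open>A\<close> and \<open>B\<close>, that of the chain \<open>C\<close> and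
    \<open>B\<close>, that of the cochain \<open>C\<close> and \<open>A\<close>; the two
    \<open>C\<close> cancel.\<close>
  define C1 where "C1 \<longleftrightarrow> tgt Q y = tgt Q (Path t xs) \<and> take ?q xs = arrows y"
  define C2 where "C2 \<longleftrightarrow> xs \<noteq> [] \<and> tgt Q y = tail Q (hd xs) \<and> take ?q (tl xs) = arrows y"
  define A where "A = hb (a \<cdot> b \<cdot> arrow Q (xs ! ?q)) (Path t (drop (Suc ?q) xs))"
  define B where "B = hb (arrow Q (last xs) \<cdot> a \<cdot> b) (Path (head Q (last xs)) (drop ?q (butlast xs)))"
  define C where "C = hb (a \<cdot> arrow Q (hd xs) \<cdot> b) (Path t (drop ?q (tl xs)))"
  let ?A = "if ?q < ?p \<and> C1 then A else 0"
  let ?B = "if ?q < ?p \<and> C1 then B else 0"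
  let ?C = "if C2 then C else 0"
  have C1q: "?q \<le> ?p" if C1
    using that unfolding C1_def by (metis length_take min.cobounded2 min.commute nle_le order.trans)
  have src_y: "src y = tgt Q (Path t (drop ?q xs))" "Path t (drop ?q xs) \<in> paths Q" if C1
  proof -
    have xs: "xs = arrows y @ drop ?q xs" using that by (metis C1_def append_take_drop_id)
    then have "Path t (arrows y @ drop ?q xs) \<in> paths Q"
      "tgt Q y = tgt Q (Path t (arrows y @ drop ?q xs))"
      using vp(2) that by (simp_all add: C1_def)
    from path_suffix[OF this(1) up(1) this(2)]
    show "src y = tgt Q (Path t (drop ?q xs))" "Path t (drop ?q xs) \<in> paths Q" by simp_all
  qed
  have L: "hdiff (capb (a, x) (y, b)) =
      scale ((-1) ^ ((?p + ?q) * ?q)) (?A + scale ((-1) ^ (?p - ?q)) ?B)"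
  proof (cases C1)
    case True
    have "a \<cdot> b \<in> paths Q" "tgt Q (a \<cdot> b) = t"
      using vp up True by (auto intro!: comp_in_paths simp: C1_def tgt_pcomp)
    moreover have "src (a \<cdot> b) = tgt Q (Path t (drop ?q xs))"
      using src_y[OF True] up by simp
    ultimately have "hdiff (hb (a \<cdot> b) (Path t (drop ?q xs))) = ?A + scale ((-1) ^ (?p - ?q)) ?B"
      using True C1q
      by (subst hom_diff_hb)
        (auto simp: src_y A_def B_def pcomp_assoc hd_drop_conv_nth drop_Suc tl_drop butlast_drop)
    then show ?thesis
      using True up vp by (simp add: x capb_eq C1_def hom_diff_linear)
  next
    case False
    then have "capb (a, x) (y, b) = 0" using up vp by (auto simp: x capb_eq C1_def)
    then show ?thesis using False by (simp add: hom_diff_linear)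
  qed
  have M: "cap_chain Q I (hdiff (bas (a, x))) (bas (y, b)) =
      scale ((-1) ^ ((?p - 1 + ?q) * ?q)) (?C + scale ((-1) ^ ?p) ?B)"
  proof (cases "xs = []")
    case True
    then show ?thesis by (simp add: x hom_diff_bas C2_def cap_chain_linear)
  next
    case False
    let ?l = "arrow Q (hd xs)" and ?f = "arrow Q (last xs)"
    have al: "hd xs \<in> arcs Q" "last xs \<in> arcs Q" "t = tail Q (last xs)"
      using False vp by (auto simp: paths_iff)
    have xs: "hd xs # tl xs = xs" "butlast xs @ [last xs] = xs" using False by simp_all
    have p1: "a \<cdot> ?l \<in> paths Q" "?f \<cdot> a \<in> paths Q"
      using False vp al by (auto intro!: comp_in_paths arrow_in_paths simp: tgt_Path)
    have p2: "Path t (tl xs) \<in> paths Q" and t2: "tgt Q (Path t (tl xs)) = tail Q (hd xs)"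
      using vp(2) False by (cases xs; cases "tl xs"; auto simp: paths_iff comp_def tgt_Path)+
    have "Path t (butlast xs @ [last xs]) \<in> paths Q" using vp(2) False by simp
    then have p3: "Path (head Q (last xs)) (butlast xs) \<in> paths Q"
      by (auto simp: paths_iff successively_append_iff comp_def)
    have t3: "tgt Q (Path (head Q (last xs)) (butlast xs)) = tgt Q (Path t xs)"
      using False by (cases xs; cases "tl xs") (auto simp: tgt_Path)
    have "hdiff (bas (a, x)) = hb (a \<cdot> ?l) (Path t (tl xs)) +
        scale ((-1) ^ ?p) (hb (?f \<cdot> a) (Path (head Q (last xs)) (butlast xs)))"
      using False by (simp add: x hom_diff_bas last_arrow_def first_arrow_def drop_last_def drop_first_def)
    then have "cap_chain Q I (hdiff (bas (a, x))) (bas (y, b)) =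
        capb (a \<cdot> ?l, Path t (tl xs)) (y, b) +
        scale ((-1) ^ ?p) (capb (?f \<cdot> a, Path (head Q (last xs)) (butlast xs)) (y, b))"
      using p1 p2 p3 t2 t3 up vp by (simp add: cap_chain_linear cap_chain_hb)
    moreover have "capb (a \<cdot> ?l, Path t (tl xs)) (y, b) = scale ((-1) ^ ((?p - 1 + ?q) * ?q)) ?C"
      using p2 t2 up False by (auto simp: capb_eq C2_def C_def pcomp_assoc)
    moreover have "capb (?f \<cdot> a, Path (head Q (last xs)) (butlast xs)) (y, b) =
        scale ((-1) ^ ((?p - 1 + ?q) * ?q)) ?B"
    proof -
      \<comment> \<open>Here \<open>y\<close> has to fit into \<open>x\<close> without its first
        arrow, so it must not use up all of \<open>x\<close>; the same condition governs the
        differential of the product.\<close>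
      have "take ?q (butlast xs) = arrows y \<longleftrightarrow> ?q < ?p \<and> take ?q xs = arrows y"
      proof
        assume tk: "take ?q (butlast xs) = arrows y"
        from arg_cong[OF this, of length] have "?q \<le> ?p - 1" by simp
        moreover have "0 < ?p" using False by simp
        ultimately have "?q < ?p" by linarith
        with tk show "?q < ?p \<and> take ?q xs = arrows y" by (simp add: take_butlast)
      qed (simp add: take_butlast)
      then show ?thesis
        using p3 t3 up by (auto simp: capb_eq C1_def B_def pcomp_assoc)
    qed
    ultimately show ?thesis
      by (simp add: scale_add scale_scale mult.commute)
  qed
  have R: "cap_chain Q I (bas (a, x)) (coh_diff Q I (bas (y, b))) =
      scale ((-1) ^ ((?p + Suc ?q) * Suc ?q)) (?C - scale ((-1) ^ ?q) ?A)"
    unfolding coh_diff_bas x cap_chain_linear sum_capb_left[OF v[unfolded x] u]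
      sum_capb_right[OF v[unfolded x] u]
    by (auto simp: C1_def C2_def A_def C_def scale_diff scale_scale mult.commute)
  have sgn: "(-1 :: 'k) ^ m = (-1) ^ n" if "even (m + n)" for m n
    using that by (auto simp: uminus_power_if)
  have sgn': "(-1 :: 'k) ^ m = - ((-1) ^ n)" if "odd (m + n)" for m n
    using that by (auto simp: uminus_power_if)
  have sA: "scale ((-1) ^ ((?p + ?q) * ?q)) ?A =
      - scale ((-1) ^ (?p + ?q)) (scale ((-1) ^ ((?p + Suc ?q) * Suc ?q)) (scale ((-1) ^ ?q) ?A))"
    unfolding scale_scale power_add[symmetric]
    by (subst sgn'[of _ "?p + ?q + (?p + Suc ?q) * Suc ?q + ?q"]) (auto simp: scale_minus_left add.assoc)
  have sB: "scale ((-1) ^ ((?p + ?q) * ?q)) (scale ((-1) ^ (?p - ?q)) ?B) =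
      scale ((-1) ^ ((?p - 1 + ?q) * ?q)) (scale ((-1) ^ ?p) ?B)"
  proof (cases "?q < ?p")
    case True
    \<comment> \<open>This removes the truncated subtractions from the exponents, so that only
      parities remain to be compared.\<close>
    then obtain r where r: "?p = Suc (?q + r)" using less_iff_Suc_add by blast
    show ?thesis
      unfolding scale_scale power_add[symmetric] r
      by (subst sgn[of "(Suc (?q + r) + ?q) * ?q + (Suc (?q + r) - ?q)"
            "(Suc (?q + r) - 1 + ?q) * ?q + Suc (?q + r)"]) auto
  qed simp
  have sC: "scale ((-1) ^ ((?p - 1 + ?q) * ?q)) ?C =
      - scale ((-1) ^ (?p + ?q)) (scale ((-1) ^ ((?p + Suc ?q) * Suc ?q)) ?C)"
  proof (cases C2)
    case True
    then obtain r where r: "?p = Suc r" by (cases xs) (auto simp: C2_def)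
    show ?thesis
      unfolding scale_scale power_add[symmetric] r
      by (subst sgn'[of "(Suc r - 1 + ?q) * ?q" "Suc r + ?q + (Suc r + Suc ?q) * Suc ?q"])
        (auto simp: scale_minus_left)
  qed simp
  have lx: "len x = ?p" by (simp add: x)
  show ?thesis
    unfolding L M R lx scale_add scale_diff sA sB sC by simp
qed

section \<open>The cap product on classes\<close>

text \<open>
  Signs by degree make the Leibniz rule bilinear, hence valid for inhomogeneous chains as well.
\<close>

definition twist :: "(('v, 'a) path \<times> ('v, 'a) path \<Rightarrow>\<^sub>0 'k) \<Rightarrow> ('v, 'a) path \<times> ('v, 'a) path \<Rightarrow>\<^sub>0 'k" where
  "twist = lin_ext (\<lambda>v. scale ((-1) ^ len (snd v)) (bas v))"

definition cotwist :: "(('v, 'a) path \<times> ('v, 'a) path \<Rightarrow>\<^sub>0 'k) \<Rightarrow> ('v, 'a) path \<times> ('v, 'a) path \<Rightarrow>\<^sub>0 'k" where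
  "cotwist = lin_ext (\<lambda>u. scale ((-1) ^ len (fst u)) (bas u))"

lemma poly_mapping_eq_sum_bas: "x = (\<Sum>v\<in>Poly_Mapping.keys x. scale (Poly_Mapping.lookup x v) (bas v))"
  using lin_ext_bas_id[of x] unfolding lin_ext_def by simp

text \<open>Agreement is asked only on the support of \<open>x\<close>, so that rules proved for
  admissible basis pairs extend to chains and cochains.\<close>

lemma linear_eqI:
  fixes f g :: "('b \<Rightarrow>\<^sub>0 'k) \<Rightarrow> ('c \<Rightarrow>\<^sub>0 'k)"
  assumes "\<And>x y. f (x + y) = f x + f y" "\<And>c x. f (scale c x) = scale c (f x)"
    "\<And>x y. g (x + y) = g x + g y" "\<And>c x. g (scale c x) = scale c (g x)"
    and eq: "\<And>v. v \<in> Poly_Mapping.keys x \<Longrightarrow> f (bas v) = g (bas v)"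
  shows "f x = g x"
proof -
  have zero: "f 0 = 0" "g 0 = 0" using assms(2)[of 0 0] assms(4)[of 0 0] by simp_all
  have "f (sum h A) = (\<Sum>v\<in>A. f (h v))" "g (sum h A) = (\<Sum>v\<in>A. g (h v))" for h and A :: "'b set"
    by (induction A rule: infinite_finite_induct) (simp_all add: zero assms)
  then show ?thesis
    by (subst (1 2) poly_mapping_eq_sum_bas[of x]) (simp add: assms(2,4) eq)
qed

lemma coh_diff_linear:
  "coh_diff Q I (x + y) = coh_diff Q I x + coh_diff Q I y"
  "coh_diff Q I (scale c x) = scale c (coh_diff Q I x)"
  "coh_diff Q I (x - y) = coh_diff Q I x - coh_diff Q I y"
  "coh_diff Q I (sum f A) = (\<Sum>i\<in>A. coh_diff Q I (f i))"
  "coh_diff Q I 0 = 0"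
  by (simp_all add: coh_diff_def lin_ext_add lin_ext_scale lin_ext_diff lin_ext_sum)

lemma twist_linear:
  "twist (x - y) = twist x - twist y"
  "twist (x + y) = twist x + twist y" "twist (scale c x) = scale c (twist x)" "twist 0 = 0"
  "cotwist (x + y) = cotwist x + cotwist y" "cotwist (scale c x) = scale c (cotwist x)" "cotwist 0 = 0"
  "cotwist (x - y) = cotwist x - cotwist y" "cotwist (sum f A) = (\<Sum>i\<in>A. cotwist (f i))"
  by (simp_all add: twist_def cotwist_def lin_ext_add lin_ext_scale lin_ext_diff lin_ext_sum)

lemma twist_bas:
  "twist (bas (p, g)) = scale ((-1) ^ len g) (bas (p, g))"
  "cotwist (bas (g, p)) = scale ((-1) ^ len g) (bas (g, p))"
  by (simp_all add: twist_def cotwist_def)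

lemma twist_hb: "twist (hb p g) = scale ((-1) ^ len g) (hb p g)"
  by (simp add: hom_bas_def twist_bas twist_linear)

lemma power_minus_one_sq: "(-1 :: 'k) ^ n * (-1) ^ n = 1"
  by (simp flip: power_mult_distrib)

lemma twist_twist: "twist (twist x) = x"
  by (rule linear_eqI[where f = "\<lambda>x. twist (twist x)" and g = "\<lambda>x. x"])
    (auto simp: twist_linear twist_bas scale_scale power_minus_one_sq)

lemma cotwist_cotwist: "cotwist (cotwist x) = x"
  by (rule linear_eqI[where f = "\<lambda>x. cotwist (cotwist x)" and g = "\<lambda>x. x"])
    (auto simp: twist_linear twist_bas scale_scale power_minus_one_sq)

text \<open>The differential lowers the degree by one and thereby changes the sign that
  \<open>twist\<close> assigns.\<close>

lemma hom_diff_twist: "hdiff (twist x) = - twist (hdiff x)"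
proof (rule linear_eqI[where f = "\<lambda>x. hdiff (twist x)" and g = "\<lambda>x. - twist (hdiff x)"])
  fix v :: "('v, 'a) path \<times> ('v, 'a) path"
  obtain p g where v: "v = (p, g)" by force
  show "hdiff (twist (bas v)) = - twist (hdiff (bas v))"
  proof (cases "arrows g = []")
    case True
    then show ?thesis by (simp add: v twist_bas hom_diff_linear hom_diff_bas twist_linear)
  next
    case False
    then obtain n where n: "len g = Suc n" by (cases "arrows g") auto
    have "len (drop_last g) = n" "len (drop_first Q g) = n"
      using n by (simp_all add: drop_last_def drop_first_def)
    then show ?thesis
      by (simp add: v twist_bas hom_diff_linear hom_diff_bas twist_linear twist_hb n
        scale_diff scale_scale scale_minus_left)
  qed
qed (simp_all add: twist_linear hom_diff_linear scale_minus_right)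

lemma coh_diff_cotwist: "coh_diff Q I (cotwist y) = - cotwist (coh_diff Q I y)"
proof (rule linear_eqI[where f = "\<lambda>y. coh_diff Q I (cotwist y)" and g = "\<lambda>y. - cotwist (coh_diff Q I y)"])
  fix u :: "('v, 'a) path \<times> ('v, 'a) path"
  obtain g p where u: "u = (g, p)" by force
  show "coh_diff Q I (cotwist (bas u)) = - cotwist (coh_diff Q I (bas u))"
    by (simp add: u twist_bas coh_diff_linear coh_diff_bas twist_linear scale_sum scale_scale
      scale_minus_left scale_minus_right sum_negf scale_diff power_minus_one_sq)
qed (simp_all add: twist_linear coh_diff_linear scale_minus_right)

lemma twist_in_hom_chains: "x \<in> hom_chains Q I \<Longrightarrow> twist x \<in> hom_chains Q I"
proof -
  assume x: "x \<in> hom_chains Q I"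
  then have "bas v \<in> hom_chains Q I" if "v \<in> Poly_Mapping.keys x" for v
    using that by (auto simp: hom_chains_def)
  then show "twist x \<in> hom_chains Q I"
    unfolding twist_def lin_ext_def by (intro hom_chains_closed(3,4))
qed

lemma cotwist_in_cochains: "x \<in> cochains Q I \<Longrightarrow> cotwist x \<in> cochains Q I"
  using keys_lin_ext[of "\<lambda>u. scale ((-1) ^ len (fst u)) (bas u)" x]
    keys_scale[of _ "bas _ :: ('v, 'a) path \<times> ('v, 'a) path \<Rightarrow>\<^sub>0 'k"]
  unfolding cotwist_def cochains_def by fastforce

lemma cap_chain_in_hom_chains:
  assumes "x \<in> hom_chains Q I" "y \<in> cochains Q I"
  shows "cap_chain Q I x y \<in> hom_chains Q I"
proof -
  have *: "capb (a, x) (y, b) \<in> hom_chains Q I"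
    if v: "(a, x) \<in> hom_pairs Q I" and u: "(y, b) \<in> coh_pairs Q I" for a b x y
  proof -
    let ?z = "Path (src x) (drop (len y) (arrows x))"
    have xy: "x \<in> paths Q" "y \<in> paths Q" "a \<in> paths Q" "b \<in> paths Q"
      using v u by (auto simp: hom_pairs_iff coh_pairs_iff)
    have "hb (a \<cdot> b) ?z \<in> hom_chains Q I"
      if c: "tgt Q y = tgt Q x" "take (len y) (arrows x) = arrows y"
    proof -
      have xs: "arrows x = arrows y @ drop (len y) (arrows x)"
        using c(2) by (metis append_take_drop_id)
      obtain s xs' where x: "x = Path s (arrows y @ xs')" and z: "?z = Path s xs'"
        using xs by (cases x) auto
      have ab: "a \<cdot> b \<in> paths Q" "tgt Q (a \<cdot> b) = s"
        using v u c xy by (auto intro!: comp_in_paths simp: hom_pairs_iff coh_pairs_iff tgt_pcomp x)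
      have "tgt Q y = tgt Q (Path s (arrows y @ xs'))" using c(1) by (simp add: x)
      note suf = path_suffix[OF xy(1)[unfolded x] xy(2) this]
      moreover have "successively gstep xs'"
        using v by (simp add: x hom_pairs_iff successively_append_iff)
      ultimately show ?thesis
        using ab u unfolding z
        by (auto simp: hom_bas_eq[OF ab(1)] bas_in_hom_chains hom_pairs_iff hom_chains_closed coh_pairs_iff)
    qed
    then show ?thesis
      using xy by (simp add: capb_eq hom_chains_closed)
  qed
  have **: "capb v u \<in> hom_chains Q I" if "v \<in> Poly_Mapping.keys x" "u \<in> Poly_Mapping.keys y" for v u
    using *[of "fst v" "snd v" "fst u" "snd u"] that assms by (auto simp: hom_chains_def cochains_def)
  show ?thesis
    unfolding cap_chain_eq lin_ext_def
    by (intro hom_chains_closed(3,4)) (rule **)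
qed

text \<open>The sign (-1)^(\<open>len x + len y\<close>) of the rule on basis pairs splits:
  \<open>twist\<close> carries the part of \<open>x\<close>, and \<open>cotwist\<close>, applied
  before the coboundary, the part of \<open>y\<close>.\<close>

lemma hom_diff_cap_chain:
  assumes x: "x \<in> hom_chains Q I" and y: "y \<in> cochains Q I"
  shows "hdiff (cap_chain Q I x y) =
    cap_chain Q I (hdiff x) y + cap_chain Q I (twist x) (coh_diff Q I (cotwist y))"
proof (rule linear_eqI[where f = "\<lambda>x. hdiff (cap_chain Q I x y)" and
      g = "\<lambda>x. cap_chain Q I (hdiff x) y + cap_chain Q I (twist x) (coh_diff Q I (cotwist y))"])
  fix v assume "v \<in> Poly_Mapping.keys x"
  then have v: "v \<in> hom_pairs Q I" using x by (auto simp: hom_chains_def)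
  show "hdiff (cap_chain Q I (bas v) y) = cap_chain Q I (hdiff (bas v)) y +
      cap_chain Q I (twist (bas v)) (coh_diff Q I (cotwist y))"
  proof (rule linear_eqI[where f = "\<lambda>y. hdiff (cap_chain Q I (bas v) y)" and
      g = "\<lambda>y. cap_chain Q I (hdiff (bas v)) y +
        cap_chain Q I (twist (bas v)) (coh_diff Q I (cotwist y))"])
    fix u assume "u \<in> Poly_Mapping.keys y"
    then have u: "u \<in> coh_pairs Q I" using y by (auto simp: cochains_def)
    obtain a x' y' b where vu: "v = (a, x')" "u = (y', b)" by force
    show "hdiff (cap_chain Q I (bas v) (bas u)) = cap_chain Q I (hdiff (bas v)) (bas u) +
        cap_chain Q I (twist (bas v)) (coh_diff Q I (cotwist (bas u)))"
      using v u unfolding vu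
      by (simp add: cap_chain_linear hom_diff_capb twist_bas coh_diff_linear scale_scale power_add
        mult.commute)
  qed (simp_all add: cap_chain_linear hom_diff_linear coh_diff_linear twist_linear scale_add)
qed (simp_all add: cap_chain_linear hom_diff_linear coh_diff_linear twist_linear scale_add)

lemma bdry_cap_left:
  assumes "x \<in> hom_chains Q I" "y \<in> cochains Q I" "coh_diff Q I y = 0"
  shows "bdry (cap_chain Q I (hdiff x) y)"
  using bdryI[OF cap_chain_in_hom_chains[OF assms(1,2)]] assms
  by (simp add: hom_diff_cap_chain coh_diff_cotwist twist_linear cap_chain_linear)

text \<open>The Leibniz rule is applied to \<open>twist x\<close>, which is again a cycle, and to
  \<open>cotwist y\<close>; the two pairs of signs then cancel.\<close>

lemma bdry_cap_right:
  assumes "x \<in> hom_chains Q I" "y \<in> cochains Q I" "hdiff x = 0"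
  shows "bdry (cap_chain Q I x (coh_diff Q I y))"
  using bdryI[OF cap_chain_in_hom_chains[OF twist_in_hom_chains[OF assms(1)] cotwist_in_cochains[OF assms(2)]]]
    hom_diff_cap_chain[OF twist_in_hom_chains[OF assms(1)] cotwist_in_cochains[OF assms(2)]] assms(3)
  by (simp add: hom_diff_twist twist_linear cap_chain_linear twist_twist cotwist_cotwist)

text \<open>\<open>cap\<close> collects the products of all representatives. These are homologous,
  since changing both factors adds a cycle capped with a coboundary and a boundary capped with a
  cocycle.\<close>

lemma cap_classes:
  assumes v: "v \<in> hom_chains Q I" "hdiff v = 0"
    and u: "u \<in> cochains Q I" "coh_diff Q I u = 0"
  shows "cap Q I (hom_class Q I v) (coh_class Q I u) = hom_class Q I (cap_chain Q I v u)"
proof -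
  have eq: "hom_class Q I (cap_chain Q I x y) = hom_class Q I (cap_chain Q I v u)"
    if x: "x \<in> hom_class Q I v" and y: "y \<in> coh_class Q I u" for x y
  proof (rule hom_class_cong)
    obtain x' where x': "x - v = hdiff x'" "x' \<in> hom_chains Q I" and xc: "x \<in> hom_chains Q I" "hdiff x = 0"
      using x by (auto simp: hom_class_def)
    obtain y' where y': "y - u = coh_diff Q I y'" "y' \<in> cochains Q I"
      using y by (auto simp: coh_class_def)
    have "cap_chain Q I x y - cap_chain Q I v u =
        cap_chain Q I x (coh_diff Q I y') + cap_chain Q I (hdiff x') u"
      unfolding x'(1)[symmetric] y'(1)[symmetric] by (simp add: cap_chain_linear)
    also have "bdry \<dots>"
      using bdry_cap_left[OF x'(2) u] bdry_cap_right[OF xc(1) y'(2) xc(2)] by (rule bdry_add[OF _ _, rotated])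
    finally show "bdry (cap_chain Q I x y - cap_chain Q I v u)" .
  qed
  moreover have "v \<in> hom_class Q I v"
    using v bdry_zero by (simp add: hom_class_def bdry_def)
  moreover have "u \<in> coh_class Q I u"
    using u image_eqI[of 0 "coh_diff Q I" 0 "cochains Q I"]
    by (simp add: coh_class_def coh_diff_linear cochains_def)
  ultimately show ?thesis unfolding cap_def by blast
qed

end

section \<open>Circuits and their representatives\<close>

context gentle_quiver
begin

definition circ :: "('a \<Rightarrow> 'a \<Rightarrow> bool) \<Rightarrow> ('v, 'a) path set set" where
  "circ S = circuit_of Q ` mk ` {xs. cyclic S xs}"

lemma cyclic_comp: "cyclic gstep xs \<Longrightarrow> cyclic comp xs" "cyclic bstep xs \<Longrightarrow> cyclic comp xs"
  by (erule cyclic_mono, simp add: gstep_comp bstep_comp)+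

lemma mk_in_paths: "cyclic comp xs \<Longrightarrow> mk xs \<in> paths Q"
  using cycles_iff[of "mk xs"] by (auto simp: cycles_def)

text \<open>Squaring exposes the closing junction: besides two copies of the word,
  \<open>cpow p 2\<close> contains the step from its last letter to its first.\<close>

lemma complete_iff: "complete Q I p \<longleftrightarrow> p \<in> mk ` {xs. cyclic gstep xs}"
  and cocomplete_iff: "cocomplete Q I p \<longleftrightarrow> p \<in> mk ` {xs. cyclic bstep xs}"
proof -
  have sq: "cpow (mk xs) 2 \<in> Gam Q I \<longleftrightarrow> cyclic gstep xs" "cpow (mk xs) 2 \<in> Bset Q I \<longleftrightarrow> cyclic bstep xs"
    if "cyclic comp xs" for xs
    using that mk_in_paths[OF cyclic_lpow[OF that, of 2]]
    by (auto simp: cpow_mk Gam_iff Bset_iff cyclic_def successively_append_iff numeral_2_eq_2)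
  show "complete Q I p \<longleftrightarrow> p \<in> mk ` {xs. cyclic gstep xs}"
    unfolding complete_def cycles_iff using sq cyclic_comp by blast
  show "cocomplete Q I p \<longleftrightarrow> p \<in> mk ` {xs. cyclic bstep xs}"
    unfolding cocomplete_def cycles_iff using sq cyclic_comp by blast
qed

lemma circuits_eq_circ:
  "complete_circuits Q I = circ gstep" "cocomplete_circuits Q I = circ bstep"
  unfolding complete_circuits_def cocomplete_circuits_def circ_def complete_iff cocomplete_iff
  by simp_all

lemma circuit_of_mk: "xs \<noteq> [] \<Longrightarrow> circuit_of Q (mk xs) = {mk (rotate i xs) |i. True}"
  by (simp add: circuit_of_def rotn_mk)

lemma circuit_of_rotate: "xs \<noteq> [] \<Longrightarrow> circuit_of Q (mk (rotate i xs)) = circuit_of Q (mk xs)"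
proof -
  assume xs: "xs \<noteq> []"
  have "\<exists>l. rotate j xs = rotate l (rotate i xs)" for j
  proof -
    let ?n = "length xs"
    have "i mod ?n < ?n" using xs by simp
    then have sum: "?n - i mod ?n + j + i mod ?n = j + ?n" by linarith
    \<comment> \<open>Going on by the complement of \<open>i\<close> modulo the length undoes
      \<open>rotate i\<close>.\<close>
    have "rotate (?n - i mod ?n + j) (rotate i xs) = rotate (?n - i mod ?n + j) (rotate (i mod ?n) xs)"
      by (metis rotate_conv_mod)
    also have "\<dots> = rotate (j + ?n) xs"
      by (simp only: rotate_rotate sum)
    also have "\<dots> = rotate j xs"
      by (metis rotate_conv_mod mod_add_self2)
    finally show ?thesis by metis
  qed
  moreover have "\<exists>l. rotate j (rotate i xs) = rotate l xs" for j
    by (metis rotate_rotate)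
  ultimately show ?thesis
    using xs by (auto simp: circuit_of_mk; metis)
qed

text \<open>Both kinds of junctions obey the same determinism; this predicate lets roots, circuits
  and representatives be treated once for both.\<close>

definition stepping :: "('a \<Rightarrow> 'a \<Rightarrow> bool) \<Rightarrow> bool" where
  "stepping S \<longleftrightarrow> S = gstep \<or> S = bstep"

lemma stepping_det:
  assumes "stepping S"
  shows "S a b \<Longrightarrow> S a c \<Longrightarrow> b = c" "S b a \<Longrightarrow> S c a \<Longrightarrow> b = c"
  using assms gstep_bstep_det unfolding stepping_def by blast+

lemma stepping_root:
  assumes S: "stepping S" and xs: "cyclic S xs"
  obtains ys k where "1 \<le> k" "xs = lpow ys k" "distinct ys" "cyclic S ys"
proof (rule cyclic_root[of S xs])
  show "b = c" if "S b a" "S c a" for a b c by (rule stepping_det(2)[OF S that])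
  show "b = c" if "S a b" "S a c" for a b c by (rule stepping_det(1)[OF S that])
qed (use xs that in blast)+

lemma stepping_share:
  assumes S: "stepping S" and "cyclic S xs" "cyclic S ys" "distinct xs" "distinct ys"
    "a \<in> set xs" "a \<in> set ys"
  obtains i where "ys = rotate i xs"
proof (rule cyclic_distinct_share[of S xs ys a])
  show "b = c" if "S a b" "S a c" for a b c by (rule stepping_det(1)[OF S that])
qed (use assms that in blast)+

lemma stepping_comp: "stepping S \<Longrightarrow> cyclic S xs \<Longrightarrow> cyclic comp xs"
  unfolding stepping_def using cyclic_comp by blast

text \<open>The root from \<open>stepping_root\<close> has distinct letters, and a primitive word is
  its own root; conversely, a proper power repeats its first letter.\<close>

lemma primitive_iff_distinct:
  assumes S: "stepping S" and xs: "cyclic S xs"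
  shows "primitive Q (mk xs) \<longleftrightarrow> distinct xs"
proof
  assume p: "primitive Q (mk xs)"
  obtain ys k where y: "1 \<le> k" "xs = lpow ys k" "distinct ys" "cyclic S ys"
    using stepping_root[OF S xs] by blast
  have "mk ys \<in> cycles Q" "mk xs = cpow (mk ys) k"
    using y stepping_comp[OF S] by (auto simp: cycles_iff cpow_mk)
  then have "\<not> 2 \<le> k" using p unfolding primitive_def by blast
  then have "k = 1" using y(1) by linarith
  then show "distinct xs" using y by simp
next
  assume d: "distinct xs"
  have "\<not> (\<exists>q\<in>cycles Q. \<exists>k\<ge>2. mk xs = cpow q k)"
  proof
    assume "\<exists>q\<in>cycles Q. \<exists>k\<ge>2. mk xs = cpow q k"
    then obtain ys k where y: "2 \<le> k" "xs = lpow ys k" "ys \<noteq> []"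
      by (auto simp: cycles_iff cpow_mk cyclic_def)
    then obtain j where "k = Suc (Suc j)" using Suc_le_D numeral_2_eq_2 by (metis Suc_le_mono)
    with d y show False by (cases ys) auto
  qed
  then show "primitive Q (mk xs)"
    using stepping_comp[OF S xs] by (auto simp: primitive_def cycles_iff)
qed

text \<open>A rotation fixes a power exactly if it fixes the root, and with distinct letters only
  multiples of the root length do. So sums over a period have \<open>length ds\<close> terms for
  every exponent.\<close>

lemma period_mk_lpow:
  assumes "distinct ds" "ds \<noteq> []" "1 \<le> k"
  shows "period Q (mk (lpow ds k)) = length ds"
proof -
  have "rotate i (lpow ds k) = lpow ds k \<longleftrightarrow> length ds dvd i" for i
  proof -
    have "rotate i ds = ds" if "lpow (rotate i ds) k = lpow ds k"
    proof -
      obtain j where "k = Suc j" using assms(3) by (cases k) auto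
      with that show ?thesis by simp
    qed
    then show ?thesis
      using rotate_eq_self_iff[OF assms(1,2), of i] by (auto simp: rotate_lpow)
  qed
  then have "period Q (mk (lpow ds k)) = (LEAST i. 1 \<le> i \<and> length ds dvd i)"
    using assms by (simp add: period_def rotn_mk)
  also have "\<dots> = length ds"
    using assms(2) by (intro Least_equality) (auto dest: dvd_imp_le simp: Suc_leI)
  finally show ?thesis .
qed

end

locale based_quiver = gentle_quiver Q I
  for Q :: "('v, 'a) pre_digraph" and I :: "(('v, 'a) path \<Rightarrow>\<^sub>0 'k::field) set" +
  fixes rep :: "('v, 'a) path set \<Rightarrow> ('v, 'a) path"
  assumes conn: "connected Q" and card_verts: "card (verts Q) > 1"
    and reps: "circuit_reps Q I rep"
begin

text \<open>This is where connectedness and the second vertex enter.\<close>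

lemma ex_nonloop:
  assumes e: "e \<in> verts Q"
  obtains c where "c \<in> arcs Q" "tail Q c = e \<or> head Q c = e" "tail Q c \<noteq> head Q c"
proof (rule ccontr)
  assume "\<not> thesis"
  with that have loop: "\<And>c. c \<in> arcs Q \<Longrightarrow> tail Q c = e \<or> head Q c = e \<Longrightarrow> tail Q c = head Q c"
    by metis
  obtain e' where e': "e' \<in> verts Q" "e' \<noteq> e"
  proof -
    have "\<not> verts Q \<subseteq> {e}"
      using card_verts card_mono[of "{e}" "verts Q"] by auto
    then show thesis using that by blast
  qed
  have "e \<rightarrow>\<^sup>*\<^bsub>with_proj (mk_symmetric Q)\<^esub> e'"
    using conn e e' unfolding connected_def strongly_connected_def by simp
  then have "(e, e') \<in> rtrancl_on (verts Q) (parcs (mk_symmetric Q))"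
    by (simp add: reachable_def)
  \<comment> \<open>If all arrows at \<open>e\<close> are loops, a walk in the symmetric closure
    that starts at \<open>e\<close> never leaves it.\<close>
  then have "e' = e"
    by (induction rule: rtrancl_on_induct) (auto simp: parcs_mk_symmetric dest: loop)
  with e' show False by simp
qed

text \<open>A vertex has at most two outgoing and two incoming arrows. Two loops would use up all of
  them and leave no room for the arrow of \<open>ex_nonloop\<close>.\<close>

lemma no_two_loops:
  assumes "comp a a" "comp b b" "comp a b"
  shows "a = b"
proof (rule ccontr)
  assume ab: "a \<noteq> b"
  define e where "e = tail Q a"
  have e: "a \<in> arcs Q" "b \<in> arcs Q" "head Q a = e" "tail Q b = e" "head Q b = e" "tail Q a = e"
    using assms by (auto simp: comp_def e_def)
  then have ev: "e \<in> verts Q" by auto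
  have "card (out_arcs Q e) \<le> 2" "card (in_arcs Q e) \<le> 2"
    using gentle ev unfolding gentle_presentation_def by blast+
  moreover have "{a, b} \<subseteq> out_arcs Q e" "{a, b} \<subseteq> in_arcs Q e"
    using e by auto
  moreover have "card {a, b} = 2" using ab by simp
  moreover have "finite (out_arcs Q e)" "finite (in_arcs Q e)"
    by (auto intro: finite_subset[of _ "arcs Q"])
  ultimately have "{a, b} = out_arcs Q e" "{a, b} = in_arcs Q e"
    by (metis card_seteq)+
  then have "c = a \<or> c = b" if "c \<in> arcs Q" "tail Q c = e \<or> head Q c = e" for c
    using that by (metis in_in_arcs_conv in_out_arcs_conv insertE singletonD)
  moreover obtain c where "c \<in> arcs Q" "tail Q c = e \<or> head Q c = e" "tail Q c \<noteq> head Q c"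
    using ex_nonloop[OF ev] .
  ultimately have "c = a \<or> c = b" "tail Q c \<noteq> head Q c" by blast+
  then show False using e by auto
qed

text \<open>The nonloop arrow at the vertex of \<open>a\<close> is composable with \<open>a\<close>.
  Next to \<open>a\<close> itself it is a second neighbour on that side, while determinism allows
  one of each kind; this is how loops without one kind of junction are ruled out.\<close>

lemma loop_has_other_neighbour:
  assumes "comp a a"
  obtains c where "comp a c" "c \<noteq> a" | c where "comp c a" "c \<noteq> a"
proof -
  have "tail Q a \<in> verts Q" "tail Q a = head Q a" "a \<in> arcs Q" using assms by (auto simp: comp_def)
  then show thesis
    using ex_nonloop[of "tail Q a"] that by (metis comp_def)
qed

text \<open>The words of the chosen primitive cycles of kind \<open>S\<close>;
  \<open>distinct\<close> stands for primitivity, by \<open>primitive_iff_distinct\<close>.\<close>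

definition brep :: "('a \<Rightarrow> 'a \<Rightarrow> bool) \<Rightarrow> 'a list set" where
  "brep S = {ds. cyclic S ds \<and> distinct ds \<and> rep (circuit_of Q (mk ds)) = mk ds}"

lemma base_circuits_eq:
  "base_circuits Q I = primitive_circuits Q \<inter> circ gstep \<union> primitive_circuits Q \<inter> circ bstep"
  by (auto simp: base_circuits_def circuits_eq_circ)

lemma prim_circuit_rep:
  assumes S: "stepping S" and P: "P \<in> primitive_circuits Q \<inter> circ S"
  obtains ds where "ds \<in> brep S" "rep P = mk ds" "P = circuit_of Q (mk ds)"
proof -
  obtain p where p: "primitive Q p" "P = circuit_of Q p" using P by (auto simp: primitive_circuits_def)
  obtain xs where xs: "cyclic S xs" "P = circuit_of Q (mk xs)" using P by (auto simp: circ_def)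
  then have ne: "xs \<noteq> []" by (simp add: cyclic_def)
  have "p \<in> P" using p(2) by (auto simp: circuit_of_def intro: exI[of _ 0])
  then obtain i where i: "p = mk (rotate i xs)" using xs ne by (auto simp: circuit_of_mk)
  have "distinct (rotate i xs)"
    using p(1) i primitive_iff_distinct[OF S cyclic_rotate[OF xs(1)]] by simp
  moreover have "P \<in> base_circuits Q I"
    using P S by (auto simp: base_circuits_eq stepping_def)
  then have "rep P \<in> P" using reps by (auto simp: circuit_reps_def)
  then obtain j where j: "rep P = mk (rotate j xs)" using xs ne by (auto simp: circuit_of_mk)
  moreover have PP: "P = circuit_of Q (mk (rotate j xs))" using xs ne by (simp add: circuit_of_rotate)
  ultimately have "rotate j xs \<in> brep S"
    using cyclic_rotate[OF xs(1), of j] by (simp add: brep_def)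
  with that j PP show thesis by blast
qed

lemma brep_circuit:
  assumes S: "stepping S" and ds: "ds \<in> brep S"
  shows "circuit_of Q (mk ds) \<in> primitive_circuits Q \<inter> circ S"
    "circuit_of Q (mk ds) \<in> base_circuits Q I" "rep (circuit_of Q (mk ds)) = mk ds"
proof -
  show 1: "circuit_of Q (mk ds) \<in> primitive_circuits Q \<inter> circ S"
    using ds primitive_iff_distinct[OF S, of ds]
    by (auto simp: brep_def primitive_circuits_def circ_def)
  then show "circuit_of Q (mk ds) \<in> base_circuits Q I"
    using S by (auto simp: base_circuits_eq stepping_def)
  show "rep (circuit_of Q (mk ds)) = mk ds" using ds by (simp add: brep_def)
qed

lemma reps_eq:
  assumes S: "stepping S"
  shows "rep ` (primitive_circuits Q \<inter> circ S) = mk ` brep S"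
proof
  show "rep ` (primitive_circuits Q \<inter> circ S) \<subseteq> mk ` brep S"
  proof
    fix x assume "x \<in> rep ` (primitive_circuits Q \<inter> circ S)"
    then obtain P where P: "P \<in> primitive_circuits Q \<inter> circ S" "x = rep P" by blast
    from prim_circuit_rep[OF S P(1)] P(2) show "x \<in> mk ` brep S" by blast
  qed
  show "mk ` brep S \<subseteq> rep ` (primitive_circuits Q \<inter> circ S)"
  proof
    fix x assume "x \<in> mk ` brep S"
    then obtain ds where ds: "ds \<in> brep S" "x = mk ds" by blast
    with brep_circuit(1,3)[OF S ds(1)] show "x \<in> rep ` (primitive_circuits Q \<inter> circ S)"
      by (metis image_eqI)
  qed
qed

text \<open>A common arrow makes the two words rotations of each other, and a circuit has only one
  chosen representative.\<close>

lemma brep_share: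
  assumes S: "stepping S" and "ds \<in> brep S" "es \<in> brep S" "a \<in> set ds" "a \<in> set es"
  shows "ds = es"
proof -
  have "cyclic S ds" "cyclic S es" "distinct ds" "distinct es" using assms by (auto simp: brep_def)
  then obtain i where "es = rotate i ds"
    using stepping_share[OF S _ _ _ _ assms(4,5)] by blast
  then have "circuit_of Q (mk es) = circuit_of Q (mk ds)"
    using \<open>cyclic S ds\<close> by (simp add: circuit_of_rotate cyclic_def)
  then have "mk ds = mk es" using assms(2,3) by (simp add: brep_def)
  then show ?thesis by simp
qed

text \<open>The work is uniqueness. A competing power is a rotation of the same word, so its closing
  junction is of both kinds, which forces the kinds to agree; common letters then give the same
  representative, and lengths the same word.\<close>

lemma bar_lpow:
  assumes S: "stepping S" and ds: "ds \<in> brep S" and k: "1 \<le> k"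
  shows "bar Q I rep (circuit_of Q (mk (lpow ds k))) = mk (lpow ds k)"
  unfolding bar_def
proof (rule the_equality)
  have c: "cyclic S ds" using ds by (simp add: brep_def)
  then have ne: "lpow ds k \<noteq> []" using k by (auto simp: cyclic_def)
  have "mk (lpow ds k) \<in> circuit_of Q (mk (lpow ds k))"
    by (auto simp: circuit_of_def intro: exI[of _ 0])
  moreover have "mk (lpow ds k) = cpow (rep (circuit_of Q (mk ds))) k"
    using brep_circuit(3)[OF S ds] k by (simp add: cpow_mk)
  ultimately show "mk (lpow ds k) \<in> circuit_of Q (mk (lpow ds k)) \<and>
      (\<exists>P\<in>base_circuits Q I. \<exists>j\<ge>1. mk (lpow ds k) = cpow (rep P) j)"
    using brep_circuit(2)[OF S ds] k by blast
  fix p assume p: "p \<in> circuit_of Q (mk (lpow ds k)) \<and>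
      (\<exists>P\<in>base_circuits Q I. \<exists>j\<ge>1. p = cpow (rep P) j)"
  then obtain P j where P: "P \<in> base_circuits Q I" "1 \<le> j" "p = cpow (rep P) j" by blast
  then obtain S' where S': "stepping S'" "P \<in> primitive_circuits Q \<inter> circ S'"
    unfolding base_circuits_eq stepping_def by blast
  obtain es where es: "es \<in> brep S'" "rep P = mk es"
    using prim_circuit_rep[OF S'] by metis
  obtain i where i: "p = mk (rotate i (lpow ds k))" using p ne by (auto simp: circuit_of_mk)
  have w: "lpow es j = rotate i (lpow ds k)"
    using P(2,3) es i by (simp add: cpow_mk)
  have c': "cyclic S' es" using es by (simp add: brep_def)
  have "cyclic S (lpow es j)" "cyclic S' (lpow es j)"
    using cyclic_rotate[OF cyclic_lpow[OF c k]] cyclic_lpow[OF c' P(2)] by (simp_all only: w)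
  then have "S (last (lpow es j)) (hd (lpow es j))" "S' (last (lpow es j)) (hd (lpow es j))"
    unfolding cyclic_def by blast+
  then have SS: "S' = S"
    using S S'(1) bstep_not_gstep unfolding stepping_def by blast
  have "set es = set ds"
    using set_lpow[OF P(2), of es] set_lpow[OF k, of ds] w by simp
  moreover have "es \<noteq> []" using c' by (simp add: cyclic_def)
  then have "hd es \<in> set es" by simp
  ultimately have "es = ds" using brep_share[OF S es(1)[unfolded SS] ds] by blast
  moreover have "j * length es = k * length ds"
    using arg_cong[OF w, of length] by simp
  ultimately show "p = mk (lpow ds k)"
    using P es \<open>es \<noteq> []\<close> by (simp add: cpow_mk)
qed

text \<open>The root of a cyclic word is a rotation of the chosen word of its own circuit, and
  rotations commute with powers.\<close>

lemma circ_brep: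
  assumes S: "stepping S" and C: "C \<in> circ S"
  obtains ds k where "ds \<in> brep S" "1 \<le> k" "C = circuit_of Q (mk (lpow ds k))"
    "bar Q I rep C = mk (lpow ds k)"
proof -
  obtain xs where xs: "cyclic S xs" "C = circuit_of Q (mk xs)" using C by (auto simp: circ_def)
  obtain ys k where y: "1 \<le> k" "xs = lpow ys k" "distinct ys" "cyclic S ys"
    using stepping_root[OF S xs(1)] by blast
  have "circuit_of Q (mk ys) \<in> primitive_circuits Q \<inter> circ S"
    using y primitive_iff_distinct[OF S y(4)] by (auto simp: primitive_circuits_def circ_def)
  then obtain ds where ds: "ds \<in> brep S" "circuit_of Q (mk ys) = circuit_of Q (mk ds)"
    using prim_circuit_rep[OF S] by metis
  have "mk ds \<in> circuit_of Q (mk ys)"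
    unfolding ds(2) by (auto simp: circuit_of_def intro: exI[of _ 0])
  then obtain i where "ds = rotate i ys" using y by (auto simp: circuit_of_mk cyclic_def)
  then have "C = circuit_of Q (mk (lpow ds k))"
    using xs y by (simp add: circuit_of_rotate cyclic_def flip: rotate_lpow)
  with that[OF ds(1) y(1)] bar_lpow[OF S ds(1) y(1)] show thesis by simp
qed

lemma brep_circ:
  assumes "stepping S" "ds \<in> brep S" "1 \<le> k"
  shows "circuit_of Q (mk (lpow ds k)) \<in> circ S"
  using assms cyclic_lpow[of S ds k] by (auto simp: circ_def brep_def)

lemma stepping [simp]: "stepping gstep" "stepping bstep"
  by (simp_all add: stepping_def)

lemma basic_B_eq: "basic_B Q I rep = mk ` brep bstep"
  unfolding basic_B_def circuits_eq_circ by (rule reps_eq) simp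

text \<open>The parity clauses in the definition all serve the last conclusion: an even length gives
  the sign 1, an odd one does after squaring, and in characteristic 2 the sign is always 1. Later
  arguments use the sign in place of the case distinction.\<close>

lemma basic_Gam_elim:
  assumes "p \<in> basic_Gam Q I rep"
  obtains ds w where "ds \<in> brep gstep" "1 \<le> w" "p = mk (lpow ds w)"
    "(-1 :: 'k) ^ length (lpow ds w) = 1"
proof -
  have Ds: "rep ` (primitive_circuits Q \<inter> complete_circuits Q I) = mk ` brep gstep"
    unfolding circuits_eq_circ by (rule reps_eq) simp
  show thesis
  proof (cases "CHAR('k) = 2")
    case True
    then have "of_nat 2 = (0 :: 'k)" by (metis of_nat_CHAR)
    then have "(1 :: 'k) + 1 = 0" by (metis of_nat_numeral one_add_one)
    then have "(- 1 :: 'k) = 1" by (rule minus_unique)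
    then have "(-1 :: 'k) ^ n = 1" for n by (metis power_one)
    moreover obtain ds where "ds \<in> brep gstep" "p = mk ds"
      using assms True Ds by (auto simp: basic_Gam_def)
    ultimately show thesis using that[of ds 1] by simp
  next
    case False
    then have "p \<in> {D \<in> mk ` brep gstep. even (len D)} \<union> {cpow D 2 |D. D \<in> mk ` brep gstep \<and> odd (len D)}"
      using assms Ds by (simp add: basic_Gam_def)
    then consider ds where "ds \<in> brep gstep" "p = mk ds" "even (length ds)"
      | ds where "ds \<in> brep gstep" "p = mk (lpow ds 2)"
      by (auto simp: cpow_mk)
    then show thesis
    proof cases
      case 1
      then show thesis using that[of ds 1] by simp
    next
      case 2
      then show thesis using that[of ds 2] by simp
    qed
  qed
qed

end

section \<open>The generators are cocycles and the basis elements are cycles\<close>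

context gentle_quiver
begin

lemma cyclic_comp_facts:
  assumes "cyclic comp w"
  shows "w \<noteq> []" "set w \<subseteq> arcs Q" "successively comp w" "head Q (hd w) = tail Q (last w)"
    "hd w \<in> arcs Q" "last w \<in> arcs Q" "tail Q (last w) \<in> verts Q" "mk w \<in> paths Q"
  using assms mk_in_paths[OF assms] by (auto simp: cyclic_def comp_def mk_def paths_iff)

lemma mk_Path: "mk w = Path (tail Q (last w)) w"
  by (simp add: mk_def)

text \<open>
  The basis pairs that make up the generators, for a cyclic word \<open>w\<close>. The pair \<open>VB1 w\<close> is
  \<open>(f'(p), f(p))\<close> for \<open>p\<close> the rotation of \<open>w\<close> by one step; since only sums over all rotations
  matter, this shift is harmless, and it trades \<open>last\<close> and \<open>butlast\<close> for \<open>hd\<close> and \<open>tl\<close>.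
\<close>

definition UB :: "'a list \<Rightarrow> ('v, 'a) path \<times> ('v, 'a) path" where
  "UB w = (vert (tail Q (last w)), mk w)"

definition UG :: "'a list \<Rightarrow> ('v, 'a) path \<times> ('v, 'a) path" where
  "UG w = (mk w, vert (tail Q (last w)))"

text \<open>As formulas \<open>VB0\<close> and \<open>UG\<close> coincide, and so do
  \<open>VG\<close> and \<open>UB\<close>. The names record the complex: \<open>U\<close> for
  cochains, whose component in \<Gamma> comes first, and \<open>V\<close> for chains, where it comes
  second.\<close>

definition VB0 :: "'a list \<Rightarrow> ('v, 'a) path \<times> ('v, 'a) path" where
  "VB0 w = (mk w, vert (tail Q (last w)))"

definition VB1 :: "'a list \<Rightarrow> ('v, 'a) path \<times> ('v, 'a) path" where
  "VB1 w = (Path (head Q (hd w)) (tl w), arrow Q (hd w))"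

definition VG :: "'a list \<Rightarrow> ('v, 'a) path \<times> ('v, 'a) path" where
  "VG w = (vert (tail Q (last w)), mk w)"

definition VG' :: "'a list \<Rightarrow> ('v, 'a) path \<times> ('v, 'a) path" where
  "VG' w = (arrow Q (hd w), Path (tail Q (last w)) (tl w))"

lemma vert_pair: "e \<in> verts Q \<Longrightarrow> (vert e, vert e) \<in> hom_pairs Q I"
  by (simp add: hom_pairs_iff vert_def paths_iff tgt_def)

lemma UB_pair: "cyclic comp w \<Longrightarrow> successively bstep w \<Longrightarrow> UB w \<in> coh_pairs Q I"
  using cyclic_comp_facts[of w] by (simp add: UB_def coh_pairs_iff vert_def paths_iff tgt_Path mk_Path)

lemma UG_pair: "cyclic gstep w \<Longrightarrow> UG w \<in> coh_pairs Q I"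
  using cyclic_comp_facts[OF cyclic_comp(1), of w]
  by (simp add: UG_def coh_pairs_iff vert_def paths_iff tgt_Path mk_Path cyclic_def)

lemma VB0_pair: "cyclic bstep w \<Longrightarrow> VB0 w \<in> hom_pairs Q I"
  using cyclic_comp_facts[OF cyclic_comp(2), of w]
  by (simp add: VB0_def hom_pairs_iff vert_def paths_iff tgt_Path mk_Path cyclic_def)

lemma VG_pair: "cyclic gstep w \<Longrightarrow> VG w \<in> hom_pairs Q I"
  using cyclic_comp_facts[OF cyclic_comp(1), of w]
  by (simp add: VG_def hom_pairs_iff vert_def paths_iff tgt_Path mk_Path cyclic_def)

lemma tl_path:
  assumes "cyclic comp w"
  shows "Path (tail Q (last w)) (tl w) \<in> paths Q" "tgt Q (Path (tail Q (last w)) (tl w)) = tail Q (hd w)"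
  using cyclic_comp_facts[OF assms]
  by (cases w; cases "tl w"; auto simp: paths_iff tgt_Path comp_def)+

lemma VB1_pair: "cyclic bstep w \<Longrightarrow> VB1 w \<in> hom_pairs Q I"
  using cyclic_comp_facts[OF cyclic_comp(2), of w] tl_path[OF cyclic_comp(2), of w]
  by (cases w; cases "tl w") (auto simp: VB1_def hom_pairs_iff arrow_def paths_iff tgt_Path cyclic_def comp_def)

lemma VG'_pair: "cyclic gstep w \<Longrightarrow> VG' w \<in> hom_pairs Q I"
  using cyclic_comp_facts[OF cyclic_comp(1), of w] tl_path[OF cyclic_comp(1), of w]
  by (cases w; cases "tl w") (auto simp: VG'_def hom_pairs_iff arrow_def paths_iff tgt_Path cyclic_def comp_def)

lemma coh_left_iff:
  assumes "(y, p) \<in> coh_pairs Q I"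
  shows "c \<in> arcs Q \<and> tail Q c = tgt Q y \<and> (arrow Q c \<cdot> y, arrow Q c \<cdot> p) \<in> coh_pairs Q I \<longleftrightarrow>
    c \<in> arcs Q \<and> tail Q c = tgt Q y \<and> (arrows y \<noteq> [] \<longrightarrow> gstep c (hd (arrows y))) \<and>
      (arrows p \<noteq> [] \<longrightarrow> bstep c (hd (arrows p)))"
proof -
  have "arrow Q c \<cdot> y \<in> paths Q" "arrow Q c \<cdot> p \<in> paths Q"
    if "c \<in> arcs Q" "tail Q c = tgt Q y"
    using assms that by (auto simp: coh_pairs_iff intro!: comp_in_paths arrow_in_paths)
  then show ?thesis
    using assms by (auto simp: coh_pairs_iff successively_Cons tgt_def)
qed

lemma coh_right_iff:
  assumes "(y, p) \<in> coh_pairs Q I"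
  shows "c \<in> arcs Q \<and> src y = head Q c \<and> (y \<cdot> arrow Q c, p \<cdot> arrow Q c) \<in> coh_pairs Q I \<longleftrightarrow>
    c \<in> arcs Q \<and> src y = head Q c \<and> (arrows y \<noteq> [] \<longrightarrow> gstep (last (arrows y)) c) \<and>
      (arrows p \<noteq> [] \<longrightarrow> bstep (last (arrows p)) c)"
proof -
  have "y \<cdot> arrow Q c \<in> paths Q" "p \<cdot> arrow Q c \<in> paths Q"
      "tgt Q (y \<cdot> arrow Q c) = tgt Q (p \<cdot> arrow Q c)"
    if "c \<in> arcs Q" "src y = head Q c"
    using assms that by (auto simp: coh_pairs_iff tgt_pcomp intro!: comp_in_paths arrow_in_paths)
  then show ?thesis
    using assms by (auto simp: coh_pairs_iff successively_append_iff)
qed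

lemma coh_diff_pair:
  assumes "(y, p) \<in> coh_pairs Q I"
  shows "coh_diff Q I (bas (y, p)) =
    (\<Sum>c \<in> {c \<in> arcs Q. tail Q c = tgt Q y \<and> (arrows y \<noteq> [] \<longrightarrow> gstep c (hd (arrows y))) \<and>
        (arrows p \<noteq> [] \<longrightarrow> bstep c (hd (arrows p)))}. bas (arrow Q c \<cdot> y, arrow Q c \<cdot> p)) -
    scale ((-1) ^ len y)
    (\<Sum>c \<in> {c \<in> arcs Q. src y = head Q c \<and> (arrows y \<noteq> [] \<longrightarrow> gstep (last (arrows y)) c) \<and>
        (arrows p \<noteq> [] \<longrightarrow> bstep (last (arrows p)) c)}. bas (y \<cdot> arrow Q c, p \<cdot> arrow Q c))"
  unfolding coh_diff_bas coh_left_iff[OF assms] coh_right_iff[OF assms] ..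

lemma coh_diff_eq_0:
  assumes "(y, p) \<in> coh_pairs Q I"
    and "\<And>c. c \<in> arcs Q \<Longrightarrow> tail Q c = tgt Q y \<Longrightarrow> (arrows y \<noteq> [] \<Longrightarrow> gstep c (hd (arrows y))) \<Longrightarrow>
        (arrows p \<noteq> [] \<Longrightarrow> bstep c (hd (arrows p))) \<Longrightarrow> False"
    and "\<And>c. c \<in> arcs Q \<Longrightarrow> src y = head Q c \<Longrightarrow> (arrows y \<noteq> [] \<Longrightarrow> gstep (last (arrows y)) c) \<Longrightarrow>
        (arrows p \<noteq> [] \<Longrightarrow> bstep (last (arrows p)) c) \<Longrightarrow> False"
  shows "coh_diff Q I (bas (y, p)) = 0"
proof -
  have "{c \<in> arcs Q. tail Q c = tgt Q y \<and> (arrows y \<noteq> [] \<longrightarrow> gstep c (hd (arrows y))) \<and>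
        (arrows p \<noteq> [] \<longrightarrow> bstep c (hd (arrows p)))} = {}"
    using assms(2) by blast
  moreover have "{c \<in> arcs Q. src y = head Q c \<and> (arrows y \<noteq> [] \<longrightarrow> gstep (last (arrows y)) c) \<and>
        (arrows p \<noteq> [] \<longrightarrow> bstep (last (arrows p)) c)} = {}"
    using assms(3) by blast
  ultimately show ?thesis
    unfolding coh_diff_pair[OF assms(1)] by (simp only: sum.empty scale_zero diff_self)
qed

lemma arrow_vert: "tail Q c = e \<Longrightarrow> arrow Q c \<cdot> vert e = arrow Q c"
  by (auto simp: arrow_def vert_def pcomp_def)

lemma vert_arrow: "vert e \<cdot> arrow Q c = arrow Q c"
  by (auto simp: arrow_def vert_def pcomp_def)

lemma Collect_eq_singletonI: "P x \<Longrightarrow> (\<And>y. P y \<Longrightarrow> y = x) \<Longrightarrow> {y. P y} = {x}"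
  by blast

text \<open>By determinism the cyclic neighbour is the only \<open>bstep\<close> extension on either
  side. Since \<open>w @ [hd w]\<close> is \<open>rotate1 w\<close> with its last letter repeated in
  front, the two terms are one expression at \<open>w\<close> and at \<open>rotate1 w\<close>, and
  the sum over rotations telescopes.\<close>

lemma coh_diff_UB:
  assumes w: "cyclic bstep w"
  shows "coh_diff Q I (bas (UB w)) =
    bas (arrow Q (last w), mk (last w # w)) - bas (arrow Q (hd w), mk (w @ [hd w]))"
proof -
  have p: "UB w \<in> coh_pairs Q I"
    using w cyclic_comp(2) by (auto simp: cyclic_def intro!: UB_pair)
  note f = cyclic_comp_facts[OF cyclic_comp(2)[OF w]]
  have b: "bstep (last w) (hd w)" using w by (simp add: cyclic_def)
  have "{c \<in> arcs Q. tail Q c = tgt Q (vert (tail Q (last w))) \<and>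
        bstep c (hd w)} = {last w}"
  proof (rule Collect_eq_singletonI, goal_cases)
    case 1
    show ?case using f(4-6) b by (simp add: vert_def tgt_def)
  next
    case (2 c)
    then show ?case using gstep_bstep_det(4)[OF _ b] by metis
  qed
  moreover have "{c \<in> arcs Q. tail Q (last w) = head Q c \<and> bstep (last w) c} = {hd w}"
  proof (rule Collect_eq_singletonI, goal_cases)
    case 1
    show ?case using f(4-6) b by (simp add: vert_def tgt_def)
  next
    case (2 c)
    then show ?case using gstep_bstep_det(3)[OF b] by metis
  qed
  ultimately show ?thesis
    unfolding UB_def coh_diff_pair[OF p[unfolded UB_def]]
    using f(1) by (simp add: vert_def arrow_def pcomp_def mk_def)
qed

text \<open>The argument of \<open>coh_diff_UB\<close> with \<open>gstep\<close>. The coboundary now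
  carries the sign (-1)^length, and \<open>sgn\<close> makes the two terms a difference that
  telescopes.\<close>

lemma coh_diff_UG:
  assumes w: "cyclic gstep w" and sgn: "(-1 :: 'k) ^ length w = 1"
  shows "coh_diff Q I (bas (UG w)) =
    bas (mk (last w # w), arrow Q (last w)) - bas (mk (w @ [hd w]), arrow Q (hd w))"
proof -
  have p: "UG w \<in> coh_pairs Q I" by (rule UG_pair[OF w])
  note f = cyclic_comp_facts[OF cyclic_comp(1)[OF w]]
  have b: "gstep (last w) (hd w)" using w by (simp add: cyclic_def)
  have "{c \<in> arcs Q. tail Q c = head Q (hd w) \<and> gstep c (hd w)} = {last w}"
  proof (rule Collect_eq_singletonI, goal_cases)
    case 1
    show ?case using f(4-6) b by (simp add: vert_def tgt_def)
  next
    case (2 c)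
    then show ?case using gstep_bstep_det(2)[OF _ b] by metis
  qed
  moreover have "{c \<in> arcs Q. tail Q (last w) = head Q c \<and> gstep (last w) c} = {hd w}"
  proof (rule Collect_eq_singletonI, goal_cases)
    case 1
    show ?case using f(4-6) b by (simp add: vert_def tgt_def)
  next
    case (2 c)
    then show ?case using gstep_bstep_det(1)[OF b] by metis
  qed
  ultimately show ?thesis
    unfolding UG_def coh_diff_pair[OF p[unfolded UG_def]]
    using f(1) sgn by (simp add: vert_def arrow_def pcomp_def mk_def tgt_Path)
qed

lemma rotate_eq_rotate1: "rotate (Suc i) w = rotate1 (rotate i w)"
  by simp

lemma rotate1_conv: "w \<noteq> [] \<Longrightarrow> rotate1 w = tl w @ [hd w]"
  by (cases w) simp_all

lemma sum_rotate_telescope: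
  fixes f :: "'a list \<Rightarrow> 'b::ab_group_add"
  shows "(\<Sum>i<length ds. f (rotate i (lpow ds k)) - f (rotate (Suc i) (lpow ds k))) = 0"
  by (rule sum_telescope_cyclic) (simp add: rotate_lpow)

lemma sum_rotate_shift:
  fixes f :: "'a list \<Rightarrow> 'b::comm_monoid_add"
  shows "(\<Sum>i<length ds. f (rotate (Suc i) (lpow ds k))) = (\<Sum>i<length ds. f (rotate i (lpow ds k)))"
  by (rule sum_shift) (simp add: rotate_lpow)

lemma angle_cocomplete_cocycle:
  assumes ds: "cyclic bstep ds"
  shows "coh_diff Q I (\<Sum>i<length ds. bas (UB (rotate i ds))) = 0"
proof -
  let ?f = "\<lambda>w. bas (arrow Q (last w), mk (last w # w))"
  have "coh_diff Q I (bas (UB (rotate i ds))) = ?f (rotate i (lpow ds 1)) - ?f (rotate (Suc i) (lpow ds 1))"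
    for i
  proof -
    have ne: "rotate i ds \<noteq> []" using ds by (simp add: cyclic_def)
    then have "hd (rotate i ds) # tl (rotate i ds) = rotate i ds"
      by (rule list.collapse)
    then show ?thesis
      using coh_diff_UB[OF cyclic_rotate[OF ds, of i]] rotate1_conv[OF ne]
      by (metis append_Cons last_snoc rotate_eq_rotate1 lpow_simps One_nat_def append_Nil2)
  qed
  then show ?thesis
    unfolding coh_diff_linear using sum_rotate_telescope[of ?f ds 1] by simp
qed

lemma angle_complete_cocycle:
  assumes ds: "cyclic gstep ds" and w: "1 \<le> w" and sgn: "(-1 :: 'k) ^ length (lpow ds w) = 1"
  shows "coh_diff Q I (\<Sum>i<length ds. bas (UG (rotate i (lpow ds w)))) = 0"
proof -
  let ?f = "\<lambda>w. bas (mk (last w # w), arrow Q (last w))"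
  have c: "cyclic gstep (rotate i (lpow ds w))" for i by (intro cyclic_rotate cyclic_lpow ds w)
  have "coh_diff Q I (bas (UG (rotate i (lpow ds w)))) =
      ?f (rotate i (lpow ds w)) - ?f (rotate (Suc i) (lpow ds w))" for i
  proof -
    have "rotate (Suc i) (lpow ds w) = tl (rotate i (lpow ds w)) @ [hd (rotate i (lpow ds w))]"
      using c[of i] by (simp add: rotate1_conv cyclic_def)
    moreover have "hd (rotate i (lpow ds w)) # tl (rotate i (lpow ds w)) = rotate i (lpow ds w)"
      using c[of i] unfolding cyclic_def by simp
    ultimately show ?thesis
      using coh_diff_UG[OF c[of i]] sgn
      by (metis append_Cons last_snoc length_rotate)
  qed
  then show ?thesis
    unfolding coh_diff_linear using sum_rotate_telescope[of ?f ds w] by simp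
qed

text \<open>The removed arrow \<open>hd w\<close> closes the arc \<open>tl w\<close> again on the
  right or on the left, which gives two consecutive rotations; hence all rotations are
  homologous.\<close>

lemma hom_diff_VB1:
  assumes w: "cyclic bstep w"
  shows "hdiff (bas (VB1 w)) = bas (VB0 (rotate1 w)) - bas (VB0 w)"
proof -
  note f = cyclic_comp_facts[OF cyclic_comp(2)[OF w]]
  obtain a xs where w': "w = a # xs" using f(1) by (cases w) auto
  have r: "cyclic bstep (xs @ [a])" using cyclic_rotate1[OF w] by (simp add: w')
  have "hb (Path (tail Q a) (xs @ [a])) z = bas (Path (tail Q a) (xs @ [a]), z)" for z
    using cyclic_comp_facts(8)[OF cyclic_comp(2)[OF r]] r by (simp add: hom_bas_eq mk_def cyclic_def)
  moreover have "hb (Path (head Q a) (a # xs)) z = bas (mk w, z)" for z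
    using f(4,8) w by (simp add: hom_bas_eq mk_def cyclic_def w')
  ultimately show ?thesis
    using f(4) by (simp add: VB1_def VB0_def hom_diff_bas w' pcomp_def arrow_def last_arrow_def
        first_arrow_def drop_last_def drop_first_def vert_def mk_def scale_minus_one)
qed

lemma bdry_VB0_rotate:
  assumes w: "cyclic bstep w"
  shows "bdry (bas (VB0 (rotate i w)) - bas (VB0 w))"
proof (induction i)
  case (Suc i)
  have c: "cyclic bstep (rotate i w)" by (rule cyclic_rotate[OF w])
  have "bdry (bas (VB0 (rotate1 (rotate i w))) - bas (VB0 (rotate i w)))"
    using bdryI[of "bas (VB1 (rotate i w))"] VB1_pair[OF c]
    by (simp add: hom_diff_VB1[OF c] bas_in_hom_chains)
  from bdry_trans[OF this Suc] show ?case by simp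
qed simp

lemma bracket_cocomplete_cycle:
  assumes ds: "cyclic bstep ds" and k: "1 \<le> k"
  shows "hdiff (\<Sum>i<length ds. bas (VB1 (rotate i (lpow ds k)))) = 0"
proof -
  have c: "cyclic bstep (rotate i (lpow ds k))" for i by (intro cyclic_rotate cyclic_lpow ds k)
  have "hdiff (\<Sum>i<length ds. bas (VB1 (rotate i (lpow ds k)))) =
      - (\<Sum>i<length ds. bas (VB0 (rotate i (lpow ds k))) - bas (VB0 (rotate (Suc i) (lpow ds k))))"
    unfolding hom_diff_linear sum_negf[symmetric]
    by (intro sum.cong refl) (simp add: hom_diff_VB1[OF c])
  also have "\<dots> = - 0"
    by (rule arg_cong[OF sum_rotate_telescope[of "\<lambda>w. bas (VB0 w)"]])
  finally show ?thesis by simp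
qed

lemma hom_diff_VG:
  assumes w: "cyclic gstep w"
  shows "hdiff (bas (VG (rotate1 w))) =
    bas (VG' (rotate1 w)) + scale ((-1) ^ length w) (bas (VG' w))"
proof -
  note f = cyclic_comp_facts[OF cyclic_comp(1)[OF w]]
  obtain a xs where w': "w = a # xs" using f(1) by (cases w) auto
  have r: "cyclic gstep (xs @ [a])" using cyclic_rotate1[OF w] by (simp add: w')
  note g = cyclic_comp_facts[OF cyclic_comp(1)[OF r]]
  have h: "hb (Path (tail Q c) [c]) z = bas (arrow Q c, z)" if "c \<in> arcs Q" for c z
    using arrow_in_paths[OF that] by (simp add: hom_bas_eq arrow_def)
  have "last (if xs = [] then [a] else xs) = last w" by (simp add: w')
  then show ?thesis
    using f g h[of a] h[of "hd (xs @ [a])"]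
    by (simp add: VG_def VG'_def hom_diff_bas w' pcomp_def arrow_def last_arrow_def
        first_arrow_def drop_last_def drop_first_def vert_def mk_def)
qed

text \<open>The next rotation costs (-1)^(m+1) in the bracket and (-1)^m in the differential; the
  resulting -1 makes the sums over rotations telescope.\<close>

lemma sign_step: "(-1 :: 'k) ^ ((m + 1) * Suc i) * (-1) ^ m = - ((-1) ^ ((m + 1) * i))"
proof -
  have "(m + 1) * Suc i + m = (m + 1) * i + (2 * m + 1)" by simp
  then have "(-1 :: 'k) ^ ((m + 1) * Suc i) * (-1) ^ m = (-1) ^ ((m + 1) * i + (2 * m + 1))"
    by (simp only: power_add[symmetric])
  also have "\<dots> = - ((-1) ^ ((m + 1) * i))"
    by (simp only: power_add power_mult) simp
  finally show ?thesis .
qed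

lemma bdry_VG'_rotate:
  assumes w: "cyclic gstep w"
  shows "bdry (scale ((-1) ^ ((length w + 1) * i)) (bas (VG' (rotate i w))) - bas (VG' w))"
proof (induction i)
  case (Suc i)
  let ?m = "length w"
  have c: "cyclic gstep (rotate i w)" by (rule cyclic_rotate[OF w])
  have "bdry (hdiff (bas (VG (rotate1 (rotate i w)))))"
    by (intro bdryI) (simp add: bas_in_hom_chains VG_pair cyclic_rotate1 c)
  from bdry_scale[OF this, of "(-1) ^ ((?m + 1) * Suc i)"]
  have "bdry (scale ((-1) ^ ((?m + 1) * Suc i)) (bas (VG' (rotate (Suc i) w))) -
      scale ((-1) ^ ((?m + 1) * i)) (bas (VG' (rotate i w))))"
    unfolding hom_diff_VG[OF c] scale_add scale_scale length_rotate sign_step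
    by (simp add: scale_minus_left)
  from bdry_trans[OF this Suc] show ?case .
qed simp

lemma bracket_complete_cycle:
  assumes ds: "cyclic gstep ds" and k: "1 \<le> k"
    and sgn: "(-1 :: 'k) ^ ((length (lpow ds k) + 1) * length ds) = 1"
  shows "hdiff (\<Sum>i<length ds. scale ((-1) ^ ((length (lpow ds k) + 1) * i))
    (bas (VG (rotate i (lpow ds k))))) = 0"
proof -
  let ?cs = "lpow ds k"
  let ?s = "\<lambda>i. (-1 :: 'k) ^ ((length ?cs + 1) * i)"
  let ?f = "\<lambda>i. scale (?s i) (bas (VG (rotate i ?cs)))"
  let ?g = "\<lambda>i. scale (?s i) (bas (VG' (rotate i ?cs)))"
  have c: "cyclic gstep (rotate i ?cs)" for i by (intro cyclic_rotate cyclic_lpow ds k)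
  have per: "rotate (length ds) ?cs = ?cs" by (simp add: rotate_lpow)
  \<comment> \<open>\<open>hom_diff_VG\<close> computes the differential at
    \<open>rotate1 w\<close>, so the index is moved up first; \<open>sgn\<close> is what makes the
    shifted sum the same.\<close>
  have "(\<Sum>i<length ds. ?f i) = (\<Sum>i<length ds. ?f (Suc i))"
    by (rule sum_shift[symmetric]) (simp only: sgn per, simp)
  also have "hdiff \<dots> = (\<Sum>i<length ds. ?g (Suc i) - ?g i)"
    unfolding hom_diff_linear
  proof (intro sum.cong refl)
    fix i
    have "scale (?s (Suc i)) (hdiff (bas (VG (rotate (Suc i) ?cs)))) =
        ?g (Suc i) + scale (?s (Suc i) * (-1) ^ length ?cs) (bas (VG' (rotate i ?cs)))"
      using hom_diff_VG[OF c[of i]] by (simp only: rotate_eq_rotate1 scale_add scale_scale length_rotate)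
    also have "?s (Suc i) * (-1) ^ length ?cs = - ?s i"
      by (rule sign_step)
    finally show "scale (?s (Suc i)) (hdiff (bas (VG (rotate (Suc i) ?cs)))) = ?g (Suc i) - ?g i"
      by (simp only: scale_minus_left) simp
  qed
  also have "\<dots> = - (\<Sum>i<length ds. ?g i - ?g (Suc i))"
    by (simp only: sum_negf[symmetric] minus_diff_eq)
  also have "\<dots> = - 0"
    by (rule arg_cong[OF sum_telescope_cyclic]) (simp only: sgn per, simp)
  finally show ?thesis by simp
qed

text \<open>Either summand puts two consecutive letters of a complete cycle into the left component,
  and these form a relation; for a single letter the degree is 0.\<close>

lemma hom_diff_VG':
  assumes w: "cyclic gstep w"
  shows "hdiff (bas (VG' w)) = 0"
proof (cases "tl w = []")
  case False
  note f = cyclic_comp_facts[OF cyclic_comp(1)[OF w]]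
  obtain a b xs where w': "w = a # b # xs" using f(1) False by (cases w; cases "tl w") auto
  have ab: "gstep a b" "gstep (last (b # xs)) a" using w by (auto simp: cyclic_def w')
  have z: "hb (Path (tail Q d) [c, d]) z = 0" if "gstep c d" for c d z
  proof -
    have "Path (tail Q d) [c, d] \<in> paths Q"
      using gstep_comp[OF that] by (simp add: paths_iff comp_def)
    then show ?thesis using bstep_not_gstep that by (auto simp: hom_bas_eq)
  qed
  show ?thesis
    using z[OF ab(1)] z[OF ab(2)]
    by (simp add: VG'_def w' hom_diff_bas pcomp_def arrow_def last_arrow_def first_arrow_def)
qed (simp add: VG'_def hom_diff_bas)

end

section \<open>Cap products of generators and basis elements\<close>

context gentle_quiver
begin

lemma capb_vert:
  assumes "e \<in> verts Q" "x \<in> paths Q"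
  shows "capb (a, x) (vert e, b) = (if e = tgt Q x then hb (a \<cdot> b) x else 0)"
proof -
  have "Path (src x) (arrows x) = x" by simp
  then show ?thesis
    using assms capb_eq[OF assms(2) vert_in_paths[OF assms(1)], of a b]
    by (simp add: vert_def tgt_Path)
qed

lemma capb_nonzero:
  assumes "x \<in> paths Q" "y \<in> paths Q" "capb (a, x) (y, b) \<noteq> 0"
  shows "take (len y) (arrows x) = arrows y" "tgt Q y = tgt Q x"
    "arrows y \<noteq> [] \<Longrightarrow> arrows x \<noteq> [] \<and> hd (arrows y) = hd (arrows x)"
proof -
  show t: "take (len y) (arrows x) = arrows y" and "tgt Q y = tgt Q x"
    using assms(3) unfolding capb_eq[OF assms(1,2)] by (auto split: if_splits)
  show "arrows x \<noteq> [] \<and> hd (arrows y) = hd (arrows x)" if "arrows y \<noteq> []"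
    using t that by (metis hd_take length_greater_0_conv take_Nil)
qed

lemma capb_vert_second:
  assumes v: "v \<in> hom_pairs Q I" "arrows (snd v) = []" and u: "u \<in> coh_pairs Q I" "arrows (fst u) \<noteq> []"
  shows "capb v u = 0"
proof -
  obtain a x y b where vu: "v = (a, x)" "u = (y, b)" by force
  have "x \<in> paths Q" "y \<in> paths Q" using v u by (auto simp: vu hom_pairs_iff coh_pairs_iff)
  then show ?thesis using capb_nonzero(3)[of x y a b] v(2) u(2) unfolding vu by auto
qed

lemma path_append_zero:
  assumes "Path s (xs @ ys) \<in> paths Q" "xs \<noteq> []" "ys \<noteq> []" "gstep (last xs) (hd ys)"
  shows "hb (Path s (xs @ ys)) z = 0"
  using assms bstep_not_gstep[of "last xs" "hd ys"] by (auto simp: hom_bas_eq successively_append_iff)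

lemma hb_bas: "Path s xs \<in> paths Q \<Longrightarrow> successively bstep xs \<Longrightarrow> hb (Path s xs) z = bas (Path s xs, z)"
  by (simp add: hom_bas_eq)

lemma hd_butlast: "butlast w \<noteq> [] \<Longrightarrow> hd (butlast w) = hd w"
  by (cases w) (auto split: if_splits)

lemma cyclic_bstep:
  assumes "cyclic bstep w"
  shows "successively bstep w" "bstep (last w) (hd w)" "cyclic comp w"
  using assms cyclic_comp(2) by (auto simp: cyclic_def)

lemma cyclic_gstep:
  assumes "cyclic gstep w"
  shows "successively gstep w" "gstep (last w) (hd w)" "cyclic comp w"
  using assms cyclic_comp(1) by (auto simp: cyclic_def)

lemma vert_simps [simp]: "src (vert e) = e" "tgt Q (vert e) = e" "arrows (vert e) = []"
  by (simp_all add: vert_def tgt_def)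

lemma vert_mk: "vert e \<cdot> mk w = mk w"
  by (simp add: vert_def mk_def pcomp_def)

lemma Path_mk: "Path s xs \<cdot> mk w = Path (tail Q (last w)) (xs @ w)"
  by (simp add: mk_def pcomp_def)

lemma mk_mk: "w \<noteq> [] \<Longrightarrow> mk xs \<cdot> mk w = mk (xs @ w)"
  by (simp add: mk_def pcomp_def)

text \<open>A left component \<open>a\<close> of positive length meets \<open>w\<close> in a
  relation, by \<open>left\<close>. If \<open>a\<close> is a vertex, the product pairs
  \<open>w\<close> with \<open>x\<close>, and \<open>bdry_kill\<close> moves the first arrow
  \<open>last w\<close> of the path: \<open>right\<close> lets it join \<open>x\<close> within
  \<Gamma>, and \<open>left\<close> makes the opposite summand vanish.\<close>

lemma capb_B_maximal:
  assumes w: "cyclic comp w" "successively bstep w" "butlast w \<noteq> []"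
    and right: "\<And>c. comp (last w) c \<Longrightarrow> gstep (last w) c"
    and left: "\<And>c. comp c (hd w) \<Longrightarrow> gstep c (hd w)"
    and v: "v \<in> hom_pairs Q I"
  shows "bdry (capb v (UB w))"
proof -
  obtain a x where ax: "v = (a, x)" by force
  note f = cyclic_comp_facts[OF w(1)]
  have p: "a \<in> paths Q" "x \<in> paths Q" "successively gstep (arrows x)" "src a = tgt Q x" "tgt Q a = src x"
    using v by (auto simp: ax hom_pairs_iff)
  have eq: "capb v (UB w) = (if tail Q (last w) = tgt Q x then hb (a \<cdot> mk w) x else 0)"
    unfolding UB_def ax by (rule capb_vert[OF f(7) p(2)])
  show ?thesis
  proof (cases "tail Q (last w) = tgt Q x")
    case t: True
    obtain s as where a: "a = Path s as" by (cases a)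
    have aw: "a \<cdot> mk w = Path (tail Q (last w)) (as @ w)" by (simp add: a Path_mk)
    have awp: "a \<cdot> mk w \<in> paths Q"
      by (rule comp_in_paths[OF p(1) f(8)]) (use p(4) t f(1,4) in simp)
    show ?thesis
    proof (cases "as = []")
      case False
      then have "comp (last as) (hd w)"
        using p(1,4) t f(4,5) by (auto simp: a comp_def paths_nonempty_iff)
      then have "hb (a \<cdot> mk w) x = 0"
        unfolding aw using awp[unfolded aw] False f(1) left by (intro path_append_zero) auto
      then show ?thesis using eq by simp
    next
      case True
      obtain t ys where x: "x = Path t ys" by (cases x)
      have s: "s = tail Q (last w)" "t = tail Q (last w)"
        using p(4,5) t True by (auto simp: a x tgt_Path)
      have wl: "butlast w @ [last w] = w" using f(1) by simp
      have mw: "mk w = Path (tail Q (last w)) (butlast w @ [last w])" by (simp add: mk_def wl)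
      have pair: "(Path (tail Q (last w)) (butlast w @ [last w]), Path t ys) \<in> hom_pairs Q I"
      proof -
        have "tgt Q (mk w) = src x" using f(1,4) s(2) by (simp add: x)
        then have "(mk w, x) \<in> hom_pairs Q I"
          unfolding hom_pairs_iff using p(2,3) f(8) w(2) t by simp
        then show ?thesis unfolding mw x .
      qed
      have yst: "ys \<noteq> [] \<Longrightarrow> tail Q (last w) = head Q (hd ys)" "ys \<noteq> [] \<Longrightarrow> tail Q (last ys) = tail Q (last w)"
        "ys \<noteq> [] \<Longrightarrow> hd ys \<in> arcs Q \<and> last ys \<in> arcs Q"
      proof -
        assume ne: "ys \<noteq> []"
        have "tail Q (last ys) = t" and "hd ys \<in> arcs Q \<and> last ys \<in> arcs Q"
          using p(2) ne unfolding x paths_nonempty_iff[OF ne] by auto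
        then show "tail Q (last ys) = tail Q (last w)" "hd ys \<in> arcs Q \<and> last ys \<in> arcs Q"
          using s(2) by simp_all
        show "tail Q (last w) = head Q (hd ys)" using t ne unfolding x tgt_Path by simp
      qed
      have "bdry (bas (Path (tail Q (last w)) (butlast w @ [last w]), Path t ys))"
      proof (rule bdry_kill[OF pair])
        show "gstep (last w) (hd ys)" if "ys \<noteq> []"
          using that yst f(6) by (intro right) (simp add: comp_def)
        show "butlast w \<noteq> []" by (rule w(3))
        show "gstep (last (last w # ys)) (hd (butlast w))"
          unfolding hd_butlast[OF w(3)] using yst f(4,5,6) by (intro left) (auto simp: comp_def)
      qed
      then have "bdry (bas (mk w, x))" unfolding mw x .
      moreover have "hb (a \<cdot> mk w) x = bas (mk w, x)"
      proof -
        have "a \<cdot> mk w = mk w" unfolding aw using True by (simp add: mk_def)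
        then show ?thesis using f(8) w(2) by (simp add: hom_bas_eq)
      qed
      ultimately show ?thesis using eq t by simp
    qed
  qed (simp add: eq)
qed

lemma scale_of_nat_card: "finite A \<Longrightarrow> (\<Sum>i\<in>A. x) = scale (of_nat (card A)) x"
  by (induction A rule: finite_induct) (simp_all add: scale_left_add add.commute)

lemma cap_UB_vert:
  assumes ds: "cyclic bstep ds" and e: "e \<in> verts Q"
  shows "bdry (cap_chain Q I (bas (vert e, vert e)) (\<Sum>j<length ds. bas (UB (rotate j ds))) -
    scale (of_nat (passes Q (mk ds) e)) (bas (VB0 ds)))"
proof -
  let ?r = "length ds"
  let ?F = "\<lambda>w. if tail Q (last w) = e then bas (VB0 w) else (0 :: _ \<Rightarrow>\<^sub>0 'k)"
  have c: "cyclic bstep (rotate j ds)" for j by (rule cyclic_rotate[OF ds])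
  have ne: "ds \<noteq> []" using ds by (simp add: cyclic_def)
  have l1: "lpow ds 1 = ds" by simp
  have capb: "capb (vert e, vert e) (UB w) = ?F w" if w: "cyclic bstep w" for w
    using cyclic_comp_facts(7,8)[OF cyclic_bstep(3)[OF w]] cyclic_bstep(1)[OF w] vert_in_paths[OF e]
    by (auto simp: UB_def VB0_def capb_vert vert_mk hom_bas_eq)
  have "cap_chain Q I (bas (vert e, vert e)) (\<Sum>j<?r. bas (UB (rotate j ds))) =
      (\<Sum>j<?r. ?F (rotate j (lpow ds 1)))"
    unfolding cap_chain_linear l1 by (simp only: capb[OF c])
  \<comment> \<open>After this shift the base vertex of the \<open>j\<close>-th term is the tail of
    \<open>ds ! j\<close>, as in the count \<open>passes\<close>.\<close>
  also have "\<dots> = (\<Sum>j<?r. ?F (rotate (Suc j) (lpow ds 1)))"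
    by (rule sum_rotate_shift[symmetric])
  also have "\<dots> = (\<Sum>j<?r. if tail Q (ds ! j) = e then bas (VB0 (rotate (Suc j) ds)) else 0)"
  proof (rule sum.cong[OF refl])
    fix j assume "j \<in> {..<?r}"
    then have "last (rotate (Suc j) ds) = ds ! j"
      using ne last_rotate_Suc[OF ne, of j] hd_rotate[OF ne, of j] by simp
    then show "?F (rotate (Suc j) (lpow ds 1)) =
        (if tail Q (ds ! j) = e then bas (VB0 (rotate (Suc j) ds)) else 0)" by (simp only: l1)
  qed
  finally have L: "cap_chain Q I (bas (vert e, vert e)) (\<Sum>j<?r. bas (UB (rotate j ds))) =
      (\<Sum>j<?r. if tail Q (ds ! j) = e then bas (VB0 (rotate (Suc j) ds)) else 0)" .
  have "scale (of_nat (passes Q (mk ds) e)) (bas (VB0 ds)) =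
      (\<Sum>j\<in>{i. i < ?r \<and> tail Q (ds ! i) = e}. bas (VB0 ds))"
    unfolding passes_def arrows_mk by (rule scale_of_nat_card[symmetric]) simp
  also have "\<dots> = (\<Sum>j<?r. if tail Q (ds ! j) = e then bas (VB0 ds) else 0)"
    by (subst sum.inter_filter[symmetric]) (auto intro: sum.cong)
  finally have R: "scale (of_nat (passes Q (mk ds) e)) (bas (VB0 ds)) =
      (\<Sum>j<?r. if tail Q (ds ! j) = e then bas (VB0 ds) else (0 :: _ \<Rightarrow>\<^sub>0 'k))" .
  show ?thesis
    unfolding L R sum_subtractf[symmetric]
  proof (rule bdry_sum)
    fix j
    show "bdry ((if tail Q (ds ! j) = e then bas (VB0 (rotate (Suc j) ds)) else 0) -
        (if tail Q (ds ! j) = e then bas (VB0 ds) else 0))"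
      using bdry_VB0_rotate[OF ds, of "Suc j"]
      by (cases "tail Q (ds ! j) = e") (simp_all only: simp_thms if_True if_False diff_self bdry_zero)
  qed
qed

text \<open>A common base vertex is not enough: the junction from \<open>last cs\<close> to
  \<open>hd w\<close> is a \<open>bstep\<close> only for \<open>hd w = hd cs\<close>.\<close>

lemma capb_VB0_UB:
  assumes cs: "cyclic bstep cs" and w: "cyclic bstep w"
  shows "capb (VB0 cs) (UB w) = (if hd w = hd cs then bas (mk (cs @ w), vert (tail Q (last cs))) else 0)"
proof -
  note f = cyclic_comp_facts[OF cyclic_bstep(3)[OF cs]] and g = cyclic_comp_facts[OF cyclic_bstep(3)[OF w]]
  have eq: "capb (VB0 cs) (UB w) = (if tail Q (last w) = tail Q (last cs)
      then hb (mk (cs @ w)) (vert (tail Q (last cs))) else 0)"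
    unfolding VB0_def UB_def using g(1,7) vert_in_paths[OF f(7)]
    by (simp add: capb_vert mk_mk)
  show ?thesis
  proof (cases "tail Q (last w) = tail Q (last cs)")
    case True
    have p: "mk (cs @ w) \<in> paths Q"
      unfolding mk_mk[OF g(1), symmetric] by (rule comp_in_paths[OF f(8) g(8)]) (use g True in simp)
    have "comp (last cs) (hd w)" using True f g by (simp add: comp_def)
    then have "bstep (last cs) (hd w) \<longleftrightarrow> hd w = hd cs"
      using gstep_bstep_det(3)[OF cyclic_bstep(2)[OF cs]] cyclic_bstep(2)[OF cs] by metis
    then show ?thesis
      using eq True p cyclic_bstep(1)[OF cs] cyclic_bstep(1)[OF w] f(1) g(1)
      by (auto simp: hom_bas_eq successively_append_iff)
  next
    case False
    have "tail Q (last w) = tail Q (last cs)" if "hd w = hd cs" using f(4) g(4) that by simp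
    then show ?thesis using eq False by auto
  qed
qed

lemma capb_VB1_UB:
  assumes v: "cyclic bstep v" and w: "cyclic bstep w"
  shows "capb (VB1 v) (UB w) = (if tail Q (last w) = head Q (hd v)
      then hb (Path (tail Q (last w)) (tl v @ w)) (arrow Q (hd v)) else 0)"
    "tail Q (last w) = head Q (hd v) \<Longrightarrow> Path (tail Q (last w)) (tl v @ w) \<in> paths Q"
proof -
  note f = cyclic_comp_facts[OF cyclic_bstep(3)[OF v]] and g = cyclic_comp_facts[OF cyclic_bstep(3)[OF w]]
  show "capb (VB1 v) (UB w) = (if tail Q (last w) = head Q (hd v)
      then hb (Path (tail Q (last w)) (tl v @ w)) (arrow Q (hd v)) else 0)"
    unfolding VB1_def UB_def using g(7) arrow_in_paths[OF f(5)] by (simp add: capb_vert Path_mk)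
  have "Path (head Q (hd v)) (tl v) \<in> paths Q"
    using VB1_pair[OF v] by (simp add: VB1_def hom_pairs_iff)
  from comp_in_paths[OF this g(8)]
  show "tail Q (last w) = head Q (hd v) \<Longrightarrow> Path (tail Q (last w)) (tl v @ w) \<in> paths Q"
    using g(1,4) by (simp add: Path_mk)
qed

text \<open>The letter in front of \<open>w\<close> is \<open>last v\<close>, whose only
  \<open>bstep\<close> continuation is \<open>hd v\<close>. Nonempty \<open>tl v\<close> provides
  this junction; for a loop the left factor is a vertex and \<open>bdry_loop_UB\<close> takes
  over.\<close>

lemma capb_VB1_UB_hd:
  assumes v: "cyclic bstep v" and w: "cyclic bstep w" and tl: "tl v \<noteq> []"
  shows "capb (VB1 v) (UB w) = (if hd w = hd v
      then bas (Path (head Q (hd v)) (tl (v @ w)), arrow Q (hd v)) else 0)"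
proof -
  note f = cyclic_comp_facts[OF cyclic_bstep(3)[OF v]] and g = cyclic_comp_facts[OF cyclic_bstep(3)[OF w]]
  have l: "last (tl v) = last v" using tl by (simp add: last_tl)
  have s: "successively bstep (tl v)" using cyclic_bstep(1)[OF v] by (cases v) (auto simp: successively_Cons)
  show ?thesis
  proof (cases "tail Q (last w) = head Q (hd v)")
    case True
    have "comp (last v) (hd w)" using True f g by (simp add: comp_def)
    then have "bstep (last v) (hd w) \<longleftrightarrow> hd w = hd v"
      using gstep_bstep_det(3)[OF cyclic_bstep(2)[OF v]] cyclic_bstep(2)[OF v] by metis
    then show ?thesis
      using capb_VB1_UB[OF v w] True s cyclic_bstep(1)[OF w] tl l f(1) g(1)
      by (auto simp: hom_bas_eq successively_append_iff)
  next
    case False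
    have "tail Q (last w) = head Q (hd v)" if "hd w = hd v" using g(4) that by simp
    then show ?thesis using capb_VB1_UB[OF v w] False by auto
  qed
qed

text \<open>If the base vertices agree, \<open>last w\<close> is composable with
  \<open>hd v\<close>. A \<open>bstep\<close> there gives \<open>hd v = hd w\<close>, a
  \<open>gstep\<close> gives \<open>last w = last v\<close>; both equalities together would make one
  junction of both kinds, so the sum counts nothing twice.\<close>

lemma capb_VG_UB:
  assumes v: "cyclic gstep v" and w: "cyclic bstep w"
  shows "capb (VG v) (UB w) = (if last w = last v then bas (mk w, mk v) else 0) +
    (if hd w = hd v then bas (mk w, mk v) else 0)"
proof -
  note f = cyclic_comp_facts[OF cyclic_gstep(3)[OF v]] and g = cyclic_comp_facts[OF cyclic_bstep(3)[OF w]]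
  have eq: "capb (VG v) (UB w) = (if tail Q (last w) = head Q (hd v) then bas (mk w, mk v) else 0)"
    unfolding VG_def UB_def using f(1,8) g(7,8) cyclic_bstep(1)[OF w]
    by (simp add: capb_vert vert_mk hom_bas_eq)
  have b: "bstep (last w) (hd w)" and gs: "gstep (last v) (hd v)"
    using cyclic_bstep(2)[OF w] cyclic_gstep(2)[OF v] .
  have "\<not> (last w = last v \<and> hd w = hd v)" using b gs bstep_not_gstep by metis
  moreover have "tail Q (last w) = head Q (hd v)" if "last w = last v" using that f(4) by simp
  moreover have "tail Q (last w) = head Q (hd v)" if "hd w = hd v" using that g(4) by simp
  moreover have "last w = last v \<or> hd w = hd v" if "tail Q (last w) = head Q (hd v)"
  proof -
    have "comp (last w) (hd v)" using that f g by (simp add: comp_def)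
    then show ?thesis
      using bstep_or_gstep gstep_bstep_det(3)[OF b] gstep_bstep_det(2)[OF _ gs] by metis
  qed
  ultimately show ?thesis using eq by auto
qed

text \<open>In \<open>bdry_move\<close> for the rotated pair the common arrow leaves the first word
  and joins the second. The opposite end of the second word is \<open>hd v\<close>, the same arrow,
  and it returns to the front of \<open>tl w\<close>, which restores the unrotated pair.\<close>

lemma bdry_rotate_pair:
  assumes v: "cyclic gstep v" and w: "cyclic bstep w" and hd: "hd w = hd v"
  shows "bdry (bas (mk (rotate1 w), mk (rotate1 v)) + scale ((-1) ^ Suc (length v)) (bas (mk w, mk v)))"
proof -
  note f = cyclic_comp_facts[OF cyclic_gstep(3)[OF v]] and g = cyclic_comp_facts[OF cyclic_bstep(3)[OF w]]
  have v': "cyclic gstep (rotate1 v)" and w': "cyclic bstep (rotate1 w)"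
    using v w by (simp_all add: cyclic_rotate1)
  note f' = cyclic_comp_facts[OF cyclic_gstep(3)[OF v']] and g' = cyclic_comp_facts[OF cyclic_bstep(3)[OF w']]
  have rw: "rotate1 w = tl w @ [hd w]" "rotate1 v = tl v @ [hd v]"
    using f(1) g(1) by (simp_all add: rotate1_conv)
  have lasts: "last (rotate1 v) = hd v" "last (rotate1 w) = hd w" using rw by simp_all
  have mks: "mk (rotate1 w) = Path (tail Q (hd w)) (tl w @ [hd w])"
    "mk (rotate1 v) = Path (tail Q (hd v)) (rotate1 v)"
    "mk w = Path (head Q (hd w)) (hd w # tl w)" "mk v = Path (head Q (hd v)) (hd v # tl v)"
    using f g lasts by (simp_all add: mk_def rw)
  have pair: "(mk (rotate1 w), mk (rotate1 v)) \<in> hom_pairs Q I"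
    using f' g' lasts cyclic_bstep(1)[OF w'] cyclic_gstep(1)[OF v'] hd
    by (simp add: hom_pairs_iff del: rotate1_is_Nil_conv)
  have "gstep (hd w) (hd (rotate1 v))"
    using cyclic_gstep(2)[OF v'] lasts hd by simp
  from bdry_move[OF pair[unfolded mks(1,2)] this]
  have "bdry (bas (mk (rotate1 w), mk (rotate1 v)) + scale ((-1) ^ Suc (length (rotate1 v)))
      (hb (Path (head Q (hd w)) (last (hd w # rotate1 v) # tl w))
        (Path (head Q (last (hd w # rotate1 v))) (butlast (hd w # rotate1 v)))))"
    unfolding mks(1,2) .
  moreover have "last (hd w # rotate1 v) = hd w" using lasts f'(1) hd by simp
  moreover have "butlast (hd w # rotate1 v) = hd v # tl v" using hd rw by simp
  moreover have "hb (mk w) (mk v) = bas (mk w, mk v)"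
    using g(8) cyclic_bstep(1)[OF w] by (simp add: hom_bas_eq)
  ultimately show ?thesis using mks(3,4) hd by simp
qed

text \<open>
  A summand is nonzero if the two cycles either enter or leave their common vertex by the same
  arrow. A summand of the second kind and the summand of the first kind that arises by moving along
  this arrow add up to a boundary.
\<close>

lemma cap_VG_UB:
  assumes es: "cyclic gstep es" and k: "1 \<le> k" and ds: "cyclic bstep ds"
    and sgn: "(-1 :: 'k) ^ ((length (lpow es k) + 1) * length es) = 1"
  shows "bdry (cap_chain Q I (\<Sum>i<length es. scale ((-1) ^ ((length (lpow es k) + 1) * i))
    (bas (VG (rotate i (lpow es k))))) (\<Sum>j<length ds. bas (UB (rotate j ds))))"
proof -
  let ?m = "length (lpow es k)"
  let ?s = "\<lambda>i. (-1 :: 'k) ^ ((?m + 1) * i)"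
  let ?v = "\<lambda>i. rotate i (lpow es k)" and ?w = "\<lambda>j. rotate j ds"
  let ?P = "\<lambda>v w. bas (mk w, mk v) :: _ \<Rightarrow>\<^sub>0 'k"
  let ?A = "\<lambda>v w. if last w = last v then ?P v w else 0"
  let ?B = "\<lambda>v w. if hd w = hd v then ?P v w else 0"
  have cv: "cyclic gstep (?v i)" for i by (intro cyclic_rotate cyclic_lpow es k)
  have cw: "cyclic bstep (?w j)" for j by (rule cyclic_rotate[OF ds])
  have ne: "?v i \<noteq> []" "?w j \<noteq> []" for i j
    using cv[of i] cw[of j] unfolding cyclic_def by blast+
  have per: "?v (length es) = ?v 0" "?w (length ds) = ?w 0" by (simp_all add: rotate_lpow)
  \<comment> \<open>Shifting both indices turns equality of last letters into equality of first
    letters, so that both kinds of summands are indexed by the same pairs (i, j).\<close>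
  have "(\<Sum>i<length es. \<Sum>j<length ds. scale (?s i) (?A (?v i) (?w j))) =
      (\<Sum>i<length es. \<Sum>j<length ds. scale (?s (Suc i)) (?A (?v (Suc i)) (?w j)))"
    by (rule sum_shift[symmetric]) (simp only: per sgn, simp)
  also have "\<dots> = (\<Sum>i<length es. \<Sum>j<length ds. scale (?s (Suc i)) (?A (?v (Suc i)) (?w (Suc j))))"
    by (intro sum.cong refl sum_shift[symmetric]) (simp only: per)
  also have "\<dots> = (\<Sum>i<length es. \<Sum>j<length ds.
      scale (?s (Suc i)) (if hd (?w j) = hd (?v i) then ?P (?v (Suc i)) (?w (Suc j)) else 0))"
    using last_rotate1[OF ne(1)] last_rotate1[OF ne(2)] by (simp only: rotate_eq_rotate1)
  finally have A: "(\<Sum>i<length es. \<Sum>j<length ds. scale (?s i) (?A (?v i) (?w j))) = \<dots>" .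
  have "cap_chain Q I (\<Sum>i<length es. scale (?s i) (bas (VG (?v i)))) (\<Sum>j<length ds. bas (UB (?w j))) =
      (\<Sum>i<length es. \<Sum>j<length ds. scale (?s i) (?A (?v i) (?w j))) +
      (\<Sum>i<length es. \<Sum>j<length ds. scale (?s i) (?B (?v i) (?w j)))"
    unfolding cap_chain_linear scale_sum capb_VG_UB[OF cv cw] scale_add sum.distrib
    by (intro arg_cong2[of _ _ _ _ "(+)"] sum.swap)
  also have "\<dots> = (\<Sum>i<length es. \<Sum>j<length ds. if hd (?w j) = hd (?v i)
      then scale (?s (Suc i)) (?P (?v (Suc i)) (?w (Suc j))) + scale (?s i) (?P (?v i) (?w j)) else 0)"
    unfolding A sum.distrib[symmetric] by (intro sum.cong refl) simp
  also have "bdry \<dots>"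
  proof (intro bdry_sum)
    fix i j
    have "bdry (scale (?s (Suc i)) (?P (?v (Suc i)) (?w (Suc j))) + scale (?s i) (?P (?v i) (?w j)))"
      if "hd (?w j) = hd (?v i)"
    proof -
      have "?s (Suc i) * (-1) ^ Suc ?m = ?s i"
        using sign_step[of ?m i] by (simp only: power_Suc mult_minus_left mult_1_left mult_minus_right minus_minus)
      then show ?thesis
        using bdry_scale[OF bdry_rotate_pair[OF cv cw that], of "?s (Suc i)"]
        by (simp only: scale_add scale_scale length_rotate rotate_eq_rotate1)
    qed
    then show "bdry (if hd (?w j) = hd (?v i)
      then scale (?s (Suc i)) (?P (?v (Suc i)) (?w (Suc j))) + scale (?s i) (?P (?v i) (?w j)) else 0)"
      by simp
  qed
  finally show ?thesis .
qed

text \<open>The left component becomes \<open>hd v # w\<close>. If its first junction is no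
  relation, determinism gives \<open>hd v = last w\<close>; moving this arrow to \<open>tl v\<close>
  restores the cycle \<open>v\<close>, and the opposite summand begins with the relation from
  \<open>last v\<close> to \<open>hd v\<close>.\<close>

lemma capb_VG'_UB:
  assumes v: "cyclic gstep v" and w: "cyclic bstep w"
  shows "bdry (capb (VG' v) (UB w))"
proof -
  note f = cyclic_comp_facts[OF cyclic_gstep(3)[OF v]] and g = cyclic_comp_facts[OF cyclic_bstep(3)[OF w]]
  note t = tl_path[OF cyclic_gstep(3)[OF v]]
  let ?x = "Path (tail Q (last v)) (tl v)" and ?p = "Path (tail Q (last w)) (hd v # w)"
  have eq: "capb (VG' v) (UB w) = (if tail Q (last w) = tail Q (hd v) then hb ?p ?x else 0)"
    unfolding VG'_def UB_def using t g(7) by (simp add: capb_vert Path_mk arrow_def)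
  show ?thesis
  proof (cases "tail Q (last w) = tail Q (hd v)")
    case True
    have c: "comp (hd v) (hd w)" using True f g by (simp add: comp_def)
    have p: "?p \<in> paths Q"
      using g(1-3,8) f(5) c by (simp add: paths_nonempty_iff successively_Cons)
    show ?thesis
    proof (cases "bstep (hd v) (hd w)")
      case b: True
      then have hl: "hd v = last w" using gstep_bstep_det(4)[OF _ cyclic_bstep(2)[OF w]] by metis
      have pw: "?p = Path (tail Q (last w)) ((hd v # butlast w) @ [last w])" using g(1) by simp
      have s: "successively bstep (hd v # w)"
        using b cyclic_bstep(1)[OF w] by (simp add: successively_Cons)
      have gt: "successively gstep (tl v)" "tl v \<noteq> [] \<Longrightarrow> gstep (hd v) (hd (tl v))"
        using cyclic_gstep(1)[OF v] by (cases v; auto simp: successively_Cons)+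
      have "(?p, ?x) \<in> hom_pairs Q I"
        using p s t gt True f(4) by (simp add: hom_pairs_iff tgt_Path)
      then have "bdry (bas (?p, ?x))"
        unfolding pw
      proof (rule bdry_kill)
        show "gstep (last w) (hd (tl v))" if "tl v \<noteq> []" using gt(2)[OF that] hl by simp
        have "last (last w # tl v) = last v" using hl f(1) by (cases v) auto
        then show "gstep (last (last w # tl v)) (hd (hd v # butlast w))"
          using cyclic_gstep(2)[OF v] by simp
      qed simp
      then show ?thesis using eq True p s by (simp add: hb_bas)
    next
      case False
      then have "hb ?p ?x = 0" using p g(1) by (simp add: hom_bas_eq successively_Cons)
      then show ?thesis unfolding eq by (simp only: if_cancel bdry_zero)
    qed
  qed (simp add: eq)
qed

section \<open>Products with arrows and with \<Gamma>-maximal paths\<close>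

lemma capb_VB1_arrow:
  assumes v: "cyclic bstep v" and c: "c \<in> arcs Q"
  shows "capb (VB1 v) (arrow Q c, arrow Q c) = (if hd v = c then bas (VB0 (rotate1 v)) else 0)"
proof -
  note f = cyclic_comp_facts[OF cyclic_bstep(3)[OF v]]
  have r: "cyclic bstep (rotate1 v)" using v by (rule cyclic_rotate1)
  have rv: "rotate1 v = tl v @ [hd v]" using f(1) by (rule rotate1_conv)
  have "hb (Path (tail Q (hd v)) (tl v @ [hd v])) z = bas (mk (rotate1 v), z)" for z
    using cyclic_comp_facts(8)[OF cyclic_bstep(3)[OF r]] cyclic_bstep(1)[OF r]
    by (simp add: hom_bas_eq mk_def rv)
  then show ?thesis
    using arrow_in_paths[OF c] arrow_in_paths[OF f(5)]
    by (auto simp: VB1_def capb_eq VB0_def rv pcomp_def vert_def)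
qed

lemma capb_VG_arrow:
  assumes v: "cyclic gstep v" and c: "c \<in> arcs Q"
  shows "capb (VG v) (arrow Q c, arrow Q c) =
    (if hd v = c then scale ((-1) ^ (length v + 1)) (bas (VG' v)) else 0)"
proof -
  note f = cyclic_comp_facts[OF cyclic_gstep(3)[OF v]]
  have "hb (arrow Q c) z = bas (arrow Q c, z)" for z
    using arrow_in_paths[OF c] by (simp add: hom_bas_eq)
  moreover have "take 1 v = [c] \<longleftrightarrow> hd v = c" using f(1) by (cases v) auto
  ultimately show ?thesis
    using arrow_in_paths[OF c] f(1,8)
    by (auto simp: VG_def capb_eq VG'_def vert_arrow drop_Suc)
qed

text \<open>Only the second letter of \<open>v\<close> can be split off, and it forms a relation
  with \<open>hd v\<close>, the left component.\<close>

lemma capb_VG'_arrow: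
  assumes v: "cyclic gstep v" and c: "c \<in> arcs Q"
  shows "capb (VG' v) (arrow Q c, arrow Q c) = 0"
proof (rule ccontr)
  note f = cyclic_comp_facts[OF cyclic_gstep(3)[OF v]]
  note t = tl_path[OF cyclic_gstep(3)[OF v]]
  assume nz: "\<not> ?thesis"
  note cn = capb_nonzero[OF t(1) arrow_in_paths[OF c] nz[unfolded VG'_def]]
  have h: "tl v \<noteq> []" "hd (tl v) = c" using cn(3) by auto
  have gs: "gstep (hd v) c" using cyclic_gstep(1)[OF v] h by (cases v; cases "tl v") auto
  have "arrow Q (hd v) \<cdot> arrow Q c = Path (tail Q c) ([hd v] @ [c])" by (simp add: arrow_def pcomp_def)
  moreover have "Path (tail Q c) ([hd v] @ [c]) \<in> paths Q"
    using gstep_comp[OF gs] by (simp add: paths_iff comp_def)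
  then have "hb (Path (tail Q c) ([hd v] @ [c])) z = 0" for z
    by (rule path_append_zero) (use gs in simp_all)
  ultimately show False
    using nz capb_eq[OF t(1) arrow_in_paths[OF c]] by (simp add: VG'_def split: if_splits)
qed

text \<open>A nonzero product needs \<open>y\<close> at the left end of \<open>x\<close>; since
  nothing continues \<open>y\<close> in \<Gamma>, nothing remains of \<open>x\<close>.\<close>

lemma capb_Gam_maximal:
  assumes v: "(a, x) \<in> hom_pairs Q I" and u: "(y, b) \<in> coh_pairs Q I" and ne: "arrows y \<noteq> []"
    and right: "\<And>c. \<not> gstep (last (arrows y)) c"
    and nz: "capb (a, x) (y, b) \<noteq> 0"
  shows "arrows x = arrows y"
proof -
  have p: "x \<in> paths Q" "y \<in> paths Q" "successively gstep (arrows x)"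
    using u v by (auto simp: hom_pairs_iff coh_pairs_iff)
  obtain zs where zs: "arrows x = arrows y @ zs"
    using capb_nonzero(1)[OF p(1,2) nz] by (metis append_take_drop_id)
  show ?thesis
  proof (cases "zs = []")
    case False
    then have "gstep (last (arrows y)) (hd zs)"
      using p(3) ne by (simp add: zs successively_append_iff)
    then show ?thesis using right by simp
  qed (simp add: zs)
qed

text \<open>The right component would be \<open>y\<close> itself. But the first letter of
  \<open>v\<close> or of \<open>tl v\<close> has a \<open>gstep\<close> leading to it, from
  \<open>last v\<close> or from \<open>hd v\<close>, against \<open>left\<close>.\<close>

lemma capb_Gam_maximal_VG:
  assumes v: "cyclic gstep v" and u: "(y, b) \<in> coh_pairs Q I" and ne: "arrows y \<noteq> []"
    and right: "\<And>c. \<not> gstep (last (arrows y)) c" and left: "\<And>c. \<not> gstep c (hd (arrows y))"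
  shows "capb (VG v) (y, b) = 0" "capb (VG' v) (y, b) = 0"
proof -
  show "capb (VG v) (y, b) = 0"
  proof (rule ccontr)
    assume "capb (VG v) (y, b) \<noteq> 0"
    then have "v = arrows y"
      using capb_Gam_maximal[OF VG_pair[OF v, unfolded VG_def] u ne right] by (simp add: VG_def)
    then show False using left[of "last v"] cyclic_gstep(2)[OF v] by simp
  qed
  show "capb (VG' v) (y, b) = 0"
  proof (rule ccontr)
    assume "capb (VG' v) (y, b) \<noteq> 0"
    then have y: "tl v = arrows y"
      using capb_Gam_maximal[OF VG'_pair[OF v, unfolded VG'_def] u ne right] by (simp add: VG'_def)
    then have "gstep (hd v) (hd (tl v))"
      using cyclic_gstep(1)[OF v] ne by (cases v; cases "tl v") auto
    then show False using left y by simp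
  qed
qed

end

section \<open>Products on the chosen representatives\<close>

context based_quiver
begin

lemma brep_facts:
  assumes "ds \<in> brep S"
  shows "cyclic S ds" "distinct ds" "ds \<noteq> []" "length ds > 0"
  using assms by (auto simp: brep_def cyclic_def)

lemma hd_rotate_in: "ds \<noteq> [] \<Longrightarrow> hd (rotate j ds) \<in> set ds"
  by (metis hd_in_set rotate_is_Nil_conv set_rotate)

text \<open>Different representatives of one kind have no arrow in common, and within one of them an
  arrow determines the rotation.\<close>

lemma brep_sum_pick:
  fixes F :: "'a list \<Rightarrow> 'b::comm_monoid_add"
  assumes S: "stepping S" and ds: "ds \<in> brep S" and es: "es \<in> brep S"
    and F: "\<And>j. F (rotate j ds) \<noteq> 0 \<Longrightarrow> hd (rotate j ds) = hd (rotate i es)"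
  shows "(\<Sum>j<length ds. F (rotate j ds)) = (if ds = es then F (rotate i es) else 0)"
proof (cases "ds = es")
  case True
  have "(\<Sum>j<length ds. F (rotate j ds)) = F (rotate i ds)"
    by (rule sum_rotate_pick) (use brep_facts[OF ds] F True in auto)
  then show ?thesis using True by simp
next
  case False
  have "F (rotate j ds) = 0" for j
    using F brep_share[OF S ds es] False hd_rotate_in brep_facts(3)[OF ds] brep_facts(3)[OF es]
    by metis
  then show ?thesis using False by simp
qed

lemma brep_index_pick:
  fixes X :: "nat \<Rightarrow> 'b::comm_monoid_add"
  assumes es: "es \<in> brep S"
  shows "c \<notin> set es \<Longrightarrow> (\<Sum>i<length es. if hd (rotate i es) = c then X i else 0) = 0"
    "i < length es \<Longrightarrow> hd (rotate i es) = c \<Longrightarrow>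
      (\<Sum>i<length es. if hd (rotate i es) = c then X i else 0) = X i"
proof -
  show "(\<Sum>i<length es. if hd (rotate i es) = c then X i else 0) = 0" if "c \<notin> set es"
    using hd_rotate_in[OF brep_facts(3)[OF es]] that by (intro sum.neutral) auto
  assume i: "i < length es" "hd (rotate i es) = c"
  have inj: "j = i" if "j < length es" "hd (rotate j es) = c" for j
  proof -
    have "es ! j = es ! i" using that i brep_facts(3)[OF es] by (simp add: hd_rotate)
    then show ?thesis using that(1) i(1) brep_facts(2)[OF es] by (simp add: nth_eq_iff_index_eq)
  qed
  have "(\<Sum>j<length es. if hd (rotate j es) = c then X j else 0) =
      (\<Sum>j<length es. if j = i then X j else 0)"
  proof (rule sum.cong[OF refl])
    fix j assume "j \<in> {..<length es}"
    then have "hd (rotate j es) = c \<longleftrightarrow> j = i" using inj i(2) by blast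
    then show "(if hd (rotate j es) = c then X j else 0) = (if j = i then X j else 0)"
      by (simp only:)
  qed
  also have "\<dots> = X i" using i(1) by simp
  finally show "(\<Sum>i<length es. if hd (rotate i es) = c then X i else 0) = X i" .
qed

lemma cap_VB0_UB:
  assumes es: "es \<in> brep bstep" and k: "1 \<le> k" and ds: "ds \<in> brep bstep"
  shows "cap_chain Q I (bas (VB0 (lpow es k))) (\<Sum>j<length ds. bas (UB (rotate j ds))) =
    (if ds = es then bas (VB0 (lpow es (k + 1))) else 0)"
proof -
  let ?F = "\<lambda>w. if hd w = hd (lpow es k) then bas (mk (lpow es k @ w), vert (tail Q (last (lpow es k))))
      else (0 :: _ \<Rightarrow>\<^sub>0 'k)"
  have c: "cyclic bstep (lpow es k)" by (intro cyclic_lpow brep_facts(1) es k)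
  have d: "cyclic bstep (rotate j ds)" for j by (intro cyclic_rotate brep_facts(1) ds)
  have "cap_chain Q I (bas (VB0 (lpow es k))) (\<Sum>j<length ds. bas (UB (rotate j ds))) =
      (\<Sum>j<length ds. ?F (rotate j ds))"
    unfolding cap_chain_linear by (simp only: capb_VB0_UB[OF c d])
  also have "\<dots> = (if ds = es then ?F (rotate 0 es) else 0)"
    by (rule brep_sum_pick[OF stepping(2) ds es]) (use k in \<open>simp split: if_splits\<close>)
  also have "?F (rotate 0 es) = bas (VB0 (lpow es (k + 1)))"
    using k brep_facts(3)[OF es] by (simp add: VB0_def lpow_commute)
  finally show ?thesis .
qed

text \<open>Neither end of the other cycle is \<open>l\<close>, so both junctions with
  \<open>l\<close> are relations, the \<open>bstep\<close> neighbour of \<open>l\<close> being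
  \<open>l\<close> itself. Then \<open>bdry_kill\<close> applies, unless the other cycle is a loop
  too, which \<open>no_two_loops\<close> excludes.\<close>

lemma bdry_loop_UB:
  assumes l: "[l] \<in> brep bstep" and ds: "ds \<in> brep bstep" "ds \<noteq> [l]"
  shows "bdry (capb (VB1 [l]) (UB (rotate j ds)))"
proof -
  let ?w = "rotate j ds"
  have w: "cyclic bstep ?w" by (intro cyclic_rotate brep_facts(1) ds)
  have v: "cyclic bstep [l]" by (rule brep_facts(1)[OF l])
  note g = cyclic_comp_facts[OF cyclic_bstep(3)[OF w]] and f = cyclic_comp_facts[OF cyclic_bstep(3)[OF v]]
  have ll: "bstep l l" using cyclic_bstep(2)[OF v] by simp
  have nl: "x \<noteq> l" if "x \<in> set ?w" for x
    using brep_share[OF stepping(2) ds(1) l] that ds(2) by auto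
  show ?thesis
  proof (cases "tail Q (last ?w) = head Q l")
    case True
    have p: "mk ?w = Path (tail Q (last ?w)) (butlast ?w @ [last ?w])" using g(1) by (simp add: mk_def)
    have comps: "comp (last ?w) l" "comp l (hd ?w)"
      using True f g by (auto simp: comp_def)
    have "bstep (last ?w) l \<Longrightarrow> last ?w = l" "bstep l (hd ?w) \<Longrightarrow> hd ?w = l"
      using gstep_bstep_det(4)[OF _ ll] gstep_bstep_det(3)[OF _ ll] by blast+
    then have gs: "gstep (last ?w) l" "gstep l (hd ?w)"
      using bstep_or_gstep[OF comps(1)] bstep_or_gstep[OF comps(2)]
        nl[OF last_in_set[OF g(1)]] nl[OF hd_in_set[OF g(1)]] by blast+
    have ne: "butlast ?w \<noteq> []"
    proof
      assume "butlast ?w = []"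
      then have w1: "?w = [last ?w]" using append_butlast_last_id[OF g(1)] by simp
      then have h: "hd ?w = last ?w" by (metis list.sel(1))
      have "comp (last ?w) (last ?w)" using bstep_comp[OF cyclic_bstep(2)[OF w]] h by simp
      from no_two_loops[OF this bstep_comp[OF ll] comps(1)] show False
        using nl[OF last_in_set[OF g(1)]] by simp
    qed
    have "tgt Q (mk ?w) = src (arrow Q l)" using g(1,4) True f(4) by simp
    then have "(mk ?w, arrow Q l) \<in> hom_pairs Q I"
      unfolding hom_pairs_iff using g(8) cyclic_bstep(1)[OF w] arrow_in_paths[of l] f(5) True by simp
    then have "bdry (bas (mk ?w, arrow Q l))"
      unfolding p arrow_def
      by (rule bdry_kill) (use ne gs hd_butlast[OF ne] in simp_all)
    moreover have "hb (mk ?w) (arrow Q l) = bas (mk ?w, arrow Q l)"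
      using g(8) cyclic_bstep(1)[OF w] by (simp add: hom_bas_eq)
    ultimately have "bdry (hb (mk ?w) (arrow Q l))" by simp
    then show ?thesis
      unfolding capb_VB1_UB(1)[OF v w] mk_def list.sel append_Nil if_P[OF True] .
  next
    case False
    then show ?thesis unfolding capb_VB1_UB(1)[OF v w] by simp
  qed
qed

lemma cap_VB1_UB:
  assumes es: "es \<in> brep bstep" and k: "1 \<le> k" and ds: "ds \<in> brep bstep"
  shows "bdry (cap_chain Q I (\<Sum>i<length es. bas (VB1 (rotate i (lpow es k))))
      (\<Sum>j<length ds. bas (UB (rotate j ds))) -
    (if ds = es then (\<Sum>i<length es. bas (VB1 (rotate i (lpow es (k + 1))))) else 0))"
proof -
  let ?v = "\<lambda>i. rotate i (lpow es k)"
  have c: "cyclic bstep (?v i)" for i by (intro cyclic_rotate cyclic_lpow brep_facts(1) es k)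
  have d: "cyclic bstep (rotate j ds)" for j by (intro cyclic_rotate brep_facts(1) ds)
  have hdv: "hd (?v i) = hd (rotate i es)" for i using k by (simp add: rotate_lpow)
  have target: "bas (Path (head Q (hd (?v i))) (tl (?v i @ rotate i es)), arrow Q (hd (?v i))) =
      bas (VB1 (rotate i (lpow es (k + 1))))" for i
  proof -
    have "?v i @ rotate i es = rotate i (lpow es (k + 1))"
      unfolding rotate_lpow by (simp add: lpow_commute)
    moreover have "hd (?v i) = hd (rotate i (lpow es (k + 1)))"
      unfolding rotate_lpow by (simp only: hd_lpow[OF k] hd_lpow[OF le_add2])
    ultimately show ?thesis unfolding VB1_def by simp
  qed
  have "bdry ((\<Sum>j<length ds. capb (VB1 (?v i)) (UB (rotate j ds))) -
      (if ds = es then bas (VB1 (rotate i (lpow es (k + 1)))) else 0))" for i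
  proof (cases "tl (?v i) = []")
    case False
    let ?F = "\<lambda>w. if hd w = hd (?v i) then bas (Path (head Q (hd (?v i))) (tl (?v i @ w)), arrow Q (hd (?v i)))
      else (0 :: _ \<Rightarrow>\<^sub>0 'k)"
    have "(\<Sum>j<length ds. capb (VB1 (?v i)) (UB (rotate j ds))) = (\<Sum>j<length ds. ?F (rotate j ds))"
      by (simp only: capb_VB1_UB_hd[OF c d False])
    also have "\<dots> = (if ds = es then ?F (rotate i es) else 0)"
      by (rule brep_sum_pick[OF stepping(2) ds es]) (simp add: hdv split: if_splits)
    also have "?F (rotate i es) = bas (VB1 (rotate i (lpow es (k + 1))))"
      unfolding target[symmetric] by (simp only: hdv if_True simp_thms)
    finally show ?thesis by simp
  next
    \<comment> \<open>Here the power is a single loop and \<open>k = 1\<close>. The junction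
      argument is replaced by \<open>bdry_loop_UB\<close>, and for \<open>ds = es\<close> by direct
      computation.\<close>
    case True
    have len: "length (?v i) = k * length es" by simp
    have "length (?v i) = 1" using True c[of i] unfolding cyclic_def by (cases "?v i") auto
    then have k1: "k = 1" "length es = 1" unfolding len by simp_all
    obtain l where esl: "es = [l]" using k1(2) by (cases es) auto
    have rl: "rotate n [l] = [l]" for n by (induction n) simp_all
    have v: "?v i = [l]" using rl by (simp add: esl k1)
    show ?thesis
    proof (cases "ds = es")
      case False
      have "bdry (\<Sum>j<length ds. capb (VB1 [l]) (UB (rotate j ds)))"
        by (intro bdry_sum bdry_loop_UB) (use es ds False in \<open>auto simp: esl\<close>)
      then show ?thesis using False v by simp
    next
      case dse: True
      have cl: "cyclic bstep [l]" using brep_facts(1)[OF es] by (simp add: esl)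
      have t: "tail Q l = head Q l" using bstep_comp[OF cyclic_bstep(2)[OF cl]] by (simp add: comp_def)
      have "capb (VB1 [l]) (UB [l]) = bas (VB1 (rotate i (lpow es (k + 1))))"
      proof -
        have "rotate i (lpow es (k + 1)) = [l, l]"
          unfolding rotate_lpow esl rl by (simp add: k1 numeral_2_eq_2)
        moreover have "Path (tail Q l) [l] \<in> paths Q"
          using cyclic_comp_facts(8)[OF cyclic_bstep(3)[OF cl]] by (simp add: mk_def)
        ultimately show ?thesis
          using capb_VB1_UB(1)[OF cl cl] t by (simp add: hom_bas_eq VB1_def)
      qed
      then show ?thesis using dse v by (simp add: esl rl)
    qed
  qed
  then have "bdry (\<Sum>i<length es. (\<Sum>j<length ds. capb (VB1 (?v i)) (UB (rotate j ds))) -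
      (if ds = es then bas (VB1 (rotate i (lpow es (k + 1)))) else 0))"
    by (intro bdry_sum)
  moreover have "cap_chain Q I (\<Sum>i<length es. bas (VB1 (?v i))) (\<Sum>j<length ds. bas (UB (rotate j ds))) =
      (\<Sum>i<length es. \<Sum>j<length ds. capb (VB1 (?v i)) (UB (rotate j ds)))"
    unfolding cap_chain_linear by (rule sum.swap)
  ultimately show ?thesis by (cases "ds = es") (simp_all only: simp_thms if_True if_False sum_subtractf sum.neutral_const diff_zero)
qed

text \<open>One rotation in the period begins with \<open>c\<close>. It contributes a rotation of
  the power, so the stated value is reached up to a boundary, and a higher power brings no
  multiplicity.\<close>

lemma cap_VB1_arrow:
  assumes es: "es \<in> brep bstep" and k: "1 \<le> k" and c: "c \<in> arcs Q"
  shows "bdry (cap_chain Q I (\<Sum>i<length es. bas (VB1 (rotate i (lpow es k)))) (bas (arrow Q c, arrow Q c)) -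
    (if c \<in> set es then bas (VB0 (lpow es k)) else 0))"
proof -
  let ?v = "\<lambda>i. rotate i (lpow es k)"
  let ?F = "\<lambda>i. if hd (rotate i es) = c then bas (VB0 (?v (Suc i))) else (0 :: _ \<Rightarrow>\<^sub>0 'k)"
  have cv: "cyclic bstep (?v i)" for i by (intro cyclic_rotate cyclic_lpow brep_facts(1) es k)
  have hdv: "hd (?v i) = hd (rotate i es)" for i using k by (simp add: rotate_lpow)
  have eq: "cap_chain Q I (\<Sum>i<length es. bas (VB1 (?v i))) (bas (arrow Q c, arrow Q c)) =
      (\<Sum>i<length es. ?F i)"
    unfolding cap_chain_linear by (simp only: capb_VB1_arrow[OF cv c] hdv rotate_eq_rotate1)
  show ?thesis
  proof (cases "c \<in> set es")
    case True
    then obtain i where i: "i < length es" "hd (rotate i es) = c" using ex_rotate_hd by metis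
    then show ?thesis
      unfolding eq brep_index_pick(2)[OF es i]
      using bdry_VB0_rotate[OF cyclic_lpow[OF brep_facts(1)[OF es] k], of "Suc i"] True
      by (simp only: if_True)
  next
    case False
    then show ?thesis unfolding eq brep_index_pick(1)[OF es False] by simp
  qed
qed

text \<open>The rotation beginning with \<open>c\<close> carries the bracket sign of its index, and
  this is the sign with which \<open>bdry_VG'_rotate\<close> takes it back to the unrotated
  word.\<close>

lemma cap_VG_arrow:
  assumes es: "es \<in> brep gstep" and k: "1 \<le> k" and c: "c \<in> arcs Q"
  shows "bdry (cap_chain Q I (\<Sum>i<length es. scale ((-1) ^ ((length (lpow es k) + 1) * i))
      (bas (VG (rotate i (lpow es k))))) (bas (arrow Q c, arrow Q c)) -
    (if c \<in> set es then scale ((-1) ^ (length (lpow es k) + 1)) (bas (VG' (lpow es k))) else 0))"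
proof -
  let ?m = "length (lpow es k)"
  let ?v = "\<lambda>i. rotate i (lpow es k)"
  let ?F = "\<lambda>i. if hd (rotate i es) = c
      then scale ((-1) ^ (?m + 1)) (scale ((-1) ^ ((?m + 1) * i)) (bas (VG' (?v i)))) else (0 :: _ \<Rightarrow>\<^sub>0 'k)"
  have cv: "cyclic gstep (?v i)" for i by (intro cyclic_rotate cyclic_lpow brep_facts(1) es k)
  have hdv: "hd (?v i) = hd (rotate i es)" for i using k by (simp add: rotate_lpow)
  have eq: "cap_chain Q I (\<Sum>i<length es. scale ((-1) ^ ((?m + 1) * i)) (bas (VG (?v i))))
      (bas (arrow Q c, arrow Q c)) = (\<Sum>i<length es. ?F i)"
    unfolding cap_chain_linear
  proof (rule sum.cong[OF refl])
    fix i
    show "scale ((-1) ^ ((?m + 1) * i)) (capb (VG (?v i)) (arrow Q c, arrow Q c)) = ?F i"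
      unfolding capb_VG_arrow[OF cv c] hdv length_rotate
      by (cases "hd (rotate i es) = c") (simp_all only: simp_thms if_True if_False scale_scale scale_zero mult.commute)
  qed
  show ?thesis
  proof (cases "c \<in> set es")
    case True
    then obtain i where i: "i < length es" "hd (rotate i es) = c" using ex_rotate_hd by metis
    have "bdry (scale ((-1) ^ (?m + 1)) (scale ((-1) ^ ((?m + 1) * i)) (bas (VG' (?v i))) -
        bas (VG' (lpow es k))))"
      by (intro bdry_scale bdry_VG'_rotate cyclic_lpow brep_facts(1) es k)
    then show ?thesis
      unfolding eq brep_index_pick(2)[OF es i] using True by (simp only: if_True scale_diff)
  next
    case False
    then show ?thesis unfolding eq brep_index_pick(1)[OF es False] by simp
  qed
qed

text \<open>A nonzero product forces \<open>y\<close> to be the single arrow \<open>hd v\<close>,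
  all of whose neighbours are then \<open>bstep\<close>s. If \<open>b\<close> is a vertex, this
  arrow is a loop with a second neighbour, against determinism. Otherwise \<open>b\<close> has other
  end arrows: for a loop \<open>v\<close> this again contradicts determinism, and else the junction
  of \<open>last v\<close> with \<open>b\<close> is a relation.\<close>

lemma capb_Gam_maximal_VB1:
  assumes v: "cyclic bstep v" and u: "(y, b) \<in> coh_pairs Q I" and ne: "arrows y \<noteq> []"
    and right: "\<And>c. \<not> gstep (last (arrows y)) c" and left: "\<And>c. \<not> gstep c (hd (arrows y))"
    and share: "\<not> share_end y b"
  shows "capb (VB1 v) (y, b) = 0"
proof (rule ccontr)
  assume nz: "capb (VB1 v) (y, b) \<noteq> 0"
  note f = cyclic_comp_facts[OF cyclic_bstep(3)[OF v]]
  let ?l = "hd v"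
  have y: "arrows y = [?l]"
    using capb_Gam_maximal[OF VB1_pair[OF v, unfolded VB1_def] u ne right] nz by (simp add: VB1_def)
  have up: "y \<in> paths Q" "b \<in> paths Q" "successively bstep (arrows b)" "src y = src b" "tgt Q y = tgt Q b"
    using u by (auto simp: coh_pairs_iff)
  have y': "y = arrow Q ?l" using up(1) y path_eq_mk[of y] by (simp add: arrow_eq_mk)
  have sb: "src b = tail Q ?l" "tgt Q b = head Q ?l" using up(4,5) y' by simp_all
  have to: "bstep c ?l" if "comp c ?l" for c using bstep_or_gstep[OF that] left y by auto
  have from_: "bstep ?l c" if "comp ?l c" for c using bstep_or_gstep[OF that] right y by auto
  have lv: "bstep (last v) ?l" by (rule cyclic_bstep(2)[OF v])
  show False
  proof (cases "arrows b = []")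
    case True
    then have "tail Q ?l = head Q ?l" using sb by (simp add: tgt_def)
    then have ll: "comp ?l ?l" using f(5) by (simp add: comp_def)
    from loop_has_other_neighbour[OF ll] show False
      using to from_ gstep_bstep_det(3,4) ll by metis
  next
    case bne: False
    have hb: "hd (arrows b) \<noteq> ?l" "last (arrows b) \<noteq> ?l" using share y bne by (auto simp: share_end_def)
    have bl: "hd (arrows b) \<in> arcs Q" "last (arrows b) \<in> arcs Q" "src b = tail Q (last (arrows b))"
        "tgt Q b = head Q (hd (arrows b))"
      using up(2) bne by (cases b; auto simp: paths_nonempty_iff tgt_Path)+
    show False
    proof (cases "tl v = []")
      case True
      then have "v = [?l]" using f(1) by (cases v) auto
      then have ll: "bstep ?l ?l" using lv by (metis last.simps)
      have "comp (last (arrows b)) ?l"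
        using bl sb bstep_comp[OF ll] by (simp add: comp_def)
      then show False using to gstep_bstep_det(4)[OF _ ll] hb(2) by metis
    next
      case False
      have "comp (last v) (hd (arrows b))" using bl sb bstep_comp[OF lv] by (simp add: comp_def)
      then have gs: "gstep (last (tl v)) (hd (arrows b))"
        using bstep_or_gstep gstep_bstep_det(3)[OF lv] hb(1) False by (metis last_tl)
      have vp: "Path (head Q ?l) (tl v) \<in> paths Q"
        using VB1_pair[OF v] by (simp add: VB1_def hom_pairs_iff)
      have pb: "Path (head Q ?l) (tl v) \<cdot> b = Path (src b) (tl v @ arrows b)" by (simp add: pcomp_def)
      have "Path (src b) (tl v @ arrows b) \<in> paths Q"
        unfolding pb[symmetric] by (rule comp_in_paths[OF vp up(2)]) (use sb in simp)
      then have "hb (Path (head Q ?l) (tl v) \<cdot> b) z = 0" for z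
        unfolding pb using False bne gs by (rule path_append_zero)
      then show False
        using nz capb_eq[OF arrow_in_paths[OF f(5)] up(1)] by (simp add: VB1_def split: if_splits)
    qed
  qed
qed

text \<open>A nonzero product forces \<open>y\<close> to be the loop \<open>hd v\<close> with a
  relation at its square, and pairs \<open>tl v\<close> with a vertex. The loop joins
  \<open>last v\<close> to the head of \<open>tl v\<close> by two \<open>bstep\<close>s, so these
  two letters themselves meet in a relation and \<open>bdry_kill\<close> applies. If
  \<open>tl v\<close> were one letter, it would be a second loop at the vertex.\<close>

lemma cap_VB1_UG:
  assumes v: "cyclic bstep v" and y: "cyclic gstep y"
  shows "bdry (capb (VB1 v) (UG y))"
proof (cases "capb (VB1 v) (UG y) = 0")
  case nz: False
  note f = cyclic_comp_facts[OF cyclic_bstep(3)[OF v]] and g = cyclic_comp_facts[OF cyclic_gstep(3)[OF y]]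
  let ?l = "hd v"
  note cn = capb_nonzero[OF arrow_in_paths[OF f(5)] g(8) nz[unfolded VB1_def UG_def]]
  have yl: "y = [?l]"
  proof -
    have t: "take (length y) [?l] = y" using cn(1) by simp
    then have "length y \<le> 1" by (metis length_take list.size(3,4) min.cobounded1 One_nat_def add_0)
    then show ?thesis using t g(1) by (cases y) auto
  qed
  have gl: "gstep ?l ?l" using cyclic_gstep(2)[OF y] yl by (metis last.simps list.sel(1))
  have lv: "bstep (last v) ?l" by (rule cyclic_bstep(2)[OF v])
  have tne: "tl v \<noteq> []"
  proof
    assume "tl v = []"
    then have "last v = ?l" using f(1) by (cases v) auto
    then show False using lv gl bstep_not_gstep by metis
  qed
  have lt: "last (tl v) = last v" using tne by (simp add: last_tl)
  have tb: "butlast (tl v) @ [last v] = tl v" using append_butlast_last_id[OF tne] lt by simp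
  let ?h = "hd (tl v)"
  have lh: "bstep ?l ?h" using cyclic_bstep(1)[OF v] tne by (cases v; cases "tl v") auto
  have loop: "tail Q ?l = head Q ?l" using gstep_comp[OF gl] by (simp add: comp_def)
  have ch: "comp (last v) ?h"
    using bstep_comp[OF lv] bstep_comp[OF lh] loop by (simp add: comp_def)
  have gh: "gstep (last v) ?h"
  proof -
    have "\<not> bstep (last v) ?h"
      using gstep_bstep_det(3)[OF lv] lh gl bstep_not_gstep by metis
    then show ?thesis using bstep_or_gstep[OF ch] by blast
  qed
  have bne: "butlast (tl v) \<noteq> []"
  proof
    assume "butlast (tl v) = []"
    then have "?h = last v" using tb by (metis append_Nil list.sel(1))
    then have "comp ?h ?h" "comp ?l ?h" "comp ?l ?l"
      using ch bstep_comp[OF lh] gstep_comp[OF gl] by simp_all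
    then have "?l = ?h" by (metis no_two_loops)
    then show False using lh gl bstep_not_gstep by metis
  qed
  have vp: "(Path (head Q ?l) (tl v), arrow Q ?l) \<in> hom_pairs Q I"
    using VB1_pair[OF v] by (simp add: VB1_def)
  have "(Path (tail Q ?l) (tl v), vert (tail Q ?l)) \<in> hom_pairs Q I"
  proof -
    have "vert (tail Q ?l) \<in> paths Q" using f(5) by (intro vert_in_paths) simp
    then show ?thesis using vp loop unfolding hom_pairs_iff by simp
  qed
  then have "(Path (tail Q ?l) (butlast (tl v) @ [last v]), Path (tail Q ?l) []) \<in> hom_pairs Q I"
    unfolding tb vert_def .
  then have b: "bdry (bas (Path (tail Q ?l) (butlast (tl v) @ [last v]), Path (tail Q ?l) []))"
    by (rule bdry_kill) (use bne gh hd_butlast[OF bne] in simp_all)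
  have "capb (VB1 v) (UG y) = scale ((-1) ^ ((1 + 1) * 1)) (hb (Path (tail Q ?l) (tl v)) (Path (tail Q ?l) []))"
    using capb_eq[OF arrow_in_paths[OF f(5)] g(8)] yl loop
    by (simp add: VB1_def UG_def vert_def pcomp_def)
  moreover have "Path (tail Q ?l) (tl v) \<in> paths Q" "successively bstep (tl v)"
    using vp loop by (simp_all add: hom_pairs_iff)
  ultimately have "capb (VB1 v) (UG y) = bas (Path (tail Q ?l) (tl v), Path (tail Q ?l) [])"
    by (simp add: hom_bas_eq)
  then show ?thesis using b unfolding tb by simp
qed simp

lemma even_sign: "(-1 :: 'k) ^ q = 1 \<Longrightarrow> (-1 :: 'k) ^ ((p + q) * q) = 1"
  by (subst mult.commute) (simp add: power_mult)

text \<open>Splitting \<open>w\<close> turns off \<open>k\<close> leaves \<open>k - w\<close> turns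
  at the same base vertex. The remainder is written with \<open>Path\<close> and not with
  \<open>mk\<close>, because for \<open>w = k\<close> it is a vertex.\<close>

lemma cap_VG_UG:
  assumes es: "es \<in> brep gstep" and k: "1 \<le> k" and ds: "ds \<in> brep gstep" and w: "1 \<le> w"
    and sgn: "(-1 :: 'k) ^ length (lpow ds w) = 1"
  shows "cap_chain Q I (\<Sum>i<length es. scale (s i) (bas (VG (rotate i (lpow es k)))))
      (\<Sum>j<length ds. bas (UG (rotate j (lpow ds w)))) =
    (if ds = es \<and> w \<le> k then \<Sum>i<length es. scale (s i)
      (bas (vert (tail Q (last (rotate i es))),
        Path (tail Q (last (rotate i es))) (rotate i (lpow es (k - w))))) else 0)"
proof -
  let ?v = "\<lambda>i. rotate i (lpow es k)"
  let ?R = "\<lambda>i. bas (vert (tail Q (last (rotate i es))),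
        Path (tail Q (last (rotate i es))) (rotate i (lpow es (k - w)))) :: _ \<Rightarrow>\<^sub>0 'k"
  have cv: "cyclic gstep (?v i)" for i by (intro cyclic_rotate cyclic_lpow brep_facts(1) es k)
  have cy: "cyclic gstep (lpow (rotate j ds) w)" for j by (intro cyclic_lpow cyclic_rotate brep_facts(1) ds w)
  have hdv: "hd (?v i) = hd (rotate i es)" "last (?v i) = last (rotate i es)" for i
    using k by (simp_all add: rotate_lpow)
  have "(\<Sum>j<length ds. capb (VG (?v i)) (UG (lpow (rotate j ds) w))) =
      (if ds = es \<and> w \<le> k then ?R i else 0)" for i
  proof -
    note f = cyclic_comp_facts[OF cyclic_gstep(3)[OF cv[of i]]]
    have "(\<Sum>j<length ds. capb (VG (?v i)) (UG (lpow (rotate j ds) w))) =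
        (if ds = es then capb (VG (?v i)) (UG (lpow (rotate i es) w)) else 0)"
    proof (rule brep_sum_pick[OF stepping(1) ds es, of "\<lambda>x. capb (VG (?v i)) (UG (lpow x w))"])
      fix j assume nz: "capb (VG (?v i)) (UG (lpow (rotate j ds) w)) \<noteq> 0"
      note g = cyclic_comp_facts[OF cyclic_gstep(3)[OF cy[of j]]]
      have "hd (lpow (rotate j ds) w) = hd (?v i)"
        using capb_nonzero(3)[OF f(8) g(8) nz[unfolded VG_def UG_def]] g(1) by simp
      then show "hd (rotate j ds) = hd (rotate i es)" using w by (simp add: hdv)
    qed
    also have "\<dots> = (if ds = es \<and> w \<le> k then ?R i else 0)"
    proof (cases "ds = es")
      case dse: True
      let ?y = "lpow (rotate i es) w"
      note g = cyclic_comp_facts[OF cyclic_gstep(3)[OF cy[of i, unfolded dse]]]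
      have ly: "length ?y = w * length es" by simp
      have "capb (VG (?v i)) (UG ?y) = (if w \<le> k then ?R i else 0)"
      proof (cases "w \<le> k")
        case True
        have vy: "?v i = ?y @ rotate i (lpow es (k - w))"
          using True by (simp add: rotate_lpow flip: lpow_add)
        have ts: "take (length ?y) (?v i) = ?y" "drop (length ?y) (?v i) = rotate i (lpow es (k - w))"
          unfolding vy by simp_all
        have tg: "tgt Q (mk ?y) = tgt Q (mk (?v i))" using f(1) g(1) hdv w by simp
        have sg: "(-1 :: 'k) ^ ((length (?v i) + length ?y) * length ?y) = 1"
          by (rule even_sign) (use sgn dse in simp)
        have lasty: "last ?y = last (rotate i es)" using w by simp
        have ev: "tail Q (last (rotate i es)) \<in> verts Q" using f(7) by (simp only: hdv)
        have "capb (VG (?v i)) (UG ?y) =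
            hb (vert (tail Q (last (?v i))) \<cdot> vert (tail Q (last ?y))) (Path (tail Q (last (?v i))) (rotate i (lpow es (k - w))))"
          unfolding VG_def UG_def capb_eq[OF f(8) g(8)] arrows_mk src_mk using tg ts sg by simp
        also have "\<dots> = ?R i"
          unfolding hdv lasty using vert_in_paths[OF ev] by (simp add: vert_def pcomp_def hom_bas_eq)
        finally show ?thesis using True by simp
      next
        case False
        have "capb (VG (?v i)) (UG ?y) = 0"
        proof (rule ccontr)
          assume nz: "capb (VG (?v i)) (UG ?y) \<noteq> 0"
          have "take (length ?y) (?v i) = ?y"
            using capb_nonzero(1)[OF f(8) g(8) nz[unfolded VG_def UG_def]] by simp
          then have "length ?y \<le> length (?v i)" by (metis length_take min.cobounded1)
          then have "w * length es \<le> k * length es" by simp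
          then show False using False brep_facts(4)[OF es] by simp
        qed
        then show ?thesis using False by simp
      qed
      then show ?thesis using dse by simp
    qed simp
    finally show ?thesis .
  qed
  then have *: "(\<Sum>j<length ds. capb (VG (?v i)) (UG (rotate j (lpow ds w)))) =
      (if ds = es \<and> w \<le> k then ?R i else 0)" for i
    by (simp only: rotate_lpow)
  have "cap_chain Q I (\<Sum>i<length es. scale (s i) (bas (VG (?v i)))) (\<Sum>j<length ds. bas (UG (rotate j (lpow ds w)))) =
      (\<Sum>i<length es. scale (s i) (\<Sum>j<length ds. capb (VG (?v i)) (UG (rotate j (lpow ds w)))))"
    unfolding cap_chain_linear scale_sum by (rule sum.swap)
  then show ?thesis unfolding *
    by (cases "ds = es \<and> w \<le> k") (simp_all only: if_True if_False simp_thms scale_zero sum.neutral_const)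
qed

text \<open>The right component lacks the first letter of the power; so the matching rotation of
  \<open>ds\<close> is the one by 1, and \<open>w = k\<close> no longer fits.\<close>

lemma cap_VG'_UG:
  assumes es: "es \<in> brep gstep" and k: "1 \<le> k" and ds: "ds \<in> brep gstep" and w: "1 \<le> w"
    and sgn: "(-1 :: 'k) ^ length (lpow ds w) = 1"
  shows "cap_chain Q I (bas (VG' (lpow es k))) (\<Sum>j<length ds. bas (UG (rotate j (lpow ds w)))) =
    (if ds = es \<and> w < k then bas (VG' (lpow es (k - w))) else 0)"
proof -
  let ?v = "lpow es k"
  have cv: "cyclic gstep ?v" by (intro cyclic_lpow brep_facts(1) es k)
  have cy: "cyclic gstep (lpow (rotate j ds) w)" for j by (intro cyclic_lpow cyclic_rotate brep_facts(1) ds w)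
  note f = cyclic_comp_facts[OF cyclic_gstep(3)[OF cv]] and t = tl_path[OF cyclic_gstep(3)[OF cv]]
  have ne: "es \<noteq> []" by (rule brep_facts(3)[OF es])
  have "(\<Sum>j<length ds. capb (VG' ?v) (UG (lpow (rotate j ds) w))) =
      (if ds = es then capb (VG' ?v) (UG (lpow (rotate 1 es) w)) else 0)"
  proof (rule brep_sum_pick[OF stepping(1) ds es, of "\<lambda>x. capb (VG' ?v) (UG (lpow x w))"])
    fix j assume nz: "capb (VG' ?v) (UG (lpow (rotate j ds) w)) \<noteq> 0"
    note g = cyclic_comp_facts[OF cyclic_gstep(3)[OF cy[of j]]]
    have h: "tl ?v \<noteq> []" "hd (lpow (rotate j ds) w) = hd (tl ?v)"
      using capb_nonzero(3)[OF t(1) g(8) nz[unfolded VG'_def UG_def]] g(1) by simp_all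
    have "hd (tl ?v) = hd (rotate1 ?v)" using h(1) f(1) by (simp add: rotate1_conv)
    also have "\<dots> = hd (rotate 1 es)" using k by (simp add: rotate1_lpow)
    finally show "hd (rotate j ds) = hd (rotate 1 es)" using h(2) w by simp
  qed
  also have "\<dots> = (if ds = es \<and> w < k then bas (VG' (lpow es (k - w))) else 0)"
  proof (cases "ds = es")
    case dse: True
    let ?y = "lpow (rotate 1 es) w"
    note g = cyclic_comp_facts[OF cyclic_gstep(3)[OF cy[of 1, unfolded dse]]]
    have "capb (VG' ?v) (UG ?y) = (if w < k then bas (VG' (lpow es (k - w))) else 0)"
    proof (cases "w < k")
      case True
      let ?z = "lpow es (k - w)"
      have zne: "?z \<noteq> []" using True ne by simp
      have "?y = rotate1 (lpow es w)" by (simp add: rotate1_lpow)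
      also have "\<dots> = tl (lpow es w) @ [hd es]" using w ne by (simp add: rotate1_conv)
      finally have y: "?y = tl (lpow es w) @ [hd es]" .
      have hz: "hd ?z = hd es" "last ?z = last ?v" using True w by simp_all
      have "?v = lpow es w @ ?z" using True by (simp flip: lpow_add)
      moreover have "hd ?z # tl ?z = ?z" using zne by (rule list.collapse)
      ultimately have "tl ?v = tl (lpow es w) @ hd ?z # tl ?z" using w ne by simp
      then have vy: "tl ?v = ?y @ tl ?z" unfolding y hz(1) by simp
      have ts: "take (length ?y) (tl ?v) = ?y" "drop (length ?y) (tl ?v) = tl ?z"
        unfolding vy by simp_all
      have tg: "tgt Q (mk ?y) = tgt Q (Path (tail Q (last ?v)) (tl ?v))"
        using g(1) by (simp add: tgt_Path vy)
      have sg: "(-1 :: 'k) ^ ((length (tl ?v) + length ?y) * length ?y) = 1"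
        by (rule even_sign) (use sgn dse in simp)
      have lasty: "last ?y = hd es" unfolding y by simp
      have a: "hd es \<in> arcs Q" using f(5) k by simp
      have hv: "hd ?v = hd es" using k by simp
      have "capb (VG' ?v) (UG ?y) =
          hb (arrow Q (hd ?v) \<cdot> vert (tail Q (last ?y))) (Path (tail Q (last ?v)) (tl ?z))"
        unfolding VG'_def UG_def capb_eq[OF t(1) g(8)] arrows_mk src_mk path.sel using tg ts sg by simp
      also have "\<dots> = bas (VG' ?z)"
        unfolding lasty hv VG'_def hz using arrow_in_paths[OF a] by (simp add: arrow_vert hom_bas_eq)
      finally show ?thesis using True by simp
    next
      case False
      have "capb (VG' ?v) (UG ?y) = 0"
      proof (rule ccontr)
        assume nz: "capb (VG' ?v) (UG ?y) \<noteq> 0"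
        have "take (length ?y) (tl ?v) = ?y"
          using capb_nonzero(1)[OF t(1) g(8) nz[unfolded VG'_def UG_def]] by simp
        from arg_cong[OF this, of length] have "w * length es \<le> k * length es - 1" by simp
        moreover have "k * length es \<le> w * length es" using False by simp
        moreover have "0 < k * length es" using k brep_facts(4)[OF es] by simp
        ultimately show False by linarith
      qed
      then show ?thesis using False by simp
    qed
    then show ?thesis using dse by simp
  qed simp
  finally show ?thesis unfolding cap_chain_linear rotate_lpow .
qed

section \<open>Generators and basis elements in terms of cyclic words\<close>

lemma angle_cocomplete_eq:
  assumes "ds \<in> brep bstep"
  shows "angle_cocomplete Q (mk ds) = (\<Sum>j<length ds. bas (UB (rotate j ds)))"
  using period_mk_lpow[OF brep_facts(2,3)[OF assms], of 1] brep_facts(3)[OF assms]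
  by (simp add: angle_cocomplete_def rotn_mk UB_def)

lemma angle_complete_eq:
  assumes "ds \<in> brep gstep" "1 \<le> w"
  shows "angle_complete Q (mk (lpow ds w)) = (\<Sum>j<length ds. bas (UG (rotate j (lpow ds w))))"
  unfolding angle_complete_def period_mk_lpow[OF brep_facts(2,3)[OF assms(1)] assms(2)]
  using brep_facts(3)[OF assms(1)] assms(2) by (simp add: rotn_mk UG_def)

lemma bracket_complete_eq:
  assumes "es \<in> brep gstep" "1 \<le> k"
  shows "bracket_complete Q (mk (lpow es k)) =
    (\<Sum>i<length es. scale ((-1) ^ ((length (lpow es k) + 1) * i)) (bas (VG (rotate i (lpow es k)))))"
  unfolding bracket_complete_def period_mk_lpow[OF brep_facts(2,3)[OF assms(1)] assms(2)]
  using brep_facts(3)[OF assms(1)] assms(2) by (simp add: rotn_mk VG_def)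

lemma bracket_cocomplete_eq:
  assumes es: "es \<in> brep bstep" and k: "1 \<le> k"
  shows "bracket_cocomplete Q (mk (lpow es k)) = (\<Sum>i<length es. bas (VB1 (rotate i (lpow es k))))"
proof -
  let ?g = "\<lambda>w. bas (Path (head Q (last w)) (butlast w), arrow Q (last w))"
  have ne: "lpow es k \<noteq> []" "rotate i (lpow es k) \<noteq> []" for i
    using brep_facts(3)[OF es] k by simp_all
  have "bracket_cocomplete Q (mk (lpow es k)) = (\<Sum>i<length es. ?g (rotate i (lpow es k)))"
    unfolding bracket_cocomplete_def period_mk_lpow[OF brep_facts(2,3)[OF es] k] rotn_mk[OF ne(1)]
    by (simp add: drop_first_def first_arrow_def)
  also have "\<dots> = (\<Sum>i<length es. ?g (rotate (Suc i) (lpow es k)))"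
    by (rule sum_rotate_shift[symmetric])
  also have "\<dots> = (\<Sum>i<length es. bas (VB1 (rotate i (lpow es k))))"
    unfolding rotate_eq_rotate1 rotate1_conv[OF ne(2)] by (simp add: VB1_def)
  finally show ?thesis .
qed

lemma VB0_eq: "bas (mk cs, vert (src (mk cs))) = bas (VB0 cs)"
  by (simp add: VB0_def)

lemma VG'_eq: "bas (last_arrow Q (mk cs), drop_last (mk cs)) = bas (VG' cs)"
  by (simp add: VG'_def last_arrow_def drop_last_def)

lemma hom_basis_cases:
  assumes "v \<in> hom_basis Q I rep"
  obtains (vertex) e where "e \<in> verts Q" "v = hom_class Q I (bas (vert e, vert e))"
    | (co0) es k where "es \<in> brep bstep" "1 \<le> k" "v = hom_class Q I (bas (VB0 (lpow es k)))"
    | (co1) es k where "es \<in> brep bstep" "1 \<le> k"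
        "v = hom_class Q I (bracket_cocomplete Q (mk (lpow es k)))"
    | (com) es k where "es \<in> brep gstep" "1 \<le> k"
        "(-1 :: 'k) ^ ((length (lpow es k) + 1) * length es) = 1"
        "v = hom_class Q I (bracket_complete Q (mk (lpow es k)))"
    | (com') es k where "es \<in> brep gstep" "1 \<le> k"
        "(-1 :: 'k) ^ ((length (lpow es k) + 1) * length es) = 1"
        "v = hom_class Q I (bas (VG' (lpow es k)))"
proof -
  have cases: "(\<exists>e\<in>verts Q. v = hom_class Q I (bas (vert e, vert e))) \<or>
    (\<exists>C\<in>circ bstep. v = hom_class Q I (bas (bar Q I rep C, vert (src (bar Q I rep C)))) \<or>
       v = hom_class Q I (bracket_cocomplete Q (bar Q I rep C))) \<or>
    (\<exists>C\<in>circ gstep. (-1 :: 'k) ^ ((len (bar Q I rep C) + 1) * period Q (bar Q I rep C)) = 1 \<and>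
       (v = hom_class Q I (bracket_complete Q (bar Q I rep C)) \<or>
        v = hom_class Q I (bas (last_arrow Q (bar Q I rep C), drop_last (bar Q I rep C)))))"
    using assms unfolding hom_basis_def circuits_eq_circ Let_def by blast
  then show thesis
  proof (elim disjE bexE)
    fix e assume "e \<in> verts Q" "v = hom_class Q I (bas (vert e, vert e))"
    then show thesis by (rule vertex)
  next
    fix C assume C: "C \<in> circ bstep" and "v = hom_class Q I (bas (bar Q I rep C, vert (src (bar Q I rep C))))"
    with circ_brep[OF stepping(2) C] show thesis using co0 VB0_eq by metis
  next
    fix C assume C: "C \<in> circ bstep" and "v = hom_class Q I (bracket_cocomplete Q (bar Q I rep C))"
    with circ_brep[OF stepping(2) C] show thesis using co1 by metis
  next
    fix C assume C: "C \<in> circ gstep"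
      and v: "(-1 :: 'k) ^ ((len (bar Q I rep C) + 1) * period Q (bar Q I rep C)) = 1 \<and>
       (v = hom_class Q I (bracket_complete Q (bar Q I rep C)) \<or>
        v = hom_class Q I (bas (last_arrow Q (bar Q I rep C), drop_last (bar Q I rep C))))"
    obtain es k where e: "es \<in> brep gstep" "1 \<le> k" "bar Q I rep C = mk (lpow es k)"
      using circ_brep[OF stepping(1) C] by metis
    note p = period_mk_lpow[OF brep_facts(2,3)[OF e(1)] e(2)]
    have s: "(-1 :: 'k) ^ ((length (lpow es k) + 1) * length es) = 1"
      using v unfolding e(3) p arrows_mk by (rule conjunct1)
    from v show thesis
      unfolding e(3) VG'_eq using com[OF e(1,2) s] com'[OF e(1,2) s] by blast
  qed
qed

lemma subpath_right: "p \<in> paths Q \<Longrightarrow> c \<in> arcs Q \<Longrightarrow> src p = head Q c \<Longrightarrow> subpath Q p (p \<cdot> arrow Q c)"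
  unfolding subpath_def
  by (intro bexI[of _ "vert (tgt Q p)"] bexI[of _ "arrow Q c"] conjI)
    (simp_all add: arrow_in_paths vert_in_paths src_tgt_in_verts[OF wf_digraph], simp add: vert_def pcomp_def)

lemma subpath_left: "p \<in> paths Q \<Longrightarrow> c \<in> arcs Q \<Longrightarrow> tail Q c = tgt Q p \<Longrightarrow> subpath Q p (arrow Q c \<cdot> p)"
  unfolding subpath_def
  by (intro bexI[of _ "arrow Q c"] bexI[of _ "vert (src p)"] conjI)
    (simp_all add: arrow_in_paths vert_in_paths src_tgt_in_verts[OF wf_digraph], simp add: vert_def pcomp_def)

lemma maximal_extend:
  assumes "maximal_in Q S p" "p \<in> paths Q" "c \<in> arcs Q"
  shows "src p = head Q c \<Longrightarrow> p \<cdot> arrow Q c \<notin> S" "tail Q c = tgt Q p \<Longrightarrow> arrow Q c \<cdot> p \<notin> S"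
proof -
  have "len (p \<cdot> arrow Q c) \<noteq> len p" "len (arrow Q c \<cdot> p) \<noteq> len p" by simp_all
  then have ne: "p \<cdot> arrow Q c \<noteq> p" "arrow Q c \<cdot> p \<noteq> p" by metis+
  show "src p = head Q c \<Longrightarrow> p \<cdot> arrow Q c \<notin> S"
    using assms ne(1) subpath_right unfolding maximal_in_def by blast
  show "tail Q c = tgt Q p \<Longrightarrow> arrow Q c \<cdot> p \<notin> S"
    using assms ne(2) subpath_left unfolding maximal_in_def by blast
qed

lemma B_maximal_cycle:
  assumes p: "p \<in> cycles Q" and max: "maximal_in Q (Bset Q I) p"
  obtains w where "p = mk w" "cyclic comp w" "successively bstep w" "butlast w \<noteq> []"
    "\<And>c. comp (last w) c \<Longrightarrow> gstep (last w) c" "\<And>c. comp c (hd w) \<Longrightarrow> gstep c (hd w)"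
proof -
  obtain w where w: "p = mk w" "cyclic comp w" using p by (auto simp: cycles_iff)
  note f = cyclic_comp_facts[OF w(2)]
  have s: "successively bstep w" using max by (simp add: maximal_in_def Bset_iff w)
  have right: "gstep (last w) c" if "comp (last w) c" for c
  proof (rule ccontr)
    assume "\<not> gstep (last w) c"
    then have b: "bstep (last w) c" using bstep_or_gstep[OF that] by blast
    have c: "c \<in> arcs Q" "src (mk w) = head Q c" using that by (simp_all add: comp_def)
    have "mk w \<cdot> arrow Q c \<in> paths Q"
      by (rule comp_in_paths[OF f(8) arrow_in_paths[OF c(1)]]) (use c in simp)
    then have "mk w \<cdot> arrow Q c \<in> Bset Q I"
      using s b f(1) by (simp add: Bset_iff successively_append_iff)
    then show False using maximal_extend(1)[OF max[unfolded w(1)] f(8) c] by simp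
  qed
  have left: "gstep c (hd w)" if "comp c (hd w)" for c
  proof (rule ccontr)
    assume "\<not> gstep c (hd w)"
    then have b: "bstep c (hd w)" using bstep_or_gstep[OF that] by blast
    have c: "c \<in> arcs Q" "tail Q c = tgt Q (mk w)" using that f(1) by (simp_all add: comp_def)
    have "arrow Q c \<cdot> mk w \<in> paths Q"
      by (rule comp_in_paths[OF arrow_in_paths[OF c(1)] f(8)]) (use c in simp)
    then have "arrow Q c \<cdot> mk w \<in> Bset Q I"
      using s b by (simp add: Bset_iff successively_Cons)
    then show False using maximal_extend(2)[OF max[unfolded w(1)] f(8) c] by simp
  qed
  \<comment> \<open>A one-letter \<open>w\<close> would be a loop whose square is a relation; its
    other neighbour would give a second relation on the same side.\<close>
  have "butlast w \<noteq> []"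
  proof
    assume "butlast w = []"
    then have "w = [last w]" using append_butlast_last_id[OF f(1)] by simp
    then have h: "hd w = last w" by (metis list.sel(1))
    then have l: "comp (last w) (last w)" using w(2) by (simp add: cyclic_def)
    from loop_has_other_neighbour[OF l] show False
      using right left h l gstep_bstep_det(1,2) by metis
  qed
  with that w s right left show thesis by blast
qed

lemma Gam_maximal_nonempty:
  assumes max: "maximal_in Q (Gam Q I) g" and g: "g \<in> paths Q" "successively gstep (arrows g)"
  shows "arrows g \<noteq> []" "\<not> gstep c (hd (arrows g))" "\<not> gstep (last (arrows g)) c"
proof -
  \<comment> \<open>A vertex is never \<Gamma>-maximal, as \<open>ex_nonloop\<close> provides an
    arrow at it.\<close>
  show ne: "arrows g \<noteq> []"
  proof
    assume e: "arrows g = []"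
    have t: "tgt Q g = src g" using e by (simp add: tgt_def)
    have "src g \<in> verts Q" using src_tgt_in_verts[OF wf_digraph g(1)] by simp
    then obtain c where c: "c \<in> arcs Q" "tail Q c = src g \<or> head Q c = src g"
      using ex_nonloop by metis
    have "g \<cdot> arrow Q c \<in> Gam Q I" if "src g = head Q c"
      using comp_in_paths[OF g(1) arrow_in_paths[OF c(1)]] that e by (simp add: Gam_iff)
    moreover have "arrow Q c \<cdot> g \<in> Gam Q I" if "tail Q c = tgt Q g"
      using comp_in_paths[OF arrow_in_paths[OF c(1)] g(1)] that e by (simp add: Gam_iff)
    ultimately show False using maximal_extend[OF max g(1) c(1)] c(2) t by auto
  qed
  have gc: "src g = tail Q (last (arrows g))" "tgt Q g = head Q (hd (arrows g))"
    using g(1) ne by (cases g; auto simp: paths_nonempty_iff tgt_Path)+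
  show "\<not> gstep c (hd (arrows g))"
  proof
    assume s: "gstep c (hd (arrows g))"
    then have c: "c \<in> arcs Q" "tail Q c = tgt Q g" using gstep_comp[OF s] gc by (simp_all add: comp_def)
    then have "arrow Q c \<cdot> g \<in> Gam Q I"
      using comp_in_paths[OF arrow_in_paths[OF c(1)] g(1)] s g(2) by (simp add: Gam_iff successively_Cons)
    then show False using maximal_extend(2)[OF max g(1) c] by simp
  qed
  show "\<not> gstep (last (arrows g)) c"
  proof
    assume s: "gstep (last (arrows g)) c"
    then have c: "c \<in> arcs Q" "src g = head Q c" using gstep_comp[OF s] gc by (simp_all add: comp_def)
    then have "g \<cdot> arrow Q c \<in> Gam Q I"
      using comp_in_paths[OF g(1) arrow_in_paths[OF c(1)]] s g(2) ne
      by (simp add: Gam_iff successively_append_iff)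
    then show False using maximal_extend(1)[OF max g(1) c] by simp
  qed
qed

lemma coh_generators_cases:
  assumes "u \<in> coh_generators Q I rep T"
  obtains (Bmax) w where "cyclic comp w" "successively bstep w" "butlast w \<noteq> []"
      "\<And>c. comp (last w) c \<Longrightarrow> gstep (last w) c" "\<And>c. comp c (hd w) \<Longrightarrow> gstep c (hd w)"
      "u = coh_class Q I (bas (UB w))"
    | (co) ds where "ds \<in> brep bstep" "u = coh_class Q I (angle_cocomplete Q (mk ds))"
    | (arc) c where "c \<in> arcs Q - T" "u = coh_class Q I (bas (arrow Q c, arrow Q c))"
    | (Gmax) y b where "(y, b) \<in> coh_pairs Q I" "arrows y \<noteq> []"
        "\<And>c. \<not> gstep (last (arrows y)) c" "\<And>c. \<not> gstep c (hd (arrows y))" "\<not> share_end y b"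
        "u = coh_class Q I (bas (y, b))"
    | (com) ds w where "ds \<in> brep gstep" "1 \<le> w" "(-1 :: 'k) ^ length (lpow ds w) = 1"
        "mk (lpow ds w) \<in> basic_Gam Q I rep" "u = coh_class Q I (angle_complete Q (mk (lpow ds w)))"
proof -
  consider p where "p \<in> cycles Q" "maximal_in Q (Bset Q I) p" "u = coh_class Q I (bas (vert (src p), p))"
    | p where "p \<in> basic_B Q I rep" "u = coh_class Q I (angle_cocomplete Q p)"
    | c where "c \<in> arcs Q - T" "u = coh_class Q I (bas (arrow Q c, arrow Q c))"
    | g p where "(g, p) \<in> coh_pairs Q I" "maximal_in Q (Gam Q I) g" "\<not> share_end g p"
        "u = coh_class Q I (bas (g, p))"
    | p where "p \<in> basic_Gam Q I rep" "u = coh_class Q I (angle_complete Q p)"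
    using assms unfolding coh_generators_def by blast
  then show thesis
  proof cases
    case (1 p)
    from B_maximal_cycle[OF 1(1,2)] obtain w where w: "p = mk w" "cyclic comp w" "successively bstep w"
      "butlast w \<noteq> []" "\<And>c. comp (last w) c \<Longrightarrow> gstep (last w) c" "\<And>c. comp c (hd w) \<Longrightarrow> gstep c (hd w)"
      by blast
    show thesis by (rule Bmax[OF w(2-6)]) (simp_all add: 1(3) w(1) UB_def)
  next
    case (2 p)
    then show thesis using co unfolding basic_B_eq by blast
  next
    case (3 c)
    then show thesis by (rule arc)
  next
    case (4 g p)
    then have "g \<in> paths Q" "successively gstep (arrows g)" by (simp_all add: coh_pairs_iff)
    note m = Gam_maximal_nonempty[OF 4(2) this]
    show thesis by (rule Gmax[OF 4(1) m(1) m(3) m(2) 4(3,4)])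
  next
    case (5 p)
    from basic_Gam_elim[OF 5(1)] show thesis using com 5 by metis
  qed
qed

section \<open>The representatives are cycles and cocycles\<close>

lemma cycle_vert:
  assumes "e \<in> verts Q"
  shows "bas (vert e, vert e) \<in> hom_chains Q I" "hdiff (bas (vert e, vert e)) = 0"
  using vert_pair[OF assms] by (simp_all add: bas_in_hom_chains hom_diff_bas)

lemma cycle_VB0:
  assumes "es \<in> brep bstep" "1 \<le> k"
  shows "bas (VB0 (lpow es k)) \<in> hom_chains Q I" "hdiff (bas (VB0 (lpow es k))) = 0"
  using VB0_pair[OF cyclic_lpow[OF brep_facts(1)[OF assms(1)] assms(2)]]
  by (simp_all add: bas_in_hom_chains) (simp add: VB0_def hom_diff_bas)

lemma cycle_VB1:
  assumes es: "es \<in> brep bstep" and k: "1 \<le> k"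
  shows "bracket_cocomplete Q (mk (lpow es k)) \<in> hom_chains Q I"
    "hdiff (bracket_cocomplete Q (mk (lpow es k))) = 0"
proof -
  have "cyclic bstep (rotate i (lpow es k))" for i by (intro cyclic_rotate cyclic_lpow brep_facts(1) es k)
  then show "bracket_cocomplete Q (mk (lpow es k)) \<in> hom_chains Q I"
    unfolding bracket_cocomplete_eq[OF es k]
    by (intro hom_chains_closed(4)) (simp add: bas_in_hom_chains VB1_pair)
  show "hdiff (bracket_cocomplete Q (mk (lpow es k))) = 0"
    unfolding bracket_cocomplete_eq[OF es k]
    by (rule bracket_cocomplete_cycle[OF brep_facts(1)[OF es] k])
qed

lemma cycle_VG:
  assumes es: "es \<in> brep gstep" and k: "1 \<le> k"
    and sgn: "(-1 :: 'k) ^ ((length (lpow es k) + 1) * length es) = 1"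
  shows "bracket_complete Q (mk (lpow es k)) \<in> hom_chains Q I"
    "hdiff (bracket_complete Q (mk (lpow es k))) = 0"
proof -
  have "cyclic gstep (rotate i (lpow es k))" for i by (intro cyclic_rotate cyclic_lpow brep_facts(1) es k)
  then show "bracket_complete Q (mk (lpow es k)) \<in> hom_chains Q I"
    unfolding bracket_complete_eq[OF es k]
    by (intro hom_chains_closed(3,4)) (simp add: bas_in_hom_chains VG_pair)
  show "hdiff (bracket_complete Q (mk (lpow es k))) = 0"
    unfolding bracket_complete_eq[OF es k]
    by (rule bracket_complete_cycle[OF brep_facts(1)[OF es] k sgn])
qed

lemma cycle_VG':
  assumes "es \<in> brep gstep" "1 \<le> k"
  shows "bas (VG' (lpow es k)) \<in> hom_chains Q I" "hdiff (bas (VG' (lpow es k))) = 0"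
  using VG'_pair[OF cyclic_lpow[OF brep_facts(1)[OF assms(1)] assms(2)]]
    hom_diff_VG'[OF cyclic_lpow[OF brep_facts(1)[OF assms(1)] assms(2)]]
  by (simp_all add: bas_in_hom_chains)

lemma bas_in_cochains: "u \<in> coh_pairs Q I \<Longrightarrow> bas u \<in> cochains Q I"
  by (simp add: cochains_def)

lemma sum_in_cochains:
  fixes f :: "nat \<Rightarrow> ('v, 'a) path \<times> ('v, 'a) path"
  assumes "\<And>i. f i \<in> coh_pairs Q I"
  shows "(\<Sum>i\<in>A. bas (f i)) \<in> cochains Q I"
proof -
  have "Poly_Mapping.keys (\<Sum>i\<in>A. bas (f i) :: _ \<Rightarrow>\<^sub>0 'k) \<subseteq> (\<Union>i\<in>A. {f i})"
    using keys_sum[of "\<lambda>i. bas (f i) :: _ \<Rightarrow>\<^sub>0 'k" A] by simp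
  then show ?thesis using assms unfolding cochains_def by blast
qed

lemma cocycle_B_maximal:
  assumes w: "cyclic comp w" "successively bstep w"
    and right: "\<And>c. comp (last w) c \<Longrightarrow> gstep (last w) c"
    and left: "\<And>c. comp c (hd w) \<Longrightarrow> gstep c (hd w)"
  shows "bas (UB w) \<in> cochains Q I" "coh_diff Q I (bas (UB w)) = 0"
proof -
  show "bas (UB w) \<in> cochains Q I" by (rule bas_in_cochains[OF UB_pair[OF w]])
  have ne: "w \<noteq> []" using w(1) by (simp add: cyclic_def)
  show "coh_diff Q I (bas (UB w)) = 0"
    unfolding UB_def
  proof (rule coh_diff_eq_0[OF UB_pair[OF w, unfolded UB_def]])
    fix c assume "arrows (mk w) \<noteq> [] \<Longrightarrow> bstep c (hd (arrows (mk w)))"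
    then have b: "bstep c (hd w)" using ne by simp
    show False using left[OF bstep_comp[OF b]] bstep_not_gstep[OF b] by simp
  next
    fix c assume "arrows (mk w) \<noteq> [] \<Longrightarrow> bstep (last (arrows (mk w))) c"
    then have b: "bstep (last w) c" using ne by simp
    show False using right[OF bstep_comp[OF b]] bstep_not_gstep[OF b] by simp
  qed
qed

lemma cocycle_UB:
  assumes ds: "ds \<in> brep bstep"
  shows "angle_cocomplete Q (mk ds) \<in> cochains Q I" "coh_diff Q I (angle_cocomplete Q (mk ds)) = 0"
proof -
  have "cyclic bstep (rotate j ds)" for j by (intro cyclic_rotate brep_facts(1) ds)
  then show "angle_cocomplete Q (mk ds) \<in> cochains Q I"
    unfolding angle_cocomplete_eq[OF ds] using cyclic_bstep by (intro sum_in_cochains UB_pair) blast+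
  show "coh_diff Q I (angle_cocomplete Q (mk ds)) = 0"
    unfolding angle_cocomplete_eq[OF ds] by (rule angle_cocomplete_cocycle[OF brep_facts(1)[OF ds]])
qed

text \<open>Extending both components by one arrow would make a single junction both a
  \<open>gstep\<close> and a \<open>bstep\<close>.\<close>

lemma cocycle_arrow:
  assumes c: "c \<in> arcs Q"
  shows "(arrow Q c, arrow Q c) \<in> coh_pairs Q I"
    "bas (arrow Q c, arrow Q c) \<in> cochains Q I" "coh_diff Q I (bas (arrow Q c, arrow Q c)) = 0"
proof -
  show p: "(arrow Q c, arrow Q c) \<in> coh_pairs Q I"
    using arrow_in_paths[OF c] by (simp add: coh_pairs_iff)
  then show "bas (arrow Q c, arrow Q c) \<in> cochains Q I" by (rule bas_in_cochains)
  show "coh_diff Q I (bas (arrow Q c, arrow Q c)) = 0"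
    by (rule coh_diff_eq_0[OF p]) (use bstep_not_gstep in auto)
qed

lemma cocycle_Gam_maximal:
  assumes u: "(y, b) \<in> coh_pairs Q I" and ne: "arrows y \<noteq> []"
    and right: "\<And>c. \<not> gstep (last (arrows y)) c" and left: "\<And>c. \<not> gstep c (hd (arrows y))"
  shows "bas (y, b) \<in> cochains Q I" "coh_diff Q I (bas (y, b)) = 0"
proof -
  show "bas (y, b) \<in> cochains Q I" by (rule bas_in_cochains[OF u])
  show "coh_diff Q I (bas (y, b)) = 0"
    by (rule coh_diff_eq_0[OF u]) (use ne right left in blast)+
qed

lemma cocycle_UG:
  assumes ds: "ds \<in> brep gstep" and w: "1 \<le> w" and sgn: "(-1 :: 'k) ^ length (lpow ds w) = 1"
  shows "angle_complete Q (mk (lpow ds w)) \<in> cochains Q I"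
    "coh_diff Q I (angle_complete Q (mk (lpow ds w))) = 0"
proof -
  have "cyclic gstep (rotate j (lpow ds w))" for j by (intro cyclic_rotate cyclic_lpow brep_facts(1) ds w)
  then show "angle_complete Q (mk (lpow ds w)) \<in> cochains Q I"
    unfolding angle_complete_eq[OF ds w] by (intro sum_in_cochains UG_pair)
  show "coh_diff Q I (angle_complete Q (mk (lpow ds w))) = 0"
    unfolding angle_complete_eq[OF ds w]
    by (rule angle_complete_cocycle[OF brep_facts(1)[OF ds] w sgn])
qed

lemma cap_B_maximal:
  assumes v: "x \<in> hom_chains Q I" and w: "cyclic comp w" "successively bstep w" "butlast w \<noteq> []"
    and right: "\<And>c. comp (last w) c \<Longrightarrow> gstep (last w) c"
    and left: "\<And>c. comp c (hd w) \<Longrightarrow> gstep c (hd w)"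
  shows "bdry (cap_chain Q I x (bas (UB w)))"
proof -
  have "bdry (capb v (UB w))" if "v \<in> Poly_Mapping.keys x" for v
    by (rule capb_B_maximal[OF w right left]) (use that v in \<open>auto simp: hom_chains_def\<close>)
  then show ?thesis
    unfolding cap_chain_eq lin_ext_bas unfolding lin_ext_def by (intro bdry_sum bdry_scale)
qed

text \<open>A pair of degree 0 has no arrow in its \<Gamma>-component that \<open>y\<close> could
  match.\<close>

lemma cap_vertex_zero:
  assumes u: "(y, b) \<in> coh_pairs Q I" "arrows y \<noteq> []"
  shows "e \<in> verts Q \<Longrightarrow> capb (vert e, vert e) (y, b) = 0"
    "es \<in> brep bstep \<Longrightarrow> 1 \<le> k \<Longrightarrow> capb (VB0 (lpow es k)) (y, b) = 0"
proof -
  show "e \<in> verts Q \<Longrightarrow> capb (vert e, vert e) (y, b) = 0"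
    by (rule capb_vert_second[OF vert_pair]) (use u in simp_all)
  assume es: "es \<in> brep bstep" and k: "1 \<le> k"
  show "capb (VB0 (lpow es k)) (y, b) = 0"
    by (rule capb_vert_second[OF VB0_pair[OF cyclic_lpow[OF brep_facts(1)[OF es] k]]])
      (use u in \<open>simp_all add: VB0_def\<close>)
qed

lemma cap_Gam_maximal:
  assumes v: "v \<in> hom_basis Q I rep" and u: "(y, b) \<in> coh_pairs Q I" and ne: "arrows y \<noteq> []"
    and right: "\<And>c. \<not> gstep (last (arrows y)) c" and left: "\<And>c. \<not> gstep c (hd (arrows y))"
    and share: "\<not> share_end y b"
  shows "cap Q I v (coh_class Q I (bas (y, b))) = hom_class Q I 0"
proof -
  note c = cap_classes[OF _ _ cocycle_Gam_maximal[OF u ne right left]]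
  have cb: "cyclic bstep (rotate i (lpow es k))" if "es \<in> brep bstep" "1 \<le> k" for i es k
    using that by (intro cyclic_rotate cyclic_lpow brep_facts(1))
  have cg: "cyclic gstep (rotate i (lpow es k))" if "es \<in> brep gstep" "1 \<le> k" for i es k
    using that by (intro cyclic_rotate cyclic_lpow brep_facts(1))
  from v show ?thesis
  proof (cases rule: hom_basis_cases)
    case (vertex e)
    show ?thesis unfolding vertex(2) c[OF cycle_vert[OF vertex(1)]] cap_chain_linear
      by (simp only: cap_vertex_zero[OF u ne] vertex(1))
  next
    case (co0 es k)
    show ?thesis unfolding co0(3) c[OF cycle_VB0[OF co0(1,2)]] cap_chain_linear
      by (simp only: cap_vertex_zero[OF u ne] co0(1,2))
  next
    case (co1 es k)
    show ?thesis
      unfolding co1(3) c[OF cycle_VB1[OF co1(1,2)]] unfolding bracket_cocomplete_eq[OF co1(1,2)] cap_chain_linear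
      by (simp only: capb_Gam_maximal_VB1[OF cb[OF co1(1,2)] u ne right left share] sum.neutral_const)
  next
    case (com es k)
    show ?thesis
      unfolding com(4) c[OF cycle_VG[OF com(1-3)]] unfolding bracket_complete_eq[OF com(1,2)] cap_chain_linear
      by (simp only: capb_Gam_maximal_VG[OF cg[OF com(1,2)] u ne right left] scale_zero sum.neutral_const)
  next
    case (com' es k)
    have "cyclic gstep (lpow es k)" by (intro cyclic_lpow brep_facts(1) com')
    from capb_Gam_maximal_VG(2)[OF this u ne right left] show ?thesis
      unfolding com'(4) c[OF cycle_VG'[OF com'(1,2)]] cap_chain_linear by (simp only:)
  qed
qed

lemma hom_class_bdry: "bdry x \<Longrightarrow> hom_class Q I x = hom_class Q I 0"
  using hom_class_cong[of x 0] by simp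

end

theorem theorem5p17:
  fixes Q :: "('v, 'a) pre_digraph"
    and I :: "(('v, 'a) path \<Rightarrow>\<^sub>0 'k::field) set"
    and T :: "'a set"
    and rep :: "('v, 'a) path set \<Rightarrow> ('v, 'a) path"
    and u v :: "(('v, 'a) path \<times> ('v, 'a) path \<Rightarrow>\<^sub>0 'k) set"
  assumes "fin_digraph Q" and "connected Q" and "card (verts Q) > 1"
    and "gentle_presentation Q I"
    and "is_spanning_tree Q T"
    and "circuit_reps Q I rep"
    and "u \<in> coh_generators Q I rep T"
    and "v \<in> hom_basis Q I rep"
    and "cap Q I v u \<noteq> hom_class Q I 0"
  shows
   "(\<exists>c \<in> arcs Q - T. \<exists>C \<in> cocomplete_circuits Q I. let C' = bar Q I rep C in
       c \<in> set (arrows C') \<and>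
       u = coh_class Q I (bas (arrow Q c, arrow Q c)) \<and>
       v = hom_class Q I (bracket_cocomplete Q C') \<and>
       cap Q I v u = hom_class Q I (bas (C', vert (src C'))))
  \<or> (\<exists>c \<in> arcs Q - T. \<exists>C \<in> complete_circuits Q I.
       let C' = bar Q I rep C; m = len C'; r = period Q C' in
       c \<in> set (arrows C') \<and>
       (-1 :: 'k) ^ ((m + 1) * r) = 1 \<and>
       u = coh_class Q I (bas (arrow Q c, arrow Q c)) \<and>
       v = hom_class Q I (bracket_complete Q C') \<and>
       cap Q I v u =
         hom_class Q I (scale ((-1) ^ (m + 1)) (bas (last_arrow Q C', drop_last C'))))
  \<or> (\<exists>p \<in> basic_B Q I rep. \<exists>e \<in> verts Q.
       passes Q p e \<ge> 1 \<and>
       u = coh_class Q I (angle_cocomplete Q p) \<and>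
       v = hom_class Q I (bas (vert e, vert e)) \<and>
       cap Q I v u = hom_class Q I (scale (of_nat (passes Q p e)) (bas (p, vert (src p)))))
  \<or> (\<exists>p \<in> basic_B Q I rep. \<exists>k \<ge> 1.
       u = coh_class Q I (angle_cocomplete Q p) \<and>
       v = hom_class Q I (bas (cpow p k, vert (src (cpow p k)))) \<and>
       cap Q I v u = hom_class Q I (bas (cpow p (k + 1), vert (src (cpow p (k + 1))))))
  \<or> (\<exists>p \<in> basic_B Q I rep. \<exists>k \<ge> 1.
       u = coh_class Q I (angle_cocomplete Q p) \<and>
       v = hom_class Q I (bracket_cocomplete Q (cpow p k)) \<and>
       cap Q I v u = hom_class Q I (bracket_cocomplete Q (cpow p (k + 1))))
  \<or> (\<exists>C \<in> complete_circuits Q I. \<exists>D \<in> complete_circuits Q I.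
     \<exists>E \<in> base_circuits Q I. \<exists>w k :: nat.
       let C' = bar Q I rep C; D' = bar Q I rep D; E' = bar Q I rep E;
           n = len D'; r = period Q D' in
       C' \<in> basic_Gam Q I rep \<and>
       (-1 :: 'k) ^ ((n + 1) * r) = 1 \<and>
       k \<ge> w \<and> C' = cpow E' w \<and> D' = cpow E' k \<and>
       u = coh_class Q I (angle_complete Q C') \<and>
       v = hom_class Q I (bracket_complete Q D') \<and>
       cap Q I v u =
         (if k = w
          then hom_class Q I (\<Sum>i<r. scale ((-1) ^ i)
                 (bas (vert (src (rotn Q i E')), vert (src (rotn Q i E')))))
          else hom_class Q I (bracket_complete Q (cpow E' (k - w)))))
  \<or> (\<exists>C \<in> complete_circuits Q I. \<exists>D \<in> complete_circuits Q I.
     \<exists>E \<in> base_circuits Q I. \<exists>w k n :: nat.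
       let C' = bar Q I rep C; D' = bar Q I rep D; E' = bar Q I rep E; t = period Q D' in
       C' \<in> basic_Gam Q I rep \<and>
       len D' = n + 1 \<and> (-1 :: 'k) ^ (n * t) = 1 \<and>
       k > w \<and> C' = cpow E' w \<and> D' = cpow E' k \<and>
       u = coh_class Q I (angle_complete Q C') \<and>
       v = hom_class Q I (bas (last_arrow Q D', drop_last D')) \<and>
       cap Q I v u =
         hom_class Q I (bas (last_arrow Q (cpow E' (k - w)), drop_last (cpow E' (k - w)))))"
proof -
  interpret fin_digraph Q by fact
  interpret gentle_quiver Q I by unfold_locales fact
  interpret based_quiver Q I rep by unfold_locales fact+
  \<comment> \<open>Every combination missing from the list ends here, as does each case where the
    two factors have no common root or arrow.\<close>
  have nz: False if "cap Q I v u = hom_class Q I x" "bdry x" for x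
    using assms(9) that hom_class_bdry by metis
  from assms(7) show ?thesis
  proof (cases rule: coh_generators_cases)
    case (Bmax w)
    obtain x where x: "x \<in> hom_chains Q I" "hom_diff Q I x = 0" "v = hom_class Q I x"
      using assms(8) by (cases rule: hom_basis_cases) (metis cycle_vert cycle_VB0 cycle_VB1 cycle_VG cycle_VG')+
    have "cap Q I v u = hom_class Q I (cap_chain Q I x (bas (UB w)))"
      unfolding x(3) Bmax(6) by (rule cap_classes[OF x(1,2) cocycle_B_maximal[OF Bmax(1,2,4,5)]])
    then have False using cap_B_maximal[OF x(1) Bmax(1-5)] by (rule nz)
    then show ?thesis ..
  next
    case (co ds)
    note c = cap_classes[OF _ _ cocycle_UB[OF co(1)], folded co(2), unfolded angle_cocomplete_eq[OF co(1)]]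
    have cb: "mk ds \<in> basic_B Q I rep" unfolding basic_B_eq using co(1) by blast
    from assms(8) show ?thesis
    proof (cases rule: hom_basis_cases)
      case (vertex e)
      have eq: "cap Q I v u = hom_class Q I (scale (of_nat (passes Q (mk ds) e)) (bas (mk ds, vert (src (mk ds)))))"
        unfolding vertex(2) c[OF cycle_vert[OF vertex(1)]] VB0_eq
        by (rule hom_class_cong[OF cap_UB_vert[OF brep_facts(1)[OF co(1)] vertex(1)]])
      have "passes Q (mk ds) e \<ge> 1"
      proof (rule ccontr)
        assume "\<not> passes Q (mk ds) e \<ge> 1"
        then have "passes Q (mk ds) e = 0" by simp
        then show False using nz[OF eq] by simp
      qed
      with eq cb vertex co(2) show ?thesis by blast
    next
      case (co0 es k)
      have eq: "cap Q I v u = hom_class Q I (if ds = es then bas (VB0 (lpow es (k + 1))) else 0)"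
        unfolding co0(3) c[OF cycle_VB0[OF co0(1,2)]] cap_VB0_UB[OF co0(1,2) co(1)] ..
      have dse: "ds = es" using nz[OF eq] by (cases "ds = es") simp_all
      have "cpow (mk ds) k = mk (lpow ds k)" "cpow (mk ds) (k + 1) = mk (lpow ds (k + 1))"
        using co0(2) by (simp_all only: cpow_mk le_add2)
      then have "v = hom_class Q I (bas (cpow (mk ds) k, vert (src (cpow (mk ds) k))))"
        and "cap Q I v u = hom_class Q I (bas (cpow (mk ds) (k + 1), vert (src (cpow (mk ds) (k + 1)))))"
        using co0(3) dse unfolding eq by (simp_all only: VB0_eq if_True simp_thms)
      with cb co0(2) co(2) show ?thesis by blast
    next
      case (co1 es k)
      have eq: "cap Q I v u = hom_class Q I (if ds = es then bracket_cocomplete Q (mk (lpow es (k + 1))) else 0)"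
        unfolding co1(3) c[OF cycle_VB1[OF co1(1,2)]] unfolding bracket_cocomplete_eq[OF co1(1,2)]
          bracket_cocomplete_eq[OF co1(1) le_add2]
        by (rule hom_class_cong[OF cap_VB1_UB[OF co1(1,2) co(1)]])
      have dse: "ds = es" using nz[OF eq] by (cases "ds = es") simp_all
      have "cpow (mk ds) k = mk (lpow ds k)" "cpow (mk ds) (k + 1) = mk (lpow ds (k + 1))"
        using co1(2) by (simp_all only: cpow_mk le_add2)
      then have "v = hom_class Q I (bracket_cocomplete Q (cpow (mk ds) k))"
        and "cap Q I v u = hom_class Q I (bracket_cocomplete Q (cpow (mk ds) (k + 1)))"
        using co1(3) dse unfolding eq by (simp_all only: if_True simp_thms)
      with cb co1(2) co(2) show ?thesis by blast
    next
      case (com es k)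
      have "cap Q I v u = hom_class Q I (cap_chain Q I (bracket_complete Q (mk (lpow es k)))
          (\<Sum>j<length ds. bas (UB (rotate j ds))))"
        unfolding com(4) by (rule c[OF cycle_VG[OF com(1-3)]])
      moreover have "bdry (cap_chain Q I (bracket_complete Q (mk (lpow es k)))
          (\<Sum>j<length ds. bas (UB (rotate j ds))))"
        unfolding bracket_complete_eq[OF com(1,2)]
        by (rule cap_VG_UB[OF brep_facts(1)[OF com(1)] com(2) brep_facts(1)[OF co(1)] com(3)])
      ultimately have False by (rule nz)
      then show ?thesis ..
    next
      case (com' es k)
      have "cap Q I v u = hom_class Q I (\<Sum>j<length ds. capb (VG' (lpow es k)) (UB (rotate j ds)))"
        unfolding com'(4) c[OF cycle_VG'[OF com'(1,2)]] cap_chain_linear ..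
      moreover have "bdry (\<Sum>j<length ds. capb (VG' (lpow es k)) (UB (rotate j ds)))"
        by (intro bdry_sum capb_VG'_UB cyclic_lpow cyclic_rotate brep_facts(1) co(1) com'(1,2))
      ultimately have False by (rule nz)
      then show ?thesis ..
    qed
  next
    case (arc a)
    then have a: "a \<in> arcs Q" by simp
    note c = cap_classes[OF _ _ cocycle_arrow(2,3)[OF a], folded arc(2)]
    have zero: "capb (vert e, vert e) (arrow Q a, arrow Q a) = 0" if "e \<in> verts Q" for e
      by (rule cap_vertex_zero(1)[OF cocycle_arrow(1)[OF a] _ that]) simp
    from assms(8) show ?thesis
    proof (cases rule: hom_basis_cases)
      case (vertex e)
      have "cap Q I v u = hom_class Q I 0"
        unfolding vertex(2) c[OF cycle_vert[OF vertex(1)]] cap_chain_linear zero[OF vertex(1)] ..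
      with assms(9) show ?thesis by contradiction
    next
      case (co0 es k)
      have "capb (VB0 (lpow es k)) (arrow Q a, arrow Q a) = 0"
        by (rule cap_vertex_zero(2)[OF cocycle_arrow(1)[OF a] _ co0(1,2)]) simp
      then have "cap Q I v u = hom_class Q I 0"
        unfolding co0(3) c[OF cycle_VB0[OF co0(1,2)]] cap_chain_linear by (simp only:)
      with assms(9) show ?thesis by contradiction
    next
      case (co1 es k)
      have eq: "cap Q I v u = hom_class Q I (if a \<in> set es then bas (VB0 (lpow es k)) else 0)"
        unfolding co1(3) c[OF cycle_VB1[OF co1(1,2)]] unfolding bracket_cocomplete_eq[OF co1(1,2)]
        by (rule hom_class_cong[OF cap_VB1_arrow[OF co1(1,2) a]])
      have ain: "a \<in> set es" using nz[OF eq] by (cases "a \<in> set es") simp_all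
      let ?C = "circuit_of Q (mk (lpow es k))"
      have C: "?C \<in> cocomplete_circuits Q I" "bar Q I rep ?C = mk (lpow es k)"
        using brep_circ[OF stepping(2) co1(1,2)] bar_lpow[OF stepping(2) co1(1,2)]
        by (simp_all add: circuits_eq_circ)
      have "a \<in> set (arrows (mk (lpow es k)))" using ain set_lpow[OF co1(2), of es] by simp
      moreover have "cap Q I v u = hom_class Q I (bas (mk (lpow es k), vert (src (mk (lpow es k)))))"
        unfolding eq VB0_eq using ain by simp
      ultimately show ?thesis
        by (intro disjI1 bexI[OF _ arc(1)] bexI[OF _ C(1)]) (simp only: C(2) Let_def co1(3) arc(2) simp_thms)
    next
      case (com es k)
      let ?m = "length (lpow es k)"
      have eq: "cap Q I v u = hom_class Q I (if a \<in> set es then scale ((-1) ^ (?m + 1)) (bas (VG' (lpow es k))) else 0)"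
        unfolding com(4) c[OF cycle_VG[OF com(1-3)]] unfolding bracket_complete_eq[OF com(1,2)]
        by (rule hom_class_cong[OF cap_VG_arrow[OF com(1,2) a]])
      have ain: "a \<in> set es" using nz[OF eq] by (cases "a \<in> set es") simp_all
      let ?C = "circuit_of Q (mk (lpow es k))"
      have C: "?C \<in> complete_circuits Q I" "bar Q I rep ?C = mk (lpow es k)"
        using brep_circ[OF stepping(1) com(1,2)] bar_lpow[OF stepping(1) com(1,2)]
        by (simp_all add: circuits_eq_circ)
      have "a \<in> set (arrows (mk (lpow es k)))" using ain set_lpow[OF com(2), of es] by simp
      moreover have "cap Q I v u = hom_class Q I (scale ((-1) ^ (len (mk (lpow es k)) + 1))
          (bas (last_arrow Q (mk (lpow es k)), drop_last (mk (lpow es k)))))"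
        unfolding eq VG'_eq using ain by simp
      moreover have "(-1 :: 'k) ^ ((len (mk (lpow es k)) + 1) * period Q (mk (lpow es k))) = 1"
        unfolding period_mk_lpow[OF brep_facts(2,3)[OF com(1)] com(2)] arrows_mk by (rule com(3))
      ultimately show ?thesis
        by (intro disjI2[OF disjI1] bexI[OF _ arc(1)] bexI[OF _ C(1)]) (simp only: C(2) Let_def com(4) arc(2) simp_thms)
    next
      case (com' es k)
      have "capb (VG' (lpow es k)) (arrow Q a, arrow Q a) = 0"
        by (intro capb_VG'_arrow cyclic_lpow brep_facts(1) com'(1,2) a)
      then have "cap Q I v u = hom_class Q I 0"
        unfolding com'(4) c[OF cycle_VG'[OF com'(1,2)]] cap_chain_linear by (simp only:)
      with assms(9) show ?thesis by contradiction
    qed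
  next
    case (Gmax y b)
    then show ?thesis using cap_Gam_maximal[OF assms(8) Gmax(1-5)] assms(9) by simp
  next
    case (com ds w)
    note c = cap_classes[OF _ _ cocycle_UG[OF com(1-3)], folded com(5), unfolded angle_complete_eq[OF com(1,2)]]
    have cw: "cyclic gstep (rotate j (lpow ds w))" for j by (intro cyclic_rotate cyclic_lpow brep_facts(1) com(1,2))
    have ne: "arrows (mk (rotate j (lpow ds w))) \<noteq> []" for j using cw[of j] by (simp add: cyclic_def)
    note zero = cap_vertex_zero[OF UG_pair[OF cw, unfolded UG_def] ne, folded UG_def]
    let ?C = "circuit_of Q (mk (lpow ds w))"
    have C: "?C \<in> complete_circuits Q I" "bar Q I rep ?C = mk (lpow ds w)"
      using brep_circ[OF stepping(1) com(1,2)] bar_lpow[OF stepping(1) com(1,2)]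
      by (simp_all add: circuits_eq_circ)
    \<comment> \<open>The primitive circuit of the last two cases is that of the root
      \<open>ds\<close>; the exponents come from the generator and from the basis element.\<close>
    let ?E = "circuit_of Q (mk ds)"
    have E: "?E \<in> base_circuits Q I" "bar Q I rep ?E = mk ds"
      using brep_circuit(2)[OF stepping(1) com(1)] bar_lpow[OF stepping(1) com(1), of 1] by simp_all
    from assms(8) show ?thesis
    proof (cases rule: hom_basis_cases)
      case (vertex e)
      have "cap Q I v u = hom_class Q I 0"
        unfolding vertex(2) c[OF cycle_vert[OF vertex(1)]] cap_chain_linear
        by (simp only: zero(1)[OF vertex(1)] sum.neutral_const)
      with assms(9) show ?thesis by contradiction
    next
      case (co0 es k)
      have "cap Q I v u = hom_class Q I 0"
        unfolding co0(3) c[OF cycle_VB0[OF co0(1,2)]] cap_chain_linear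
        by (simp only: zero(2)[OF co0(1,2)] sum.neutral_const)
      with assms(9) show ?thesis by contradiction
    next
      case (co1 es k)
      let ?x = "cap_chain Q I (\<Sum>i<length es. bas (VB1 (rotate i (lpow es k))))
        (\<Sum>j<length ds. bas (UG (rotate j (lpow ds w))))"
      have "cap Q I v u = hom_class Q I ?x"
        unfolding co1(3) c[OF cycle_VB1[OF co1(1,2)]] unfolding bracket_cocomplete_eq[OF co1(1,2)] ..
      moreover have "bdry ?x"
        unfolding cap_chain_linear
        by (intro bdry_sum cap_VB1_UG cw cyclic_rotate cyclic_lpow brep_facts(1) co1(1,2))
      ultimately have False by (rule nz)
      then show ?thesis ..
    next
      case v: (com es k)
      let ?m = "length (lpow es k)" and ?r = "length es"
      let ?s = "\<lambda>i. (-1 :: 'k) ^ ((?m + 1) * i)"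
      have eq: "cap Q I v u = hom_class Q I (if ds = es \<and> w \<le> k then \<Sum>i<?r. scale (?s i)
        (bas (vert (tail Q (last (rotate i es))),
          Path (tail Q (last (rotate i es))) (rotate i (lpow es (k - w))))) else 0)"
        unfolding v(4) c[OF cycle_VG[OF v(1-3)]] unfolding bracket_complete_eq[OF v(1,2)]
          cap_VG_UG[OF v(1,2) com(1-3)] ..
      have dw: "ds = es" "w \<le> k" using nz[OF eq] by (cases "ds = es \<and> w \<le> k"; simp)+
      let ?D = "circuit_of Q (mk (lpow ds k))"
      have D: "?D \<in> complete_circuits Q I" "bar Q I rep ?D = mk (lpow ds k)"
        using brep_circ[OF stepping(1) com(1) v(2)] bar_lpow[OF stepping(1) com(1) v(2)]
        by (simp_all add: circuits_eq_circ)
      have p: "period Q (mk (lpow ds k)) = length ds"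
        by (rule period_mk_lpow[OF brep_facts(2,3)[OF com(1)] v(2)])
      have ne: "ds \<noteq> []" by (rule brep_facts(3)[OF com(1)])
      have cap: "cap Q I v u = (if k = w
          then hom_class Q I (\<Sum>i<length ds. scale ((-1) ^ i)
                 (bas (vert (src (rotn Q i (mk ds))), vert (src (rotn Q i (mk ds))))))
          else hom_class Q I (bracket_complete Q (cpow (mk ds) (k - w))))"
      proof (cases "k = w")
        case True
        \<comment> \<open>For \<open>k = w\<close> the length \<open>?m\<close> is that of the
          generator and has sign 1.\<close>
        have "?s i = (-1) ^ i" for i
          using com(3) True dw(1) by (simp add: power_add power_mult)
        then show ?thesis
          unfolding eq using dw True by (simp add: rotn_mk[OF ne[unfolded dw(1)]] vert_def)
      next
        case False
        then have kw: "1 \<le> k - w" "k - w + w = k" using dw(2) by simp_all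
        \<comment> \<open>The two lengths differ by that of the generator, which has sign 1.\<close>
        have "?s i = (-1) ^ ((length (lpow es (k - w)) + 1) * i)" for i
        proof -
          have "?m = length (lpow es (k - w)) + length (lpow ds w)"
            using kw(2) by (simp add: dw(1) flip: add_mult_distrib)
          then have "(-1 :: 'k) ^ (?m + 1) = (-1) ^ (length (lpow es (k - w)) + 1)"
            using com(3) by (simp only: power_add mult_1_right)
          then show ?thesis by (simp only: power_mult)
        qed
        then show ?thesis
          unfolding eq cpow_mk[OF kw(1)] dw(1) bracket_complete_eq[OF v(1) kw(1)]
          using False dw kw(1) by (simp add: VG_def mk_def rotate_lpow)
      qed
      have sg: "(-1 :: 'k) ^ ((len (mk (lpow ds k)) + 1) * length ds) = 1"
        unfolding arrows_mk dw(1) by (rule v(3))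
      have vD: "v = hom_class Q I (bracket_complete Q (mk (lpow ds k)))"
        unfolding dw(1) by (rule v(4))
      have pow: "mk (lpow ds w) = cpow (mk ds) w" "mk (lpow ds k) = cpow (mk ds) k"
        by (simp_all only: cpow_mk com(2) v(2))
      have "\<exists>C \<in> complete_circuits Q I. \<exists>D \<in> complete_circuits Q I.
     \<exists>E \<in> base_circuits Q I. \<exists>w k :: nat.
       let C' = bar Q I rep C; D' = bar Q I rep D; E' = bar Q I rep E;
           n = len D'; r = period Q D' in
       C' \<in> basic_Gam Q I rep \<and>
       (-1 :: 'k) ^ ((n + 1) * r) = 1 \<and>
       k \<ge> w \<and> C' = cpow E' w \<and> D' = cpow E' k \<and>
       u = coh_class Q I (angle_complete Q C') \<and>
       v = hom_class Q I (bracket_complete Q D') \<and>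
       cap Q I v u =
         (if k = w
          then hom_class Q I (\<Sum>i<r. scale ((-1) ^ i)
                 (bas (vert (src (rotn Q i E')), vert (src (rotn Q i E')))))
          else hom_class Q I (bracket_complete Q (cpow E' (k - w))))"
        unfolding Let_def
        by (rule bexI[OF _ C(1)], rule bexI[OF _ D(1)], rule bexI[OF _ E(1)], rule exI[of _ w],
            rule exI[of _ k], unfold C(2) D(2) E(2) p, intro conjI)
          (fact com(4) sg dw(2) pow com(5) vD cap)+
      then show ?thesis by blast
    next
      case v: (com' es k)
      have eq: "cap Q I v u = hom_class Q I (if ds = es \<and> w < k then bas (VG' (lpow es (k - w))) else 0)"
        unfolding v(4) c[OF cycle_VG'[OF v(1,2)]] cap_VG'_UG[OF v(1,2) com(1-3)] ..
      have dw: "ds = es" "w < k" using nz[OF eq] by (cases "ds = es \<and> w < k"; simp)+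
      let ?D = "circuit_of Q (mk (lpow ds k))"
      have D: "?D \<in> complete_circuits Q I" "bar Q I rep ?D = mk (lpow ds k)"
        using brep_circ[OF stepping(1) com(1) v(2)] bar_lpow[OF stepping(1) com(1) v(2)]
        by (simp_all add: circuits_eq_circ)
      have p: "period Q (mk (lpow ds k)) = length ds"
        by (rule period_mk_lpow[OF brep_facts(2,3)[OF com(1)] v(2)])
      have kw: "1 \<le> k - w" using dw(2) by simp
      have cap: "cap Q I v u =
         hom_class Q I (bas (last_arrow Q (cpow (mk ds) (k - w)), drop_last (cpow (mk ds) (k - w))))"
        unfolding eq cpow_mk[OF kw] VG'_eq using dw by simp
      obtain n where n: "length (lpow ds k) = n + 1"
        using v(2) brep_facts(3)[OF com(1)] by (metis Suc_eq_plus1 length_0_conv lpow_eq_Nil_iff not0_implies_Suc not_one_le_zero)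
      have sg: "(-1 :: 'k) ^ (n * period Q (mk (lpow ds k))) = 1"
      proof -
        \<comment> \<open>The basis condition involves the length plus one, here n + 2, which has
          the parity of n.\<close>
        have "(-1 :: 'k) ^ ((n + 1 + 1) * length ds) = 1" using v(3) n by (simp only: dw(1))
        moreover have "(n + 1 + 1) * length ds = n * length ds + 2 * length ds" by simp
        ultimately have "(-1 :: 'k) ^ (n * length ds + 2 * length ds) = 1" by (simp only:)
        then show ?thesis unfolding p by (simp add: power_add power_mult)
      qed
      have len: "len (mk (lpow ds k)) = n + 1" using n by simp
      have vD: "v = hom_class Q I (bas (last_arrow Q (mk (lpow ds k)), drop_last (mk (lpow ds k))))"
        unfolding VG'_eq dw(1) by (rule v(4))
      have pow: "mk (lpow ds w) = cpow (mk ds) w" "mk (lpow ds k) = cpow (mk ds) k"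
        by (simp_all only: cpow_mk com(2) v(2))
      have "\<exists>C \<in> complete_circuits Q I. \<exists>D \<in> complete_circuits Q I.
     \<exists>E \<in> base_circuits Q I. \<exists>w k n :: nat.
       let C' = bar Q I rep C; D' = bar Q I rep D; E' = bar Q I rep E; t = period Q D' in
       C' \<in> basic_Gam Q I rep \<and>
       len D' = n + 1 \<and> (-1 :: 'k) ^ (n * t) = 1 \<and>
       k > w \<and> C' = cpow E' w \<and> D' = cpow E' k \<and>
       u = coh_class Q I (angle_complete Q C') \<and>
       v = hom_class Q I (bas (last_arrow Q D', drop_last D')) \<and>
       cap Q I v u =
         hom_class Q I (bas (last_arrow Q (cpow E' (k - w)), drop_last (cpow E' (k - w))))"
        unfolding Let_def
        by (rule bexI[OF _ C(1)], rule bexI[OF _ D(1)], rule bexI[OF _ E(1)], rule exI[of _ w],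
            rule exI[of _ k], rule exI[of _ n], unfold C(2) D(2) E(2), intro conjI)
          (fact com(4) len sg dw(2) pow com(5) vD cap)+
      then show ?thesis by blast
    qed
  qed
qed

end
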